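(* Let $d,k$ be integers with $k > d \ge 3$. Then the system $(X,m_X,T)$ is not weakly contained in a Bernoulli system; that is, it is not weakly contained in any Bernoulli shift $(\mathtt{K}^\Gamma,\kappa^\Gamma,T)$ over $\Gamma=\Gamma_{d,k}$.
   Context: $\Gamma=\Gamma_{d,k}=\langle s_1,\dots,s_d : s_1^k=\dots=s_d^k=e\rangle$ is the free product of $d$ copies of $\mathbb{Z}_k=\mathbb{Z}/k\mathbb{Z}$. $X\le \mathbb{Z}_2^\Gamma$ is the closed subgroup $$X=\Big\{x\in\mathbb{Z}_2^\Gamma : \sum_{j=0}^{k-1}x_{gs_i^j}=0 \ \ \forall g\in\Gamma,\ i=1,\dots,d\Big\},$$ $m_X$ is its Haar probability measure, and $T$ is the shift action $(T^gx)_h=x_{g^{-1}h}$ of $\Gamma$. The Bernoulli shift with standard probability base space $(\mathtt{K},\kappa)$ is $(\mathtt{K}^\Gamma,\kappa^\Gamma,T)$ with the shift action. A probability-measure-preserving $\Gamma$-system $(Y,\nu,S)$ is weakly contained in $(Z,\theta,R)$ if for all measurable $A_1,\dots,A_m\subset Y$, every finite $F\subset\Gamma$ and every $\varepsilon>0$ there are measurable $B_1,\dots,B_m\subset Z$ with $|\nu(S^gA_i\cap A_j)-\theta(R^gB_i\cap B_j)|<\varepsilon$ for all $g\in F$ and $1\le i,j\le m$. *)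

theory Defs
  imports "HOL-Probability.Probability" "HOL-Algebra.Group" "HOL-Library.Z2"
begin

text \<open>
  A letter \<open>(a, True)\<close> stands for the generator \<open>a\<close> and \<open>(a, False)\<close> for its formal inverse.
  Words over \<open>S\<close> are identified under the congruence generated by free cancellation and
  by deletion of the relators in \<open>R\<close>.
\<close>

type_synonym 'a gword = "('a \<times> bool) list"

abbreviation words :: "'a set \<Rightarrow> 'a gword set" where
  "words S \<equiv> lists (S \<times> UNIV)"

inductive_set pres_rel :: "'a set \<Rightarrow> 'a gword set \<Rightarrow> 'a gword rel"
  for S :: "'a set" and R :: "'a gword set" where
  refl: "w \<in> words S \<Longrightarrow> (w, w) \<in> pres_rel S R"
| sym: "(u, v) \<in> pres_rel S R \<Longrightarrow> (v, u) \<in> pres_rel S R"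
| trans: "(u, v) \<in> pres_rel S R \<Longrightarrow> (v, w) \<in> pres_rel S R \<Longrightarrow> (u, w) \<in> pres_rel S R"
| cancel: "u \<in> words S \<Longrightarrow> v \<in> words S \<Longrightarrow> a \<in> S \<Longrightarrow>
    (u @ [(a, b), (a, \<not> b)] @ v, u @ v) \<in> pres_rel S R"
| relator: "u \<in> words S \<Longrightarrow> v \<in> words S \<Longrightarrow> r \<in> R \<Longrightarrow> r \<in> words S \<Longrightarrow>
    (u @ r @ v, u @ v) \<in> pres_rel S R"

definition word_class :: "'a set \<Rightarrow> 'a gword set \<Rightarrow> 'a gword \<Rightarrow> 'a gword set" where
  "word_class S R w = pres_rel S R `` {w}"

definition presented_group :: "'a set \<Rightarrow> 'a gword set \<Rightarrow> 'a gword set monoid" where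
  "presented_group S R =
    \<lparr>carrier = words S // pres_rel S R,
     mult = (\<lambda>A B. \<Union>u\<in>A. \<Union>v\<in>B. word_class S R (u @ v)),
     one = word_class S R []\<rparr>"

lemma pres_rel_words: "(u, v) \<in> pres_rel S R \<Longrightarrow> u \<in> words S \<and> v \<in> words S"
  by (induction rule: pres_rel.induct) auto

lemma equiv_pres_rel: "equiv (words S) (pres_rel S R)"
proof (rule equivI)
  show "pres_rel S R \<subseteq> words S \<times> words S"
    using pres_rel_words by fast
  show "refl_on (words S) (pres_rel S R)"
    by (auto simp: refl_on_def intro: pres_rel.refl)
  show "sym (pres_rel S R)"
    by (auto simp: sym_def intro: pres_rel.sym)
  show "trans (pres_rel S R)"
    by (meson pres_rel.trans transI)
qed

lemma pres_rel_context:
  assumes "(u, v) \<in> pres_rel S R" "p \<in> words S" "q \<in> words S"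
  shows "(p @ u @ q, p @ v @ q) \<in> pres_rel S R"
  using assms
proof (induction rule: pres_rel.induct)
  case (refl w)
  then show ?case by (intro pres_rel.refl) auto
next
  case (sym u v)
  then show ?case by (blast intro: pres_rel.sym)
next
  case (trans u v w)
  then show ?case by (blast intro: pres_rel.trans)
next
  case (cancel u v a b)
  then show ?case using pres_rel.cancel[of "p @ u" S "v @ q" a b R] by simp
next
  case (relator u v r)
  then show ?case using pres_rel.relator[of "p @ u" S "v @ q" r R] by simp
qed

lemma pres_rel_append:
  assumes "(u, u') \<in> pres_rel S R" "(v, v') \<in> pres_rel S R"
  shows "(u @ v, u' @ v') \<in> pres_rel S R"
proof (rule pres_rel.trans)
  show "(u @ v, u' @ v) \<in> pres_rel S R"
    using pres_rel_context[OF assms(1), of "[]" v] pres_rel_words[OF assms(2)] by simp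
  show "(u' @ v, u' @ v') \<in> pres_rel S R"
    using pres_rel_context[OF assms(2), of u' "[]"] pres_rel_words[OF assms(1)] by simp
qed

lemma word_class_eq_iff:
  "u \<in> words S \<Longrightarrow> v \<in> words S \<Longrightarrow>
    word_class S R u = word_class S R v \<longleftrightarrow> (u, v) \<in> pres_rel S R"
  unfolding word_class_def by (rule eq_equiv_class_iff[OF equiv_pres_rel])

lemma carrier_presented_group: "carrier (presented_group S R) = word_class S R ` words S"
  by (auto simp: presented_group_def quotient_def word_class_def)

lemma one_presented_group: "\<one>\<^bsub>presented_group S R\<^esub> = word_class S R []"
  by (simp add: presented_group_def)

lemma mult_word_class:
  assumes "u \<in> words S" "v \<in> words S"
  shows "word_class S R u \<otimes>\<^bsub>presented_group S R\<^esub> word_class S R v = word_class S R (u @ v)"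
proof -
  have *: "word_class S R (u' @ v') = word_class S R (u @ v)"
    if "u' \<in> word_class S R u" "v' \<in> word_class S R v" for u' v'
  proof -
    have "(u @ v, u' @ v') \<in> pres_rel S R"
      using that pres_rel_append by (auto simp: word_class_def)
    then show ?thesis
      unfolding word_class_def by (rule equiv_class_eq[OF equiv_pres_rel, symmetric])
  qed
  moreover have "u \<in> word_class S R u" "v \<in> word_class S R v"
    using assms by (auto simp: word_class_def intro: pres_rel.refl)
  ultimately have "(\<Union>u'\<in>word_class S R u. \<Union>v'\<in>word_class S R v. word_class S R (u' @ v'))
      = word_class S R (u @ v)"
    by blast
  then show ?thesis
    by (simp add: presented_group_def)
qed

lemma pres_rel_inverse:
  "w \<in> words S \<Longrightarrow> (map (\<lambda>(a, b). (a, \<not> b)) (rev w) @ w, []) \<in> pres_rel S R"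
proof (induction w)
  case Nil
  then show ?case by (simp add: pres_rel.refl)
next
  case (Cons x w)
  obtain a b where x: "x = (a, b)" by fastforce
  let ?i = "map (\<lambda>(a, b). (a, \<not> b)) (rev w)"
  have i: "?i \<in> words S" using Cons.prems by auto
  have "(?i @ [(a, \<not> b), (a, \<not> \<not> b)] @ w, ?i @ w) \<in> pres_rel S R"
    using Cons.prems x i by (intro pres_rel.cancel) auto
  moreover have "(?i @ w, []) \<in> pres_rel S R"
    using Cons by auto
  ultimately show ?case using x by (auto intro: pres_rel.trans)
qed

lemma group_presented_group: "group (presented_group S R)"
proof (rule groupI)
  let ?G = "presented_group S R"
  show "\<one>\<^bsub>?G\<^esub> \<in> carrier ?G"
    by (auto simp: one_presented_group carrier_presented_group)
  fix x assume "x \<in> carrier ?G"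
  then obtain u where u: "u \<in> words S" "x = word_class S R u"
    by (auto simp: carrier_presented_group)
  show "\<one>\<^bsub>?G\<^esub> \<otimes>\<^bsub>?G\<^esub> x = x"
    using u by (simp add: one_presented_group mult_word_class)
  let ?i = "map (\<lambda>(a, b). (a, \<not> b)) (rev u)"
  have i: "?i \<in> words S" using u(1) by auto
  have "word_class S R ?i \<otimes>\<^bsub>?G\<^esub> x = \<one>\<^bsub>?G\<^esub>"
    unfolding u(2) mult_word_class[OF i u(1)] one_presented_group
    using word_class_eq_iff[THEN iffD2, OF _ _ pres_rel_inverse[OF u(1)]] i u(1)
    by (metis append_in_lists_conv lists.Nil)
  moreover have "word_class S R ?i \<in> carrier ?G"
    unfolding carrier_presented_group using i by (rule imageI)
  ultimately show "\<exists>y\<in>carrier ?G. y \<otimes>\<^bsub>?G\<^esub> x = \<one>\<^bsub>?G\<^esub>" ..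
  fix y assume "y \<in> carrier ?G"
  then obtain v where v: "v \<in> words S" "y = word_class S R v"
    by (auto simp: carrier_presented_group)
  have uv: "u @ v \<in> words S" using u v by simp
  show "x \<otimes>\<^bsub>?G\<^esub> y \<in> carrier ?G"
    unfolding u(2) v(2) mult_word_class[OF u(1) v(1)] carrier_presented_group
    using uv by (rule imageI)
  fix z assume "z \<in> carrier ?G"
  then obtain w where w: "w \<in> words S" "z = word_class S R w"
    by (auto simp: carrier_presented_group)
  have vw: "v @ w \<in> words S" using w v by simp
  show "x \<otimes>\<^bsub>?G\<^esub> y \<otimes>\<^bsub>?G\<^esub> z = x \<otimes>\<^bsub>?G\<^esub> (y \<otimes>\<^bsub>?G\<^esub> z)"
    unfolding u(2) v(2) w(2) mult_word_class[OF u(1) v(1)] mult_word_class[OF v(1) w(1)]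
      mult_word_class[OF uv w(1)] mult_word_class[OF u(1) vw] append_assoc ..
qed

text \<open>
  \<open>Gamma_group d k\<close> is \<open>\<langle>s\<^sub>1, \<dots>, s\<^sub>d : s\<^sub>1\<^sup>k = \<dots> = s\<^sub>d\<^sup>k = e\<rangle>\<close>; unrelated to the Gamma function
  of \<open>HOL-Analysis\<close>.
\<close>

definition Gamma_gens :: "nat \<Rightarrow> nat set" where
  "Gamma_gens d = {1..d}"

definition Gamma_rels :: "nat \<Rightarrow> nat \<Rightarrow> nat gword set" where
  "Gamma_rels d k = {replicate k (i, True) |i. i \<in> {1..d}}"

definition Gamma_group :: "nat \<Rightarrow> nat \<Rightarrow> nat gword set monoid" where
  "Gamma_group d k = presented_group (Gamma_gens d) (Gamma_rels d k)"

definition Gamma_gen :: "nat \<Rightarrow> nat \<Rightarrow> nat \<Rightarrow> nat gword set" where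
  "Gamma_gen d k i = word_class (Gamma_gens d) (Gamma_rels d k) [(i, True)]"

lemma group_Gamma: "group (Gamma_group d k)"
  unfolding Gamma_group_def by (rule group_presented_group)

definition borel_of :: "'a topology \<Rightarrow> 'a measure" where
  "borel_of T = sigma (topspace T) {U. openin T U}"

text \<open>
  Standard means that the measurable space is standard Borel, i.e. the Borel space of a Polish
  topology (for metrizable spaces, second countable is the same as separable).
\<close>

definition standard_prob_space :: "'a measure \<Rightarrow> bool" where
  "standard_prob_space M \<longleftrightarrow> prob_space M \<and>
    (\<exists>T. completely_metrizable_space T \<and> second_countable T \<and> sets M = sets (borel_of T))"

text \<open>
  Regularity is not imposed: it is automatic for Borel probability measures on
  compact metrizable groups, the only case in which the definition is used.
\<close>

definition haar_prob_measure :: "('a, 'b) monoid_scheme \<Rightarrow> 'a topology \<Rightarrow> 'a measure \<Rightarrow> bool" where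
  "haar_prob_measure G T m \<longleftrightarrow> prob_space m \<and> sets m = sets (borel_of T) \<and>
    (\<forall>g\<in>carrier G. \<forall>A\<in>sets m. emeasure m ((\<lambda>x. g \<otimes>\<^bsub>G\<^esub> x) ` A) = emeasure m A)"

definition shift :: "('g, 'b) monoid_scheme \<Rightarrow> 'g \<Rightarrow> ('g \<Rightarrow> 'a) \<Rightarrow> 'g \<Rightarrow> 'a" where
  "shift G g x = (\<lambda>h\<in>carrier G. x (inv\<^bsub>G\<^esub> g \<otimes>\<^bsub>G\<^esub> h))"

definition bernoulli :: "('g, 'b) monoid_scheme \<Rightarrow> 'a measure \<Rightarrow> ('g \<Rightarrow> 'a) measure" where
  "bernoulli G \<kappa> = (\<Pi>\<^sub>M g\<in>carrier G. \<kappa>)"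

text \<open>
  That \<open>(M, S)\<close> and \<open>(N, R)\<close> are probability-measure-preserving systems is deliberately not part
  of the definition, so that a negated weak containment cannot hold for that reason.
\<close>

definition weakly_contained ::
  "('g, 'b) monoid_scheme \<Rightarrow> 'y measure \<Rightarrow> ('g \<Rightarrow> 'y \<Rightarrow> 'y) \<Rightarrow> 'z measure \<Rightarrow> ('g \<Rightarrow> 'z \<Rightarrow> 'z) \<Rightarrow> bool"
  where
  "weakly_contained G M S N R \<longleftrightarrow>
    (\<forall>(n::nat) A F (\<epsilon>::real).
      (\<forall>i\<in>{1..n}. A i \<in> sets M) \<and> finite F \<and> F \<subseteq> carrier G \<and> \<epsilon> > 0 \<longrightarrow>
      (\<exists>B. (\<forall>i\<in>{1..n}. B i \<in> sets N) \<and>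
        (\<forall>g\<in>F. \<forall>i\<in>{1..n}. \<forall>j\<in>{1..n}.
          \<bar>measure M (S g ` A i \<inter> A j) - measure N (R g ` B i \<inter> B j)\<bar> < \<epsilon>)))"

definition parity_shift :: "nat \<Rightarrow> nat \<Rightarrow> (nat gword set \<Rightarrow> bit) set" where
  "parity_shift d k =
    {x \<in> carrier (Gamma_group d k) \<rightarrow>\<^sub>E UNIV.
      \<forall>g\<in>carrier (Gamma_group d k). \<forall>i\<in>{1..d}.
        (\<Sum>j<k. x (g \<otimes>\<^bsub>Gamma_group d k\<^esub> (Gamma_gen d k i [^]\<^bsub>Gamma_group d k\<^esub> j))) = 0}"

text \<open>
  \<open>\<int>\<^sub>2\<close>-valued configurations are extensional functions, hence the restricted operations.
\<close>

definition parity_group :: "nat \<Rightarrow> nat \<Rightarrow> (nat gword set \<Rightarrow> bit) monoid" where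
  "parity_group d k =
    \<lparr>carrier = parity_shift d k,
     mult = (\<lambda>x y. \<lambda>g\<in>carrier (Gamma_group d k). x g + y g),
     one = (\<lambda>g\<in>carrier (Gamma_group d k). 0)\<rparr>"

definition parity_topology :: "nat \<Rightarrow> nat \<Rightarrow> (nat gword set \<Rightarrow> bit) topology" where
  "parity_topology d k =
    subtopology (product_topology (\<lambda>_. discrete_topology UNIV) (carrier (Gamma_group d k)))
      (parity_shift d k)"

lemma Gamma_gen_closed: "i \<in> {1..d} \<Longrightarrow> Gamma_gen d k i \<in> carrier (Gamma_group d k)"
  by (auto simp: Gamma_gen_def Gamma_group_def carrier_presented_group Gamma_gens_def)

lemma comm_group_parity_group: "comm_group (parity_group d k)"
proof (rule comm_groupI)
  let ?G = "Gamma_group d k" and ?P = "parity_group d k"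
  interpret group ?G by (rule group_Gamma)
  have cl: "g \<otimes>\<^bsub>?G\<^esub> (Gamma_gen d k i [^]\<^bsub>?G\<^esub> j) \<in> carrier ?G"
    if "g \<in> carrier ?G" "i \<in> {1..d}" for g i and j :: nat
    using that Gamma_gen_closed by simp
  show "\<one>\<^bsub>?P\<^esub> \<in> carrier ?P"
    using cl by (auto simp: parity_group_def parity_shift_def)
  fix x assume x: "x \<in> carrier ?P"
  show "\<one>\<^bsub>?P\<^esub> \<otimes>\<^bsub>?P\<^esub> x = x"
    using x by (auto simp: parity_group_def parity_shift_def PiE_def extensional_def fun_eq_iff)
  have "x \<otimes>\<^bsub>?P\<^esub> x = \<one>\<^bsub>?P\<^esub>"
    by (auto simp: parity_group_def fun_eq_iff)
  then show "\<exists>y\<in>carrier ?P. y \<otimes>\<^bsub>?P\<^esub> x = \<one>\<^bsub>?P\<^esub>"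
    using x by blast
  fix y assume y: "y \<in> carrier ?P"
  show "x \<otimes>\<^bsub>?P\<^esub> y \<in> carrier ?P"
  proof -
    let ?s = "\<lambda>g i j. g \<otimes>\<^bsub>?G\<^esub> (Gamma_gen d k i [^]\<^bsub>?G\<^esub> j)"
    have "(\<Sum>j<k. (x \<otimes>\<^bsub>?P\<^esub> y) (?s g i j)) = 0" if gi: "g \<in> carrier ?G" "i \<in> {1..d}" for g i
    proof -
      have "(\<Sum>j<k. (x \<otimes>\<^bsub>?P\<^esub> y) (?s g i j)) = (\<Sum>j<k. x (?s g i j) + y (?s g i j))"
        using cl[OF gi] by (simp add: parity_group_def del: add_bit_eq_xor)
      also have "\<dots> = (\<Sum>j<k. x (?s g i j)) + (\<Sum>j<k. y (?s g i j))"
        by (rule sum.distrib)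
      also have "\<dots> = 0"
        using x y gi by (simp add: parity_group_def parity_shift_def)
      finally show ?thesis .
    qed
    moreover have "x \<otimes>\<^bsub>?P\<^esub> y \<in> carrier ?G \<rightarrow>\<^sub>E UNIV"
      by (simp add: parity_group_def)
    ultimately show ?thesis
      by (simp add: parity_group_def parity_shift_def)
  qed
  show "x \<otimes>\<^bsub>?P\<^esub> y = y \<otimes>\<^bsub>?P\<^esub> x"
    by (auto simp: parity_group_def fun_eq_iff add.commute simp del: add_bit_eq_xor)
  fix z assume z: "z \<in> carrier ?P"
  show "x \<otimes>\<^bsub>?P\<^esub> y \<otimes>\<^bsub>?P\<^esub> z = x \<otimes>\<^bsub>?P\<^esub> (y \<otimes>\<^bsub>?P\<^esub> z)"
    by (auto simp: parity_group_def fun_eq_iff add.assoc simp del: add_bit_eq_xor)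
qed

end

theory Submission
  imports Defs "HOL-Algebra.Bij" "HOL-Algebra.Elementary_Groups"
begin

text \<open>
  Weak containment in a Bernoulli shift would give an equivariant \<open>{0,1}\<close>-valued map \<open>z\<close>, depending on
  finitely many i.i.d. seeds, with density near \<open>1/2\<close> and with even parity on almost every coset
  \<open>g\<langle>s\<^sub>i\<rangle>\<close>. Resampling each seed with probability \<open>t\<close> and adding the two outputs gives a map \<open>h\<close> of
  the same kind whose density moves continuously from \<open>0\<close>, so it can be made equal to a tiny \<open>\<delta>\<close>.
  Even parity forces a nonzero pattern on a coset to contain at least two ones, so such a pattern
  has entropy at most about \<open>(k/2) \<delta> ln (1/\<delta>)\<close>. On the other hand functions of i.i.d. seeds satisfy
  \<open>\<Sum>\<^sub>i H(h on \<langle>s\<^sub>i\<rangle>) \<ge> k (d - 1) H(h at e)\<close>, where \<open>H(h at e) \<ge> \<delta> ln (1/\<delta>)\<close>, and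
  \<open>d/2 < d - 1\<close>. The entropy inequality is proved on a large finite quotient of \<open>\<Gamma>\<close> by revealing the
  seeds one after another.
\<close>

section \<open>Entropy of functions of independent seeds\<close>

text \<open>At density \<open>1/2\<close> the entropy inequality gives nothing: a uniform even
  pattern on a coset has entropy \<open>(k - 1) ln 2\<close>, and
  \<open>d (k - 1) > k (d - 1)\<close> exactly because \<open>k > d\<close>. At small density
  entropy is governed by the number of ones instead, and \<open>d/2 < d - 1\<close> is where
  \<open>d \<ge> 3\<close> enters. Two copies are combined by xor because parity is linear: an odd
  pattern of the sum forces one in a summand, so the error is bounded for all \<open>t\<close>,
  while the density moves from \<open>0\<close> (equal copies) to \<open>2 q (1 - q)\<close>
  (independent copies of density \<open>q\<close>). The entropy inequality extends the edge-vertex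
  inequality for factors of i.i.d. processes on regular trees, with cosets as hyperedges of size
  \<open>k\<close>. Revealing seeds one at a time needs finitely many seeds and a group over which
  to average, hence the quotient; only the tree structure near the identity has to survive in it.
  All thresholds depend on \<open>k\<close> alone, since the window is known only after the error
  has been fixed.\<close>

definition entropy_pmf :: "'a pmf \<Rightarrow> real" where
  "entropy_pmf p = (\<Sum>x\<in>set_pmf p. - pmf p x * ln (pmf p x))"

lemma sum_map_pmf:
  fixes h :: "'b \<Rightarrow> real"
  assumes "finite (set_pmf p)"
  shows "(\<Sum>y\<in>set_pmf (map_pmf f p). pmf (map_pmf f p) y * h y) = (\<Sum>x\<in>set_pmf p. pmf p x * h (f x))"
proof -
  have "(\<Sum>y\<in>set_pmf (map_pmf f p). pmf (map_pmf f p) y * h y) = measure_pmf.expectation (map_pmf f p) h"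
    using assms by (subst integral_measure_pmf_real[where A = "set_pmf (map_pmf f p)"]) (auto simp: mult.commute)
  also have "\<dots> = measure_pmf.expectation p (\<lambda>x. h (f x))"
    by simp
  also have "\<dots> = (\<Sum>x\<in>set_pmf p. pmf p x * h (f x))"
    using assms by (subst integral_measure_pmf_real[where A = "set_pmf p"]) (auto simp: mult.commute)
  finally show ?thesis .
qed

lemma entropy_map_pmf:
  assumes "finite (set_pmf p)"
  shows "entropy_pmf (map_pmf X p) = (\<Sum>w\<in>set_pmf p. - pmf p w * ln (pmf (map_pmf X p) (X w)))"
  using sum_map_pmf[OF assms, of X "\<lambda>y. - ln (pmf (map_pmf X p) y)"]
  by (simp add: entropy_pmf_def)

lemma pmf_map_pos: "w \<in> set_pmf p \<Longrightarrow> 0 < pmf (map_pmf X p) (X w)"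
  by (rule pmf_positive) auto

text \<open>Entropy only sees the partition of the support into level sets, so components of a tuple
  may be permuted, and components determined by the others added or dropped.\<close>

lemma entropy_map_pmf_cong:
  assumes "finite (set_pmf p)" "\<And>v w. v \<in> set_pmf p \<Longrightarrow> w \<in> set_pmf p \<Longrightarrow> X v = X w \<longleftrightarrow> Y v = Y w"
  shows "entropy_pmf (map_pmf X p) = entropy_pmf (map_pmf Y p)"
proof -
  have "pmf (map_pmf X p) (X w) = pmf (map_pmf Y p) (Y w)" if "w \<in> set_pmf p" for w
  proof -
    have "measure (measure_pmf p) (X -` {X w}) = measure (measure_pmf p) (Y -` {Y w})"
      using assms(2)[OF _ that] by (intro measure_pmf.finite_measure_eq_AE) (auto simp: AE_measure_pmf_iff)
    then show ?thesis by (simp add: pmf_map)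
  qed
  then show ?thesis
    using assms(1) by (simp add: entropy_map_pmf)
qed

lemma sum_pmf_fst:
  assumes "finite A" "fst ` set_pmf p \<subseteq> A"
  shows "(\<Sum>x\<in>A. pmf p (x, z)) = pmf (map_pmf snd p) z"
proof -
  have "pmf (map_pmf snd p) z = measure (measure_pmf p) (snd -` {z})"
    by (simp add: pmf_map)
  also have "\<dots> = measure (measure_pmf p) (A \<times> {z})"
    using assms(2) by (intro measure_pmf.finite_measure_eq_AE) (force simp: AE_measure_pmf_iff)+
  also have "\<dots> = (\<Sum>x\<in>A. pmf p (x, z))"
    using assms(1) by (subst measure_measure_pmf_finite) (auto simp: sum.cartesian_product')
  finally show ?thesis by simp
qed

text \<open>Conditional mutual information of \<open>X\<close> and \<open>Y\<close> given
  \<open>Z\<close> is nonnegative: the joint law \<open>a\<close> is compared with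
  \<open>b c / e\<close>, which makes \<open>X\<close> and \<open>Y\<close> conditionally
  independent given \<open>Z\<close>.\<close>

lemma entropy_submodular:
  assumes fin: "finite (set_pmf p)"
  shows "entropy_pmf (map_pmf (\<lambda>w. (X w, Y w, Z w)) p) + entropy_pmf (map_pmf Z p)
    \<le> entropy_pmf (map_pmf (\<lambda>w. (X w, Z w)) p) + entropy_pmf (map_pmf (\<lambda>w. (Y w, Z w)) p)"
proof -
  define a where "a = pmf (map_pmf (\<lambda>w. (X w, Y w, Z w)) p)"
  define b where "b = pmf (map_pmf (\<lambda>w. (X w, Z w)) p)"
  define c where "c = pmf (map_pmf (\<lambda>w. (Y w, Z w)) p)"
  define e where "e = pmf (map_pmf Z p)"
  let ?S = "set_pmf p"
  let ?r = "\<lambda>(x, y, z). b (x, z) * c (y, z) / (a (x, y, z) * e z)"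
  have pos: "0 < a (X w, Y w, Z w)" "0 < b (X w, Z w)" "0 < c (Y w, Z w)" "0 < e (Z w)" if "w \<in> ?S" for w
    using that pmf_map_pos[where p = p and X = "\<lambda>w. (X w, Y w, Z w)"] pmf_map_pos[where p = p and X = "\<lambda>w. (X w, Z w)"]
      pmf_map_pos[where p = p and X = "\<lambda>w. (Y w, Z w)"] pmf_map_pos[where p = p and X = Z]
    by (auto simp: a_def b_def c_def e_def)
  have nn: "0 \<le> b u" "0 \<le> c v" "0 \<le> e z" for u v z by (auto simp: b_def c_def e_def)
  have "entropy_pmf (map_pmf (\<lambda>w. (X w, Y w, Z w)) p) + entropy_pmf (map_pmf Z p)
      - entropy_pmf (map_pmf (\<lambda>w. (X w, Z w)) p) - entropy_pmf (map_pmf (\<lambda>w. (Y w, Z w)) p)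
    = (\<Sum>w\<in>?S. pmf p w * (ln (b (X w, Z w)) + ln (c (Y w, Z w)) - ln (a (X w, Y w, Z w)) - ln (e (Z w))))"
    unfolding entropy_map_pmf[OF fin] a_def b_def c_def e_def
    by (simp add: sum.distrib[symmetric] sum_subtractf[symmetric] sum_negf[symmetric] algebra_simps)
  \<comment> \<open>Gibbs' inequality: by \<open>ln r \<le> r - 1\<close> it suffices that the
    weights \<open>b c / e\<close> have total mass at most \<open>1\<close>.\<close>
  also have "\<dots> \<le> (\<Sum>w\<in>?S. pmf p w * (?r (X w, Y w, Z w) - 1))"
  proof (intro sum_mono mult_left_mono)
    fix w assume w: "w \<in> ?S"
    have "ln (b (X w, Z w)) + ln (c (Y w, Z w)) - ln (a (X w, Y w, Z w)) - ln (e (Z w)) = ln (?r (X w, Y w, Z w))"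
      using pos[OF w] by (simp add: ln_div ln_mult)
    also have "\<dots> \<le> ?r (X w, Y w, Z w) - 1"
      using pos[OF w] by (intro ln_le_minus_one) simp
    finally show "ln (b (X w, Z w)) + ln (c (Y w, Z w)) - ln (a (X w, Y w, Z w)) - ln (e (Z w))
      \<le> ?r (X w, Y w, Z w) - 1" .
  qed auto
  also have "\<dots> = (\<Sum>w\<in>?S. pmf p w * ?r (X w, Y w, Z w)) - 1"
    using fin by (simp add: right_diff_distrib sum_subtractf sum_pmf_eq_1)
  also have "(\<Sum>w\<in>?S. pmf p w * ?r (X w, Y w, Z w))
    = (\<Sum>t\<in>set_pmf (map_pmf (\<lambda>w. (X w, Y w, Z w)) p). a t * ?r t)"
    unfolding a_def using sum_map_pmf[OF fin, of "\<lambda>w. (X w, Y w, Z w)" ?r] by (simp add: a_def)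
  also have "\<dots> = (\<Sum>(x, y, z)\<in>set_pmf (map_pmf (\<lambda>w. (X w, Y w, Z w)) p). b (x, z) * c (y, z) / e z)"
    using pos by (intro sum.cong) fastforce+
  \<comment> \<open>The joint support may be smaller than a product set; enlarging it adds
    nonnegative terms and lets the sums over \<open>X\<close> and \<open>Y\<close> factor.\<close>
  also have "\<dots> \<le> (\<Sum>(x, y, z)\<in>X ` ?S \<times> Y ` ?S \<times> Z ` ?S. b (x, z) * c (y, z) / e z)"
    using fin nn by (intro sum_mono2) auto
  also have "\<dots> = (\<Sum>x\<in>X ` ?S. \<Sum>y\<in>Y ` ?S. \<Sum>z\<in>Z ` ?S. b (x, z) * c (y, z) / e z)"
    by (simp add: sum.cartesian_product')
  also have "\<dots> = (\<Sum>z\<in>Z ` ?S. \<Sum>x\<in>X ` ?S. \<Sum>y\<in>Y ` ?S. b (x, z) * c (y, z) / e z)"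
    by (subst sum.swap[of _ "Z ` ?S"], subst sum.swap[of _ "Z ` ?S"]) simp
  also have "\<dots> = (\<Sum>z\<in>Z ` ?S. (\<Sum>x\<in>X ` ?S. b (x, z)) * (\<Sum>y\<in>Y ` ?S. c (y, z)) / e z)"
    by (simp add: sum_product sum_divide_distrib)
  also have "\<dots> = (\<Sum>z\<in>Z ` ?S. e z)"
  proof (intro sum.cong HOL.refl)
    fix z assume "z \<in> Z ` ?S"
    have "(\<Sum>x\<in>X ` ?S. b (x, z)) = e z"
      unfolding b_def e_def using fin by (subst sum_pmf_fst) (auto simp: pmf.map_comp o_def)
    moreover have "(\<Sum>y\<in>Y ` ?S. c (y, z)) = e z"
      unfolding c_def e_def using fin by (subst sum_pmf_fst) (auto simp: pmf.map_comp o_def)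
    ultimately show "(\<Sum>x\<in>X ` ?S. b (x, z)) * (\<Sum>y\<in>Y ` ?S. c (y, z)) / e z = e z"
      by simp
  qed
  also have "\<dots> = 1"
    unfolding e_def using fin by (intro sum_pmf_eq_1) auto
  finally show ?thesis by simp
qed

lemma entropy_pair_pmf:
  assumes "finite (set_pmf p)" "finite (set_pmf q)"
  shows "entropy_pmf (pair_pmf p q) = entropy_pmf p + entropy_pmf q"
proof -
  have "entropy_pmf (pair_pmf p q)
    = (\<Sum>x\<in>set_pmf p. \<Sum>y\<in>set_pmf q. pmf q y * (- pmf p x * ln (pmf p x)) + pmf p x * (- pmf q y * ln (pmf q y)))"
    unfolding entropy_pmf_def set_pair_pmf sum.cartesian_product'
    by (intro sum.cong) (auto simp: pmf_pair ln_mult pmf_positive algebra_simps)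
  also have "\<dots> = (\<Sum>y\<in>set_pmf q. pmf q y) * (\<Sum>x\<in>set_pmf p. - pmf p x * ln (pmf p x))
      + (\<Sum>x\<in>set_pmf p. pmf p x) * (\<Sum>y\<in>set_pmf q. - pmf q y * ln (pmf q y))"
    unfolding sum_product sum.distrib by (simp only: sum.swap[of _ "set_pmf q" "set_pmf p"])
  also have "\<dots> = entropy_pmf p + entropy_pmf q"
    using assms by (simp add: sum_pmf_eq_1 entropy_pmf_def)
  finally show ?thesis .
qed

lemma entropy_pmf_nonneg: "0 \<le> entropy_pmf p"
  unfolding entropy_pmf_def
  by (intro sum_nonneg) (auto intro!: mult_nonneg_nonpos simp: pmf_le_1 pmf_positive)


section \<open>Conditional entropy given the revealed seeds\<close>

locale finite_block_code = group Q for Q :: "('q, 'c) monoid_scheme" (structure) +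
  fixes p :: "'s pmf" and dflt :: 's and D :: "'q set" and f :: "('q \<Rightarrow> 's) \<Rightarrow> bool"
  assumes finite_carrier: "finite (carrier Q)"
    and finite_seeds: "finite (set_pmf p)"
    and window: "D \<subseteq> carrier Q"
    and local: "(\<And>g. g \<in> D \<Longrightarrow> Y g = Y' g) \<Longrightarrow> f Y = f Y'"
begin

definition seeds :: "('q \<Rightarrow> 's) pmf" where
  "seeds = Pi_pmf (carrier Q) dflt (\<lambda>_. p)"

text \<open>Position \<open>v\<close> reads the seeds at \<open>v D\<close>. Off the carrier the
  product is unspecified, which is harmless because \<open>f\<close> only looks at
  \<open>D\<close>.\<close>

definition code :: "'q \<Rightarrow> ('q \<Rightarrow> 's) \<Rightarrow> bool" where
  "code v U = f (\<lambda>q. U (v \<otimes> q))"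

definition coset_code :: "nat \<Rightarrow> 'q \<Rightarrow> 'q \<Rightarrow> ('q \<Rightarrow> 's) \<Rightarrow> bool list" where
  "coset_code k s v U = map (\<lambda>j. code (v \<otimes> s [^] j) U) [0..<k]"

text \<open>Conditional entropy of \<open>X\<close> given the seeds in \<open>S\<close>, written by
  the chain rule as a difference of joint entropies.\<close>

definition cond_entropy :: "'q set \<Rightarrow> (('q \<Rightarrow> 's) \<Rightarrow> 'b) \<Rightarrow> real" where
  "cond_entropy S X = entropy_pmf (map_pmf (\<lambda>U. (X U, restrict U S)) seeds)
     - entropy_pmf (map_pmf (\<lambda>U. restrict U S) seeds)"

lemma finite_set_seeds: "finite (set_pmf seeds)"
  using set_Pi_pmf_subset'[OF finite_carrier, of dflt "\<lambda>_. p"] finite_carrier finite_seeds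
  by (auto simp: seeds_def intro: finite_subset)

lemma seeds_outside: "U \<in> set_pmf seeds \<Longrightarrow> q \<notin> carrier Q \<Longrightarrow> U q = dflt"
  using set_Pi_pmf_subset[OF finite_carrier, of dflt "\<lambda>_. p"] by (auto simp: seeds_def)

lemma restrict_eq_mono: "S \<subseteq> T \<Longrightarrow> restrict U T = restrict V T \<Longrightarrow> restrict U S = restrict V S"
  by (metis restrict_restrict inf.absorb_iff2 inf.commute)

text \<open>
  Revealing further seeds says at least as much about \<open>X\<close> as about a function of \<open>X\<close>: in the
  difference of the two sides all entropies of seeds alone cancel, and submodularity remains.
\<close>

lemma cond_entropy_gain_mono:
  assumes "S \<subseteq> T" "Y = (\<lambda>U. h (X U))"
  shows "cond_entropy S Y - cond_entropy T Y \<le> cond_entropy S X - cond_entropy T X"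
proof -
  note cong = entropy_map_pmf_cong[OF finite_set_seeds]
  have "entropy_pmf (map_pmf (\<lambda>U. (X U, restrict U T)) seeds)
      = entropy_pmf (map_pmf (\<lambda>U. (X U, restrict U T, Y U, restrict U S)) seeds)"
    using assms(2) restrict_eq_mono[OF assms(1)] by (intro cong) auto
  moreover have "entropy_pmf (map_pmf (\<lambda>U. (X U, restrict U S)) seeds)
      = entropy_pmf (map_pmf (\<lambda>U. (X U, Y U, restrict U S)) seeds)"
    using assms(2) by (intro cong) auto
  moreover have "entropy_pmf (map_pmf (\<lambda>U. (Y U, restrict U T)) seeds)
      = entropy_pmf (map_pmf (\<lambda>U. (restrict U T, Y U, restrict U S)) seeds)"
    using restrict_eq_mono[OF assms(1)] by (intro cong) auto
  ultimately show ?thesis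
    using entropy_submodular[OF finite_set_seeds, of X "\<lambda>U. restrict U T" "\<lambda>U. (Y U, restrict U S)"]
    by (simp add: cond_entropy_def)
qed

lemma cond_entropy_const: "cond_entropy S (\<lambda>_. c) = 0"
  unfolding cond_entropy_def by (subst entropy_map_pmf_cong[OF finite_set_seeds, where Y = "\<lambda>U. restrict U S"]) auto

lemma cond_entropy_antimono: "S \<subseteq> T \<Longrightarrow> cond_entropy T X \<le> cond_entropy S X"
  using cond_entropy_gain_mono[of S T "\<lambda>_. ()" "\<lambda>_. ()" X] by (simp add: cond_entropy_const)

lemma cond_entropy_empty: "cond_entropy {} X = entropy_pmf (map_pmf X seeds)"
proof -
  have "entropy_pmf (map_pmf (\<lambda>U. (X U, restrict U {})) seeds) = entropy_pmf (map_pmf X seeds)"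
    by (intro entropy_map_pmf_cong finite_set_seeds) auto
  then show ?thesis
    by (simp add: cond_entropy_def restrict_def entropy_pmf_def)
qed

text \<open>\<open>X\<close> may also inspect positions off the carrier, but these are constantly
  \<open>dflt\<close> on the support, so the seeds on the carrier determine it.\<close>

lemma cond_entropy_carrier: "cond_entropy (carrier Q) X = 0"
proof -
  have "U = V" if "U \<in> set_pmf seeds" "V \<in> set_pmf seeds" "restrict U (carrier Q) = restrict V (carrier Q)" for U V
    using seeds_outside[OF that(1)] seeds_outside[OF that(2)] that(3) by (metis ext restrict_apply')
  then have "entropy_pmf (map_pmf (\<lambda>U. (X U, restrict U (carrier Q))) seeds)
      = entropy_pmf (map_pmf (\<lambda>U. restrict U (carrier Q)) seeds)"
    by (intro entropy_map_pmf_cong finite_set_seeds) auto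
  then show ?thesis by (simp add: cond_entropy_def)
qed

text \<open>Splitting the product measure at \<open>w\<close> makes \<open>U w\<close> independent
  of everything that ignores \<open>w\<close>, so entropies add.\<close>

lemma entropy_independent_seed:
  assumes w: "w \<in> carrier Q" and Y: "\<And>U a. Y (U(w := a)) = Y U"
  shows "entropy_pmf (map_pmf (\<lambda>U. (Y U, U w)) seeds) = entropy_pmf (map_pmf Y seeds) + entropy_pmf p"
proof -
  define r where "r = Pi_pmf (carrier Q - {w}) dflt (\<lambda>_. p)"
  have s: "seeds = map_pmf (\<lambda>(y, U). U(w := y)) (pair_pmf p r)"
    unfolding seeds_def r_def using Pi_pmf_insert[of "carrier Q - {w}" w dflt "\<lambda>_. p"] finite_carrier w
    by (simp add: insert_absorb)
  have fr: "finite (set_pmf r)"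
    unfolding r_def using finite_carrier finite_seeds
    by (intro finite_subset[OF set_Pi_pmf_subset'] finite_PiE_dflt) auto
  have Yr: "map_pmf Y seeds = map_pmf Y r"
  proof -
    have "map_pmf Y seeds = map_pmf Y (map_pmf snd (pair_pmf p r))"
      unfolding s pmf.map_comp by (intro map_pmf_cong) (auto simp: Y)
    then show ?thesis by (simp add: map_snd_pair_pmf)
  qed
  have "entropy_pmf (map_pmf (\<lambda>U. (Y U, U w)) seeds) = entropy_pmf (map_pmf (\<lambda>U. (U w, Y U)) seeds)"
    by (intro entropy_map_pmf_cong finite_set_seeds) auto
  also have "map_pmf (\<lambda>U. (U w, Y U)) seeds = pair_pmf p (map_pmf Y r)"
  proof -
    have "map_pmf (\<lambda>U. (U w, Y U)) seeds = map_pmf (\<lambda>(a, b). (id a, Y b)) (pair_pmf p r)"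
      unfolding s pmf.map_comp by (intro map_pmf_cong) (auto simp: Y)
    then show ?thesis by (simp only: map_pair) simp
  qed
  also have "entropy_pmf \<dots> = entropy_pmf p + entropy_pmf (map_pmf Y r)"
    using finite_seeds fr by (intro entropy_pair_pmf) auto
  finally show ?thesis by (simp add: Yr)
qed

text \<open>Revealing \<open>w\<close> raises the joint entropy and the entropy of the seeds by the
  same amount, \<open>entropy_pmf p\<close>, which cancels.\<close>

lemma cond_entropy_insert:
  assumes w: "w \<in> carrier Q" "w \<notin> S" and X: "\<And>U a. X (U(w := a)) = X U"
  shows "cond_entropy (insert w S) X = cond_entropy S X"
proof -
  have r: "restrict U (insert w S) = restrict V (insert w S) \<longleftrightarrow> restrict U S = restrict V S \<and> U w = V w" for U V :: "'q \<Rightarrow> 's"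
    using w(2) by (auto simp: restrict_def fun_eq_iff)
  have upd: "restrict (U(w := a)) S = restrict U S" for U :: "'q \<Rightarrow> 's" and a
    using w(2) by (auto simp: restrict_def fun_eq_iff)
  have "entropy_pmf (map_pmf (\<lambda>U. (X U, restrict U (insert w S))) seeds)
      = entropy_pmf (map_pmf (\<lambda>U. ((X U, restrict U S), U w)) seeds)"
    by (intro entropy_map_pmf_cong finite_set_seeds) (auto simp: r)
  moreover have "entropy_pmf (map_pmf (\<lambda>U. restrict U (insert w S)) seeds)
      = entropy_pmf (map_pmf (\<lambda>U. (restrict U S, U w)) seeds)"
    by (intro entropy_map_pmf_cong finite_set_seeds) (auto simp: r)
  ultimately show ?thesis
    using entropy_independent_seed[OF w(1), of "\<lambda>U. (X U, restrict U S)"]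
      entropy_independent_seed[OF w(1), of "\<lambda>U. restrict U S"]
    by (simp add: cond_entropy_def X upd)
qed

text \<open>Translation permutes identically distributed coordinates. The case distinction keeps
  positions off the carrier where they are, since their value has to stay
  \<open>dflt\<close>.\<close>

lemma translate_seeds:
  assumes "v \<in> carrier Q"
  shows "map_pmf (\<lambda>U q. U (if q \<in> carrier Q then v \<otimes> q else q)) seeds = seeds"
proof -
  have "bij_betw (\<lambda>q. if q \<in> carrier Q then v \<otimes> q else q) (carrier Q) (carrier Q)"
    using assms by (intro bij_betw_byWitness[where f' = "\<lambda>q. inv v \<otimes> q"]) (auto simp: m_assoc[symmetric])
  then show ?thesis
    unfolding seeds_def
    by (subst (2) Pi_pmf_bij_betw[OF finite_carrier, where h = "\<lambda>q. if q \<in> carrier Q then v \<otimes> q else q"])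
      (auto simp: o_def)
qed

lemma code_translate:
  assumes "v \<in> carrier Q" "u \<in> carrier Q"
  shows "code u (\<lambda>q. U (if q \<in> carrier Q then v \<otimes> q else q)) = code (v \<otimes> u) U"
  unfolding code_def by (rule local) (use assms window in \<open>auto simp: m_assoc\<close>)

lemma map_code_seeds:
  assumes "v \<in> carrier Q"
  shows "map_pmf (code v) seeds = map_pmf (code \<one>) seeds"
proof -
  have "map_pmf (code \<one>) seeds
    = map_pmf (code \<one>) (map_pmf (\<lambda>U q. U (if q \<in> carrier Q then v \<otimes> q else q)) seeds)"
    by (simp only: translate_seeds[OF assms])
  also have "\<dots> = map_pmf (code v) seeds"
    unfolding pmf.map_comp using assms by (intro map_pmf_cong) (simp_all add: code_translate)
  finally show ?thesis by simp
qed

lemma map_coset_code_seeds: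
  assumes "v \<in> carrier Q" "s \<in> carrier Q"
  shows "map_pmf (coset_code k s v) seeds = map_pmf (coset_code k s \<one>) seeds"
proof -
  have "map_pmf (coset_code k s \<one>) seeds
    = map_pmf (coset_code k s \<one>) (map_pmf (\<lambda>U q. U (if q \<in> carrier Q then v \<otimes> q else q)) seeds)"
    by (simp only: translate_seeds[OF assms(1)])
  also have "\<dots> = map_pmf (coset_code k s v) seeds"
    unfolding pmf.map_comp using assms by (intro map_pmf_cong) (simp_all add: code_translate coset_code_def)
  finally show ?thesis by simp
qed

lemma code_update:
  assumes "v \<in> carrier Q" "w \<in> carrier Q" "\<And>g. g \<in> D \<Longrightarrow> v \<noteq> w \<otimes> inv g"
  shows "code v (U(w := a)) = code v U"
  unfolding code_def
proof (rule local)
  fix g assume g: "g \<in> D"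
  then have "v \<otimes> g \<noteq> w"
    using assms window by (metis inv_solve_right subsetD)
  then show "(U(w := a)) (v \<otimes> g) = U (v \<otimes> g)" by simp
qed

text \<open>
  Fix the seed \<open>w\<close> being revealed. Only the values at \<open>w g\<close> with \<open>g \<in> D\<^sup>-\<^sup>1\<close> can gain information. Each
  such \<open>g\<close> is the root of the cosets \<open>g\<langle>s\<^sub>i\<rangle>\<close> with \<open>g \<in> R i\<close>, at least \<open>c\<close> in number, different roots
  have different cosets by \<open>inj\<close>, and a coset gains at least as much as its root.
\<close>

lemma coset_entropy:
  assumes I: "finite I" "\<And>i. i \<in> I \<Longrightarrow> s i \<in> carrier Q" "\<And>i. i \<in> I \<Longrightarrow> s i [^] k = \<one>"
    and R: "\<And>i. i \<in> I \<Longrightarrow> R i \<subseteq> m_inv Q ` D" "\<And>g. g \<in> m_inv Q ` D \<Longrightarrow> c \<le> card {i\<in>I. g \<in> R i}"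
    and inj: "\<And>i. i \<in> I \<Longrightarrow> inj_on (\<lambda>(g, j). g \<otimes> s i [^] j) (R i \<times> {..<k})"
  shows "real k * (real c * entropy_pmf (map_pmf (code \<one>) seeds))
    \<le> (\<Sum>i\<in>I. entropy_pmf (map_pmf (coset_code k (s i) \<one>) seeds))"
proof -
  let ?V = "carrier Q" and ?E = "m_inv Q ` D"
  define n where "n = card ?V"
  \<comment> \<open>Any order of revealing works, since the gain is estimated for each seed
    separately.\<close>
  obtain e where e: "bij_betw e {..<n} ?V"
    using ex_bij_betw_nat_finite[OF finite_carrier] by (auto simp: n_def atLeast0LessThan)
  define S where "S m = e ` {..<m}" for m
  have S_Suc: "S (Suc m) = insert (e m) (S m)" for m
    by (auto simp: S_def lessThan_Suc)
  have S_n: "S n = ?V" using e by (auto simp: S_def bij_betw_def)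
  have e_notin: "e m \<notin> S m" if "m < n" for m
    using inj_on_image_mem_iff[of e "{..<n}" m "{..<m}"] e that by (auto simp: S_def bij_betw_def)
  have e_in: "e m \<in> ?V" if "m < n" for m using e that by (auto simp: bij_betw_def)
  have E: "?E \<subseteq> ?V" using window by auto
  have finE: "finite ?E" using E finite_carrier finite_subset by blast
  have finR: "finite (R i)" if "i \<in> I" for i using R(1)[OF that] finE finite_subset by blast
  have RV: "g \<in> ?V" if "i \<in> I" "g \<in> R i" for g i using R(1) E that by blast

  let ?g = "\<lambda>m v. cond_entropy (S m) (code v) - cond_entropy (S (Suc m)) (code v)"
  let ?gc = "\<lambda>m i v. cond_entropy (S m) (coset_code k (s i) v) - cond_entropy (S (Suc m)) (coset_code k (s i) v)"
  \<comment> \<open>Nothing is known at time \<open>0\<close> and everything at time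
    \<open>n\<close>, so the gains add up to the full entropy.\<close>
  have telescope: "entropy_pmf (map_pmf (code v) seeds) = (\<Sum>m<n. ?g m v)" for v
    by (subst sum_lessThan_telescope') (simp add: S_n cond_entropy_carrier, simp add: S_def cond_entropy_empty)
  have telescope_c: "entropy_pmf (map_pmf (coset_code k (s i) v) seeds) = (\<Sum>m<n. ?gc m i v)" for v i
    by (subst sum_lessThan_telescope') (simp add: S_n cond_entropy_carrier, simp add: S_def cond_entropy_empty)
  have gc_nonneg: "0 \<le> ?gc m i v" for m i v
    using cond_entropy_antimono[of "S m" "S (Suc m)"] by (simp add: S_Suc subset_insertI)
  have g_nonneg: "0 \<le> ?g m v" for m v
    using cond_entropy_antimono[of "S m" "S (Suc m)"] by (simp add: S_Suc subset_insertI)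

  have gain: "real k * (real c * (\<Sum>v\<in>?V. ?g m v)) \<le> (\<Sum>i\<in>I. \<Sum>v\<in>?V. ?gc m i v)" if m: "m < n" for m
  proof -
    let ?w = "e m"
    have w: "?w \<in> ?V" using e_in m .
    have "(\<Sum>v\<in>?V. ?g m v) = (\<Sum>v\<in>(\<lambda>g. ?w \<otimes> g) ` ?E. ?g m v)"
    proof (intro sum.mono_neutral_right finite_carrier ballI)
      fix v assume v: "v \<in> ?V - (\<lambda>g. ?w \<otimes> g) ` ?E"
      then have "code v (U(?w := a)) = code v U" for U a
        using w by (intro code_update) auto
      then show "?g m v = 0"
        using cond_entropy_insert[OF w e_notin[OF m], of "code v"] by (simp add: S_Suc)
    qed (use w E in auto)
    also have "\<dots> = (\<Sum>g\<in>?E. ?g m (?w \<otimes> g))"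
    proof -
      have "inj_on (\<lambda>g. ?w \<otimes> g) ?E"
      proof (rule inj_onI)
        fix x y assume "x \<in> ?E" "y \<in> ?E" "?w \<otimes> x = ?w \<otimes> y"
        moreover from this E have "x \<in> ?V" "y \<in> ?V" by blast+
        ultimately show "x = y" using w by simp
      qed
      then show ?thesis by (simp only: sum.reindex o_def)
    qed
    finally have sum_g: "(\<Sum>v\<in>?V. ?g m v) = (\<Sum>g\<in>?E. ?g m (?w \<otimes> g))" .
    have "real k * (real c * (\<Sum>g\<in>?E. ?g m (?w \<otimes> g))) = real k * (\<Sum>g\<in>?E. real c * ?g m (?w \<otimes> g))"
      by (simp add: sum_distrib_left)
    also have "\<dots> \<le> real k * (\<Sum>g\<in>?E. real (card {i\<in>I. g \<in> R i}) * ?g m (?w \<otimes> g))"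
      using g_nonneg R(2) by (intro mult_left_mono sum_mono mult_right_mono) auto
    also have "(\<Sum>g\<in>?E. real (card {i\<in>I. g \<in> R i}) * ?g m (?w \<otimes> g))
      = (\<Sum>g\<in>?E. \<Sum>i\<in>{i\<in>I. g \<in> R i}. ?g m (?w \<otimes> g))"
      by simp
    also have "\<dots> = (\<Sum>i\<in>I. \<Sum>g\<in>{g\<in>?E. g \<in> R i}. ?g m (?w \<otimes> g))"
      by (rule sum.swap_restrict[OF finE I(1)])
    also have "\<dots> = (\<Sum>i\<in>I. \<Sum>g\<in>R i. ?g m (?w \<otimes> g))"
      using R(1) by (intro sum.cong) auto
    \<comment> \<open>The factor \<open>k\<close> counts each coset once for each of its
      \<open>k\<close> starting points.\<close>
    also have "real k * \<dots> = (\<Sum>i\<in>I. \<Sum>(g, j)\<in>R i \<times> {..<k}. ?g m (?w \<otimes> g))"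
      by (simp add: sum_distrib_left sum.cartesian_product')
    also have "\<dots> \<le> (\<Sum>i\<in>I. \<Sum>v\<in>?V. ?gc m i v)"
    proof (rule sum_mono)
      fix i assume i: "i \<in> I"
      have "(\<Sum>(g, j)\<in>R i \<times> {..<k}. ?g m (?w \<otimes> g))
        \<le> (\<Sum>(g, j)\<in>R i \<times> {..<k}. ?gc m i (?w \<otimes> (g \<otimes> s i [^] j)))"
      proof (rule sum_mono, clarify)
        fix g j assume g: "g \<in> R i" and j: "j < k"
        \<comment> \<open>\<open>l\<close> is the place of the root \<open>w g\<close> in the list
          that starts at position \<open>j\<close> of the coset; the \<open>mod\<close> turns
          \<open>j = 0\<close> into \<open>l = 0\<close>, as \<open>k\<close> would be out of
          range.\<close>
        define l where "l = (k - j) mod k"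
        have l: "l < k" using j by (simp add: l_def)
        have "s i [^] j \<otimes> s i [^] l = s i [^] (j + l)"
          using I(2)[OF i] by (simp add: nat_pow_mult)
        also have "j + l = (if j = 0 then 0 else k)"
          using j by (auto simp: l_def)
        also have "s i [^] (if j = 0 then 0 else k) = \<one>"
          using I(3)[OF i] by simp
        finally have "?w \<otimes> (g \<otimes> s i [^] j) \<otimes> s i [^] l = ?w \<otimes> g"
          using w RV[OF i g] I(2)[OF i] by (simp add: m_assoc)
        then have "code (?w \<otimes> g) = (\<lambda>U. coset_code k (s i) (?w \<otimes> (g \<otimes> s i [^] j)) U ! l)"
          using l by (simp add: coset_code_def)
        then show "?g m (?w \<otimes> g) \<le> ?gc m i (?w \<otimes> (g \<otimes> s i [^] j))"
          by (intro cond_entropy_gain_mono[where h = "\<lambda>x. x ! l"]) (simp_all add: S_Suc subset_insertI)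
      qed
      also have "\<dots> = (\<Sum>v\<in>(\<lambda>(g, j). ?w \<otimes> (g \<otimes> s i [^] j)) ` (R i \<times> {..<k}). ?gc m i v)"
      proof (subst sum.reindex)
        show "inj_on (\<lambda>(g, j). ?w \<otimes> (g \<otimes> s i [^] j)) (R i \<times> {..<k})"
        proof (rule inj_onI, clarify)
          fix g j g' j' assume *: "g \<in> R i" "j < k" "g' \<in> R i" "j' < k"
            "?w \<otimes> (g \<otimes> s i [^] j) = ?w \<otimes> (g' \<otimes> s i [^] j')"
          then have "g \<otimes> s i [^] j = g' \<otimes> s i [^] j'"
            using w RV[OF i] I(2)[OF i] by simp
          then show "g = g' \<and> j = j'"
            using inj_onD[OF inj[OF i], of "(g, j)" "(g', j')"] * by auto
        qed
      qed (simp add: case_prod_unfold)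
      also have "\<dots> \<le> (\<Sum>v\<in>?V. ?gc m i v)"
        using gc_nonneg w RV[OF i] I(2)[OF i] by (intro sum_mono2 finite_carrier) auto
      finally show "(\<Sum>(g, j)\<in>R i \<times> {..<k}. ?g m (?w \<otimes> g)) \<le> (\<Sum>v\<in>?V. ?gc m i v)" .
    qed
    finally show ?thesis by (simp add: sum_g)
  qed

  \<comment> \<open>By translation invariance all \<open>n\<close> positions have the same entropy,
    so summing over the group loses nothing and \<open>n\<close> cancels at the end.\<close>
  have "(\<Sum>v\<in>?V. entropy_pmf (map_pmf (code v) seeds)) = (\<Sum>v\<in>?V. entropy_pmf (map_pmf (code \<one>) seeds))"
    by (intro sum.cong HOL.refl arg_cong[where f = entropy_pmf] map_code_seeds)
  then have "real n * (real k * (real c * entropy_pmf (map_pmf (code \<one>) seeds)))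
    = real k * (real c * (\<Sum>v\<in>?V. entropy_pmf (map_pmf (code v) seeds)))"
    by (simp add: n_def)
  also have "\<dots> = (\<Sum>m<n. real k * (real c * (\<Sum>v\<in>?V. ?g m v)))"
    unfolding telescope by (subst sum.swap) (simp only: sum_distrib_left)
  also have "\<dots> \<le> (\<Sum>m<n. \<Sum>i\<in>I. \<Sum>v\<in>?V. ?gc m i v)"
    by (intro sum_mono gain) auto
  also have "\<dots> = (\<Sum>i\<in>I. \<Sum>v\<in>?V. \<Sum>m<n. ?gc m i v)"
    by (subst sum.swap[of _ I], rule sum.cong[OF HOL.refl], rule sum.swap)
  also have "\<dots> = (\<Sum>i\<in>I. \<Sum>v\<in>?V. entropy_pmf (map_pmf (coset_code k (s i) v) seeds))"
    by (simp only: telescope_c)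
  also have "\<dots> = (\<Sum>i\<in>I. \<Sum>v\<in>?V. entropy_pmf (map_pmf (coset_code k (s i) \<one>) seeds))"
    by (intro sum.cong HOL.refl arg_cong[where f = entropy_pmf] map_coset_code_seeds I(2))
  also have "\<dots> = real n * (\<Sum>i\<in>I. entropy_pmf (map_pmf (coset_code k (s i) \<one>) seeds))"
    by (simp add: n_def sum_distrib_left)
  finally have "real n * (real k * (real c * entropy_pmf (map_pmf (code \<one>) seeds)))
    \<le> real n * (\<Sum>i\<in>I. entropy_pmf (map_pmf (coset_code k (s i) \<one>) seeds))" .
  moreover have "0 < n"
    using finite_carrier one_closed by (auto simp: n_def card_gt_0_iff)
  ultimately show ?thesis by simp
qed

end

section \<open>Finite quotients of the free product\<close>

definition word_eval :: "('b, 'c) monoid_scheme \<Rightarrow> ('a \<Rightarrow> 'b) \<Rightarrow> 'a gword \<Rightarrow> 'b" where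
  "word_eval H h w = foldr (\<lambda>(a, b) x. (if b then h a else inv\<^bsub>H\<^esub> h a) \<otimes>\<^bsub>H\<^esub> x) w \<one>\<^bsub>H\<^esub>"

lemma word_eval_closed:
  assumes "group H" "h \<in> S \<rightarrow> carrier H" "w \<in> words S"
  shows "word_eval H h w \<in> carrier H"
proof -
  interpret group H by fact
  show ?thesis
    using assms(3) by (induction w) (use assms(2) in \<open>auto simp: word_eval_def Pi_iff\<close>)
qed

lemma word_eval_append:
  assumes "group H" "h \<in> S \<rightarrow> carrier H" "u \<in> words S" "v \<in> words S"
  shows "word_eval H h (u @ v) = word_eval H h u \<otimes>\<^bsub>H\<^esub> word_eval H h v"
proof -
  interpret group H by fact
  note cl = word_eval_closed[OF assms(1,2)]
  show ?thesis
    using assms(3)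
  proof (induction u)
    case Nil
    then show ?case using cl[OF assms(4)] by (simp add: word_eval_def)
  next
    case (Cons x u)
    obtain a b where x: "x = (a, b)" by fastforce
    have "a \<in> S" "u \<in> words S" using Cons.hyps x by auto
    moreover have "h a \<in> carrier H" using \<open>a \<in> S\<close> assms(2) by auto
    ultimately show ?case
      using Cons.IH cl[OF assms(4)] cl[of u] by (auto simp: x word_eval_def m_assoc)
  qed
qed

lemma word_eval_pres_rel:
  assumes H: "group H" "h \<in> S \<rightarrow> carrier H"
    and rels: "\<And>r. r \<in> R \<Longrightarrow> r \<in> words S \<Longrightarrow> word_eval H h r = \<one>\<^bsub>H\<^esub>"
    and uv: "(u, v) \<in> pres_rel S R"
  shows "word_eval H h u = word_eval H h v"
proof -
  interpret group H by fact
  note cl = word_eval_closed[OF H]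
  show ?thesis
    using uv
  proof (induction rule: pres_rel.induct)
    case (cancel u v a b)
    have ha: "h a \<in> carrier H" using cancel.hyps H(2) by auto
    have "[(a, b), (a, \<not> b)] @ v \<in> words S" using cancel.hyps by auto
    moreover have "word_eval H h ([(a, b), (a, \<not> b)] @ v) = word_eval H h v"
      using ha cl[OF cancel.hyps(2)] by (cases b) (simp_all add: word_eval_def m_assoc[symmetric])
    ultimately show ?case
      using cancel.hyps word_eval_append[OF H] by metis
  next
    case (relator u v r)
    then show ?case
      using rels cl word_eval_append[OF H] by (metis append_in_lists_conv l_one)
  qed auto
qed

text \<open>Von Dyck's theorem. \<open>word_eval\<close> is constant on classes, so any chosen
  representative gives the same value.\<close>

lemma presented_group_hom:
  assumes H: "group H" "h \<in> S \<rightarrow> carrier H"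
    and rels: "\<And>r. r \<in> R \<Longrightarrow> r \<in> words S \<Longrightarrow> word_eval H h r = \<one>\<^bsub>H\<^esub>"
  obtains \<pi> where "\<pi> \<in> hom (presented_group S R) H"
    "\<And>w. w \<in> words S \<Longrightarrow> \<pi> (word_class S R w) = word_eval H h w"
proof
  let ?\<pi> = "\<lambda>A. word_eval H h (SOME w. w \<in> A)"
  show \<pi>: "?\<pi> (word_class S R w) = word_eval H h w" if "w \<in> words S" for w
  proof -
    have "w \<in> word_class S R w"
      using that by (auto simp: word_class_def intro: pres_rel.refl)
    then have "(SOME w'. w' \<in> word_class S R w) \<in> word_class S R w"
      by (rule someI)
    then show ?thesis
      using word_eval_pres_rel[OF assms] by (simp add: word_class_def)
  qed
  show "?\<pi> \<in> hom (presented_group S R) H"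
  proof (rule homI)
    fix x assume "x \<in> carrier (presented_group S R)"
    then obtain u where u: "u \<in> words S" "x = word_class S R u"
      by (auto simp: carrier_presented_group simp del: in_lists_conv_set)
    then show "?\<pi> x \<in> carrier H"
      using \<pi> word_eval_closed[OF H] by metis
    fix y assume "y \<in> carrier (presented_group S R)"
    then obtain v where "v \<in> words S" "y = word_class S R v"
      by (auto simp: carrier_presented_group simp del: in_lists_conv_set)
    note u this
    moreover from this have "u @ v \<in> words S" by simp
    ultimately show "?\<pi> (x \<otimes>\<^bsub>presented_group S R\<^esub> y) = ?\<pi> x \<otimes>\<^bsub>H\<^esub> ?\<pi> y"
      using \<pi> by (metis mult_word_class word_eval_append[OF H])
  qed
qed

lemma word_eval_replicate:
  assumes "group H" "h i \<in> carrier H"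
  shows "word_eval H h (replicate k (i, True)) = h i [^]\<^bsub>H\<^esub> k"
proof -
  interpret group H by fact
  show ?thesis
  proof (induction k)
    case (Suc k)
    then have "word_eval H h (replicate (Suc k) (i, True)) = h i \<otimes>\<^bsub>H\<^esub> h i [^]\<^bsub>H\<^esub> k"
      by (simp add: word_eval_def)
    then show ?case by (simp only: nat_pow_Suc2[OF assms(2)])
  qed (simp add: word_eval_def)
qed

lemma Gamma_hom:
  assumes H: "group H" "\<And>i. i \<in> {1..d} \<Longrightarrow> h i \<in> carrier H" "\<And>i. i \<in> {1..d} \<Longrightarrow> h i [^]\<^bsub>H\<^esub> k = \<one>\<^bsub>H\<^esub>"
  obtains \<pi> where "\<pi> \<in> hom (Gamma_group d k) H" "\<And>i. i \<in> {1..d} \<Longrightarrow> \<pi> (Gamma_gen d k i) = h i"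
proof -
  interpret group H by fact
  have h: "h \<in> Gamma_gens d \<rightarrow> carrier H" using H(2) by (auto simp: Gamma_gens_def)
  have "word_eval H h r = \<one>\<^bsub>H\<^esub>" if "r \<in> Gamma_rels d k" for r
    using that H by (auto simp: Gamma_rels_def word_eval_replicate)
  then obtain \<pi> where \<pi>: "\<pi> \<in> hom (Gamma_group d k) H"
    "\<And>w. w \<in> words (Gamma_gens d) \<Longrightarrow> \<pi> (word_class (Gamma_gens d) (Gamma_rels d k) w) = word_eval H h w"
    unfolding Gamma_group_def using presented_group_hom[OF H(1) h] by metis
  show thesis
  proof (rule that[OF \<pi>(1)])
    fix i assume i: "i \<in> {1..d}"
    have "[(i, True)] \<in> words (Gamma_gens d)" using i by (auto simp: Gamma_gens_def)
    from \<pi>(2)[OF this] show "\<pi> (Gamma_gen d k i) = h i"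
      using H(2)[OF i] by (simp add: Gamma_gen_def word_eval_def)
  qed
qed

lemma Gamma_gen_pow:
  assumes i: "i \<in> {1..d}"
  shows "Gamma_gen d k i [^]\<^bsub>Gamma_group d k\<^esub> n = word_class (Gamma_gens d) (Gamma_rels d k) (replicate n (i, True))"
proof (induction n)
  case 0
  then show ?case by (simp add: Gamma_group_def one_presented_group)
next
  case (Suc n)
  have "replicate n (i, True) \<in> words (Gamma_gens d)" "[(i, True)] \<in> words (Gamma_gens d)"
    using i by (auto simp: Gamma_gens_def)
  from mult_word_class[OF this, of "Gamma_rels d k"] Suc show ?case
    by (simp add: Gamma_gen_def Gamma_group_def replicate_append_same)
qed

lemma Gamma_gen_pow_order:
  assumes i: "i \<in> {1..d}"
  shows "Gamma_gen d k i [^]\<^bsub>Gamma_group d k\<^esub> k = \<one>\<^bsub>Gamma_group d k\<^esub>"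
proof -
  let ?r = "replicate k (i, True)"
  have r: "?r \<in> words (Gamma_gens d)" "?r \<in> Gamma_rels d k"
    using i by (auto simp: Gamma_gens_def Gamma_rels_def)
  have "([] @ ?r @ [], [] @ []) \<in> pres_rel (Gamma_gens d) (Gamma_rels d k)"
    using r by (intro pres_rel.relator) auto
  then have "word_class (Gamma_gens d) (Gamma_rels d k) ?r = word_class (Gamma_gens d) (Gamma_rels d k) []"
    using r by (subst word_class_eq_iff) auto
  then show ?thesis
    using Gamma_gen_pow[OF i] by (simp add: Gamma_group_def one_presented_group)
qed

definition gen_prod :: "nat \<Rightarrow> nat \<Rightarrow> nat list \<Rightarrow> nat gword set" where
  "gen_prod d k js = foldr (\<lambda>i x. Gamma_gen d k i \<otimes>\<^bsub>Gamma_group d k\<^esub> x) js \<one>\<^bsub>Gamma_group d k\<^esub>"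

lemma gen_prod_closed: "set js \<subseteq> {1..d} \<Longrightarrow> gen_prod d k js \<in> carrier (Gamma_group d k)"
proof (induction js)
  case (Cons i js)
  interpret group "Gamma_group d k" by (rule group_Gamma)
  show ?case using Cons Gamma_gen_closed[of i d k] by (simp add: gen_prod_def)
qed (simp add: gen_prod_def group.is_monoid[OF group_Gamma] monoid.one_closed)

text \<open>The inverse of a generator is its power \<open>k - 1\<close>. Positive words therefore
  suffice, and the truncated action below has to be described for generators only.\<close>

lemma gen_prod_surj:
  assumes "g \<in> carrier (Gamma_group d k)" "0 < k"
  obtains js where "set js \<subseteq> {1..d}" "g = gen_prod d k js"
proof -
  interpret group "Gamma_group d k" by (rule group_Gamma)
  let ?c = "word_class (Gamma_gens d) (Gamma_rels d k)"
  have rep: "gen_prod d k (replicate n i @ js) = Gamma_gen d k i [^]\<^bsub>Gamma_group d k\<^esub> n \<otimes>\<^bsub>Gamma_group d k\<^esub> gen_prod d k js"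
    if "i \<in> {1..d}" "set js \<subseteq> {1..d}" for n i js
  proof (induction n)
    case 0
    then show ?case using gen_prod_closed[OF that(2)] by simp
  next
    case (Suc n)
    have "gen_prod d k (replicate (Suc n) i @ js) = Gamma_gen d k i \<otimes>\<^bsub>Gamma_group d k\<^esub> gen_prod d k (replicate n i @ js)"
      by (simp add: gen_prod_def)
    then show ?case
      unfolding nat_pow_Suc2[OF Gamma_gen_closed[OF that(1)]]
      using Suc gen_prod_closed[OF that(2)] Gamma_gen_closed[OF that(1)] by (simp add: m_assoc)
  qed
  have "\<exists>js. set js \<subseteq> {1..d} \<and> ?c w = gen_prod d k js" if "w \<in> words (Gamma_gens d)" for w
    using that
  proof (induction w)
    case Nil
    then show ?case by (intro exI[of _ "[]"]) (simp add: gen_prod_def Gamma_group_def one_presented_group)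
  next
    case (Cons x w)
    obtain i b where x: "x = (i, b)" by fastforce
    have i: "i \<in> {1..d}" and w: "w \<in> words (Gamma_gens d)" using Cons.hyps x by (auto simp: Gamma_gens_def)
    obtain js where js: "set js \<subseteq> {1..d}" "?c w = gen_prod d k js" using Cons.IH w by auto
    have letter: "[(i, b)] \<in> words (Gamma_gens d)" "[(i, \<not> b)] \<in> words (Gamma_gens d)" for b using i by (auto simp: Gamma_gens_def)
    have split: "?c (x # w) = ?c [(i, b)] \<otimes>\<^bsub>Gamma_group d k\<^esub> ?c w"
      using mult_word_class[OF letter(1)[of b] w, of "Gamma_rels d k"] by (simp add: x Gamma_group_def)
    show ?case
    proof (cases b)
      case True
      then show ?thesis
        using js i split by (intro exI[of _ "i # js"]) (simp add: gen_prod_def Gamma_gen_def)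
    next
      case False
      let ?s = "Gamma_gen d k i"
      have "([] @ [(i, False), (i, \<not> False)] @ [], [] @ []) \<in> pres_rel (Gamma_gens d) (Gamma_rels d k)"
        using i by (intro pres_rel.cancel) (auto simp: Gamma_gens_def)
      then have "?c ([(i, False)] @ [(i, True)]) = ?c []"
        using i by (subst word_class_eq_iff) (auto simp: Gamma_gens_def)
      then have "?c [(i, False)] \<otimes>\<^bsub>Gamma_group d k\<^esub> ?s = \<one>\<^bsub>Gamma_group d k\<^esub>"
        using mult_word_class[OF letter(1)[of False] letter(1)[of True], of "Gamma_rels d k"]
        by (simp add: Gamma_group_def one_presented_group Gamma_gen_def)
      moreover have "?s [^]\<^bsub>Gamma_group d k\<^esub> (k - 1) \<otimes>\<^bsub>Gamma_group d k\<^esub> ?s = \<one>\<^bsub>Gamma_group d k\<^esub>"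
        using Gamma_gen_pow_order[OF i, of k] assms(2) by (cases k) auto
      moreover have "?c [(i, False)] \<in> carrier (Gamma_group d k)"
        unfolding Gamma_group_def carrier_presented_group using letter(1) by (rule imageI)
      ultimately have "?c [(i, False)] = ?s [^]\<^bsub>Gamma_group d k\<^esub> (k - 1)"
        using Gamma_gen_closed[OF i, of k] by (metis nat_pow_closed right_cancel)
      then show ?thesis
        using js i split False rep[OF i js(1), of "k - 1"] by (intro exI[of _ "replicate (k - 1) i @ js"]) auto
    qed
  qed
  moreover obtain w where "w \<in> words (Gamma_gens d)" "g = ?c w"
    using assms(1) by (auto simp: Gamma_group_def carrier_presented_group)
  ultimately show thesis using that by blast
qed


section \<open>A truncated action on reduced words\<close>

definition starts_with :: "nat \<Rightarrow> (nat \<times> nat) list \<Rightarrow> bool" where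
  "starts_with i u \<longleftrightarrow> u \<noteq> [] \<and> fst (hd u) = i"

text \<open>
  A list of pairs \<open>(i, j)\<close> stands for the product of the syllables \<open>s\<^sub>i\<^sup>j\<close>. Left multiplication by
  \<open>s\<^sub>i\<close> is truncated at length \<open>n\<close> so that it still permutes each of its orbits cyclically.
\<close>

definition reduced_words :: "nat \<Rightarrow> nat \<Rightarrow> nat \<Rightarrow> (nat \<times> nat) list set" where
  "reduced_words d k n = {u. length u \<le> n \<and> set u \<subseteq> {1..d} \<times> {1..<k} \<and> distinct_adj (map fst u)}"

definition prepend :: "nat \<Rightarrow> nat \<Rightarrow> nat \<Rightarrow> (nat \<times> nat) list \<Rightarrow> (nat \<times> nat) list" where
  "prepend k n i u =
    (if starts_with i u then if Suc (snd (hd u)) = k then tl u else (i, Suc (snd (hd u))) # tl u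
     else if length u < n then (i, 1) # u else u)"

lemma distinct_adj_Cons_fst:
  "distinct_adj (map fst ((i, j) # u)) \<longleftrightarrow> \<not> starts_with i u \<and> distinct_adj (map fst u)"
  by (cases u) (auto simp: starts_with_def)

lemma finite_reduced_words: "finite (reduced_words d k n)"
  by (rule finite_subset[OF _ finite_lists_length_le[of "{1..d} \<times> {1..<k}" n]])
    (auto simp: reduced_words_def)

lemma prepend_hit: "prepend k n i ((i, j) # b) = (if Suc j = k then b else (i, Suc j) # b)"
  by (simp add: prepend_def starts_with_def)

lemma prepend_miss: "\<not> starts_with i b \<Longrightarrow> length b < n \<Longrightarrow> prepend k n i b = (i, 1) # b"
  by (simp add: prepend_def)

text \<open>The leading exponent can be read off the word; this will tell apart the positions in a
  coset of the quotient.\<close>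

lemma syllable_Cons_eq_iff:
  assumes "\<not> starts_with i u" "\<not> starts_with i v"
    and "(if l = 0 then u else (i, l) # u) = (if m = 0 then v else (i, m) # v)"
  shows "l = m"
  using assms by (auto simp: starts_with_def split: if_splits)

text \<open>These are the full orbits, of length \<open>k\<close>; the room
  \<open>length b < n\<close> ensures that the first syllable is not cut off. Every other reduced
  word has full length and is a fixed point.\<close>

lemma prepend_pow:
  assumes "\<not> starts_with i b" "length b < n" "j < k"
  shows "(prepend k n i ^^ j) b = (if j = 0 then b else (i, j) # b)"
  using assms(3)
proof (induction j)
  case (Suc j)
  then have "(prepend k n i ^^ j) b = (if j = 0 then b else (i, j) # b)" by simp
  then show ?case
    using Suc.prems assms(1,2) by (auto simp: prepend_hit prepend_miss)
qed simp

lemma prepend_pow_order_base: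
  assumes "\<not> starts_with i b" "length b < n" "2 \<le> k"
  shows "(prepend k n i ^^ k) b = b"
proof -
  obtain j where j: "k = Suc j" "j \<noteq> 0" using assms(3) by (cases k) auto
  show ?thesis
    using prepend_pow[OF assms(1,2), of j k] j by (simp add: prepend_hit)
qed

lemma prepend_pow_order:
  assumes "2 \<le> k" "u \<in> reduced_words d k n"
  shows "(prepend k n i ^^ k) u = u"
proof (cases "starts_with i u")
  case True
  then obtain j b where u: "u = (i, j) # b" by (cases u) (auto simp: starts_with_def)
  have b: "\<not> starts_with i b" "length b < n" and j: "j < k" "j \<noteq> 0"
    using assms(2) unfolding reduced_words_def u mem_Collect_eq distinct_adj_Cons_fst by auto
  \<comment> \<open>A word beginning with \<open>i\<close> lies on the orbit of its tail, and
    commuting powers move the claim to that base.\<close>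
  have ub: "u = (prepend k n i ^^ j) b"
    unfolding prepend_pow[OF b j(1)] using j(2) u by simp
  have "(prepend k n i ^^ k) ((prepend k n i ^^ j) b) = (prepend k n i ^^ (j + k)) b"
    by (simp only: add.commute[of j] funpow_add o_apply)
  also have "\<dots> = (prepend k n i ^^ j) b"
    by (simp only: funpow_add o_apply prepend_pow_order_base[OF b assms(1)])
  finally show ?thesis by (simp only: ub[symmetric])
next
  case False
  show ?thesis
  proof (cases "length u < n")
    case True
    then show ?thesis using prepend_pow_order_base[OF False _ assms(1)] by simp
  next
    case False
    then have "prepend k n i u = u" using \<open>\<not> starts_with i u\<close> by (simp add: prepend_def)
    then have "(prepend k n i ^^ j) u = u" for j by (induction j) simp_all
    then show ?thesis .
  qed
qed

lemma prepend_closed: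
  assumes "i \<in> {1..d}" "2 \<le> k" "u \<in> reduced_words d k n"
  shows "prepend k n i u \<in> reduced_words d k n"
proof (cases "starts_with i u")
  case True
  then obtain j b where u: "u = (i, j) # b" by (cases u) (auto simp: starts_with_def)
  show ?thesis
    using assms unfolding u reduced_words_def mem_Collect_eq distinct_adj_Cons_fst
    by (auto simp: prepend_def starts_with_def distinct_adj_Cons_fst simp del: list.map)
next
  case False
  then have "distinct_adj (map fst ((i, 1) # u)) \<longleftrightarrow> distinct_adj (map fst u)"
    unfolding distinct_adj_Cons_fst by simp
  then show ?thesis
    using False assms by (auto simp: prepend_def reduced_words_def)
qed

lemma prepend_pow_closed:
  "i \<in> {1..d} \<Longrightarrow> 2 \<le> k \<Longrightarrow> u \<in> reduced_words d k n \<Longrightarrow> (prepend k n i ^^ j) u \<in> reduced_words d k n"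
  by (induction j) (auto intro: prepend_closed)

text \<open>\<open>Bij\<close> consists of extensional functions, hence the
  \<open>restrict\<close>.\<close>

definition syllable_perm :: "nat \<Rightarrow> nat \<Rightarrow> nat \<Rightarrow> nat \<Rightarrow> (nat \<times> nat) list \<Rightarrow> (nat \<times> nat) list" where
  "syllable_perm d k n i = restrict (prepend k n i) (reduced_words d k n)"

lemma syllable_perm_Bij:
  assumes "i \<in> {1..d}" "2 \<le> k"
  shows "syllable_perm d k n i \<in> Bij (reduced_words d k n)"
proof -
  obtain j where k: "k = Suc j" using assms(2) by (cases k) auto
  note order = prepend_pow_order[OF assms(2)]
  have "bij_betw (prepend k n i) (reduced_words d k n) (reduced_words d k n)"
  \<comment> \<open>The inverse is the power with exponent \<open>j = k - 1\<close>.\<close>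
  proof (rule bij_betw_byWitness[where f' = "prepend k n i ^^ j"])
    show "\<forall>u\<in>reduced_words d k n. (prepend k n i ^^ j) (prepend k n i u) = u"
      using order unfolding k funpow_Suc_right by (simp flip: k)
    show "\<forall>u\<in>reduced_words d k n. prepend k n i ((prepend k n i ^^ j) u) = u"
      using order unfolding k funpow.simps by (simp flip: k)
  qed (use prepend_closed[OF assms] prepend_pow_closed[OF assms] in auto)
  then show ?thesis
    by (simp add: Bij_def syllable_perm_def cong: bij_betw_cong)
qed

lemma carrier_BijGroup: "carrier (BijGroup S) = Bij S"
  by (simp add: BijGroup_def)

lemma one_BijGroup: "\<one>\<^bsub>BijGroup S\<^esub> = (\<lambda>x\<in>S. x)"
  by (simp add: BijGroup_def)

lemma BijGroup_mult_apply:
  "f \<in> Bij S \<Longrightarrow> g \<in> Bij S \<Longrightarrow> x \<in> S \<Longrightarrow> (f \<otimes>\<^bsub>BijGroup S\<^esub> g) x = f (g x)"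
  by (simp add: BijGroup_def compose_def)

lemma syllable_perm_pow:
  assumes "i \<in> {1..d}" "2 \<le> k" "u \<in> reduced_words d k n"
  shows "(syllable_perm d k n i [^]\<^bsub>BijGroup (reduced_words d k n)\<^esub> (j::nat)) u = (prepend k n i ^^ j) u"
  using assms(3)
proof (induction j arbitrary: u)
  case 0
  interpret B: group "BijGroup (reduced_words d k n)" by (rule group_BijGroup)
  show ?case using 0 by (simp add: one_BijGroup)
next
  case (Suc j)
  interpret B: group "BijGroup (reduced_words d k n)" by (rule group_BijGroup)
  have s: "syllable_perm d k n i \<in> Bij (reduced_words d k n)" by (rule syllable_perm_Bij[OF assms(1,2)])
  moreover have "syllable_perm d k n i [^]\<^bsub>BijGroup (reduced_words d k n)\<^esub> j \<in> Bij (reduced_words d k n)"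
    using B.nat_pow_closed[of "syllable_perm d k n i" j] s by (simp add: carrier_BijGroup)
  ultimately have "(syllable_perm d k n i [^]\<^bsub>BijGroup (reduced_words d k n)\<^esub> Suc j) u
    = (syllable_perm d k n i [^]\<^bsub>BijGroup (reduced_words d k n)\<^esub> j) (prepend k n i u)"
    unfolding B.nat_pow_Suc using Suc.prems by (subst BijGroup_mult_apply) (simp_all add: syllable_perm_def)
  then show ?case
    using Suc.IH[OF prepend_closed[OF assms(1,2) Suc.prems]] by (simp only: funpow_Suc_right o_apply)
qed

lemma Bij_eqI: "f \<in> Bij S \<Longrightarrow> g \<in> Bij S \<Longrightarrow> (\<And>x. x \<in> S \<Longrightarrow> f x = g x) \<Longrightarrow> f = g"
  by (auto simp: Bij_def intro: extensionalityI)

lemma syllable_perm_pow_order: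
  assumes "i \<in> {1..d}" "2 \<le> k"
  shows "syllable_perm d k n i [^]\<^bsub>BijGroup (reduced_words d k n)\<^esub> k = \<one>\<^bsub>BijGroup (reduced_words d k n)\<^esub>"
proof (rule Bij_eqI)
  interpret B: group "BijGroup (reduced_words d k n)" by (rule group_BijGroup)
  show "syllable_perm d k n i [^]\<^bsub>BijGroup (reduced_words d k n)\<^esub> k \<in> Bij (reduced_words d k n)"
    using B.nat_pow_closed[of "syllable_perm d k n i" k] syllable_perm_Bij[OF assms, of n] by (simp add: carrier_BijGroup)
  show "\<one>\<^bsub>BijGroup (reduced_words d k n)\<^esub> \<in> Bij (reduced_words d k n)"
    using B.one_closed by (simp add: carrier_BijGroup)
qed (use assms in \<open>simp add: syllable_perm_pow prepend_pow_order one_BijGroup\<close>)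

text \<open>Reads a group element back from a word. As a left inverse of acting on the empty word,
  it yields injectivity on short elements without a normal form theorem for free products.\<close>

definition syllable_prod :: "nat \<Rightarrow> nat \<Rightarrow> (nat \<times> nat) list \<Rightarrow> nat gword set" where
  "syllable_prod d k u = foldr (\<lambda>(i, j) x. Gamma_gen d k i [^]\<^bsub>Gamma_group d k\<^esub> j \<otimes>\<^bsub>Gamma_group d k\<^esub> x) u \<one>\<^bsub>Gamma_group d k\<^esub>"

lemma syllable_prod_closed: "set u \<subseteq> {1..d} \<times> UNIV \<Longrightarrow> syllable_prod d k u \<in> carrier (Gamma_group d k)"
proof (induction u)
  case (Cons x u)
  interpret group "Gamma_group d k" by (rule group_Gamma)
  show ?case using Cons Gamma_gen_closed[of "fst x" d k] by (auto simp: syllable_prod_def)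
qed (simp add: syllable_prod_def group.is_monoid[OF group_Gamma] monoid.one_closed)

text \<open>The truncation is invisible on words shorter than \<open>n\<close>; the relator of
  \<open>i\<close> accounts for the case where the exponent reaches \<open>k\<close> and the
  syllable disappears.\<close>

lemma syllable_prod_prepend:
  assumes "i \<in> {1..d}" "u \<in> reduced_words d k n" "length u < n"
  shows "syllable_prod d k (prepend k n i u) = Gamma_gen d k i \<otimes>\<^bsub>Gamma_group d k\<^esub> syllable_prod d k u"
proof -
  interpret group "Gamma_group d k" by (rule group_Gamma)
  have s: "Gamma_gen d k i \<in> carrier (Gamma_group d k)" by (rule Gamma_gen_closed[OF assms(1)])
  show ?thesis
  proof (cases "starts_with i u")
    case True
    then obtain j b where u: "u = (i, j) # b" by (cases u) (auto simp: starts_with_def)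
    have b: "syllable_prod d k b \<in> carrier (Gamma_group d k)"
      using assms(2) by (intro syllable_prod_closed) (auto simp: reduced_words_def u)
    have "Gamma_gen d k i \<otimes>\<^bsub>Gamma_group d k\<^esub> syllable_prod d k u
      = Gamma_gen d k i [^]\<^bsub>Gamma_group d k\<^esub> Suc j \<otimes>\<^bsub>Gamma_group d k\<^esub> syllable_prod d k b"
      unfolding nat_pow_Suc2[OF s] using s b by (simp add: syllable_prod_def u m_assoc)
    also have "\<dots> = syllable_prod d k (prepend k n i u)"
    proof (cases "Suc j = k")
      case True
      then have "Gamma_gen d k i [^]\<^bsub>Gamma_group d k\<^esub> Suc j = \<one>\<^bsub>Gamma_group d k\<^esub>"
        using Gamma_gen_pow_order[OF assms(1), of k] by simp
      moreover have "prepend k n i u = b"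
        using True by (simp add: prepend_def u starts_with_def)
      ultimately show ?thesis using b by (simp only: l_one)
    next
      case False
      then have "prepend k n i u = (i, Suc j) # b"
        by (simp add: prepend_def u starts_with_def)
      then show ?thesis by (simp add: syllable_prod_def)
    qed
    finally show ?thesis by simp
  next
    case False
    then show ?thesis
      using assms s by (simp add: prepend_def syllable_prod_def)
  qed
qed

text \<open>One generator lengthens a word by at most one syllable, so a product of at most
  \<open>n\<close> generators applied to the empty word never meets the truncation.\<close>

lemma prepend_gen_prod:
  assumes "set js \<subseteq> {1..d}" "length js \<le> n" "2 \<le> k"
  shows "foldr (prepend k n) js [] \<in> reduced_words d k n \<and> length (foldr (prepend k n) js []) \<le> length js
    \<and> syllable_prod d k (foldr (prepend k n) js []) = gen_prod d k js"
  using assms(1,2)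
proof (induction js)
  case Nil
  then show ?case by (simp add: reduced_words_def syllable_prod_def gen_prod_def)
next
  case (Cons i js)
  let ?u = "foldr (prepend k n) js []"
  have i: "i \<in> {1..d}" and "set js \<subseteq> {1..d}" "length js < n" using Cons.prems by auto
  then have IH: "?u \<in> reduced_words d k n" "length ?u \<le> length js" "syllable_prod d k ?u = gen_prod d k js"
    using Cons.IH by auto
  then have "length ?u < n" using \<open>length js < n\<close> by simp
  moreover have "length (prepend k n i ?u) \<le> Suc (length js)"
    using IH(2) by (auto simp: prepend_def)
  ultimately show ?case
    using prepend_closed[OF i assms(3) IH(1)] syllable_prod_prepend[OF i IH(1)] IH(3) by (simp add: gen_prod_def)
qed

text \<open>
  In the proof \<open>R i\<close> consists of the elements whose inverse, as a reduced word, does not begin with a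
  power of \<open>s\<^sub>i\<close>, that is, of the elements \<open>g\<close> closest to the identity in \<open>g\<langle>s\<^sub>i\<rangle>\<close>. Every \<open>g\<close> has
  this role for all \<open>i\<close> but at most one.
\<close>

lemma Gamma_finite_quotient:
  assumes k: "2 \<le> k" and E: "finite E" "E \<subseteq> carrier (Gamma_group d k)"
  obtains Q :: "((nat \<times> nat) list \<Rightarrow> (nat \<times> nat) list) monoid" and \<pi> R
  where "group Q" "finite (carrier Q)" "\<pi> \<in> hom (Gamma_group d k) Q" "inj_on \<pi> E"
    "\<And>i. i \<in> {1..d} \<Longrightarrow> R i \<subseteq> m_inv Q ` \<pi> ` E"
    "\<And>g. g \<in> m_inv Q ` \<pi> ` E \<Longrightarrow> d - 1 \<le> card {i\<in>{1..d}. g \<in> R i}"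
    "\<And>i. i \<in> {1..d} \<Longrightarrow> inj_on (\<lambda>(g, j). g \<otimes>\<^bsub>Q\<^esub> \<pi> (Gamma_gen d k i) [^]\<^bsub>Q\<^esub> j) (R i \<times> {..<k})"
proof -
  interpret \<Gamma>: group "Gamma_group d k" by (rule group_Gamma)
  have "\<exists>js. set js \<subseteq> {1..d} \<and> g = gen_prod d k js" if "g \<in> E" for g
    using gen_prod_surj[of g d k] k E(2) that by (metis gr0I not_numeral_le_zero subsetD)
  then obtain W where W: "\<And>g. g \<in> E \<Longrightarrow> set (W g) \<subseteq> {1..d}" "\<And>g. g \<in> E \<Longrightarrow> g = gen_prod d k (W g)"
    by metis
  \<comment> \<open>\<open>Suc\<close> leaves room for one more syllable: images of the empty word
    under \<open>E\<close> are strictly shorter than \<open>n\<close>, so those not starting with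
    \<open>i\<close> are bases of full orbits.\<close>
  define n where "n = Suc (\<Sum>g\<in>E. length (W g))"
  have n: "length (W g) < n" if "g \<in> E" for g
    using member_le_sum[OF that, of "\<lambda>g. length (W g)"] E(1) by (simp add: n_def)
  define S where "S = reduced_words d k n"
  define Q where "Q = BijGroup S"
  let ?\<sigma> = "syllable_perm d k n"
  interpret Q: group Q unfolding Q_def by (rule group_BijGroup)
  have cQ: "carrier Q = Bij S" by (simp add: Q_def carrier_BijGroup)
  have Q_apply: "(f \<otimes>\<^bsub>Q\<^esub> g) u = f (g u)" if "f \<in> carrier Q" "g \<in> carrier Q" "u \<in> S" for f g u
    using that unfolding cQ unfolding Q_def by (rule BijGroup_mult_apply)
  have Nil: "[] \<in> S" by (simp add: S_def reduced_words_def)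
  have "finite (S \<rightarrow>\<^sub>E S)" by (intro finite_PiE) (auto simp: S_def finite_reduced_words)
  then have fin: "finite (carrier Q)"
    unfolding cQ by (rule finite_subset[rotated]) (auto simp: Bij_def PiE_def bij_betw_def)
  have sc: "?\<sigma> i \<in> carrier Q" if "i \<in> {1..d}" for i
    using syllable_perm_Bij[OF that k] by (simp add: cQ S_def)
  have sk: "?\<sigma> i [^]\<^bsub>Q\<^esub> k = \<one>\<^bsub>Q\<^esub>" if "i \<in> {1..d}" for i
    unfolding Q_def S_def by (rule syllable_perm_pow_order[OF that k])
  obtain \<pi> where \<pi>: "\<pi> \<in> hom (Gamma_group d k) Q" "\<And>i. i \<in> {1..d} \<Longrightarrow> \<pi> (Gamma_gen d k i) = ?\<sigma> i"
    by (rule Gamma_hom[where d = d and k = k and h = ?\<sigma>, OF Q.group_axioms sc sk]) (assumption, assumption, rule that)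
  interpret \<pi>: group_hom "Gamma_group d k" Q \<pi>
    by unfold_locales (rule \<pi>(1))
  have \<pi>_gen_prod: "\<pi> (gen_prod d k js) [] = foldr (prepend k n) js []" if "set js \<subseteq> {1..d}" "length js \<le> n" for js
    using that
  proof (induction js)
    case Nil
    then show ?case using \<open>[] \<in> S\<close> \<pi>.hom_one by (simp add: gen_prod_def) (simp add: Q_def one_BijGroup)
  next
    case (Cons i js)
    have i: "i \<in> {1..d}" and js: "set js \<subseteq> {1..d}" "length js \<le> n" using Cons.prems by auto
    have "gen_prod d k (i # js) = Gamma_gen d k i \<otimes>\<^bsub>Gamma_group d k\<^esub> gen_prod d k js"
      by (simp add: gen_prod_def)
    then have "\<pi> (gen_prod d k (i # js)) [] = (?\<sigma> i \<otimes>\<^bsub>Q\<^esub> \<pi> (gen_prod d k js)) []"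
      using Gamma_gen_closed[OF i] gen_prod_closed[OF js(1)] \<pi>(2)[OF i] by simp
    also have "\<dots> = ?\<sigma> i (foldr (prepend k n) js [])"
      using Q_apply[OF sc[OF i] _ Nil] gen_prod_closed[OF js(1)] Cons.IH[OF js] by simp
    also have "\<dots> = prepend k n i (foldr (prepend k n) js [])"
      using prepend_gen_prod[OF js k] by (simp add: syllable_perm_def)
    finally show ?case by simp
  qed
  have \<pi>E: "\<pi> g [] \<in> S" "length (\<pi> g []) < n" "syllable_prod d k (\<pi> g []) = g" if "g \<in> E" for g
  proof -
    have "\<pi> g [] = foldr (prepend k n) (W g) []"
      using \<pi>_gen_prod[OF W(1)[OF that]] n[OF that] W(2)[OF that] by simp
    then show "\<pi> g [] \<in> S" "length (\<pi> g []) < n" "syllable_prod d k (\<pi> g []) = g"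
      using prepend_gen_prod[OF W(1)[OF that] _ k, of n] n[OF that] W(2)[OF that] by (auto simp: S_def)
  qed
  \<comment> \<open>Words are acted on from the left, while cosets arise by multiplying on the
    right; passing to the inverse turns one into the other.\<close>
  define R where "R i = {q \<in> m_inv Q ` \<pi> ` E. \<not> starts_with i ((inv\<^bsub>Q\<^esub> q) [])}" for i
  have EQ: "m_inv Q ` \<pi> ` E \<subseteq> carrier Q" using E(2) by auto
  have inv_S: "(inv\<^bsub>Q\<^esub> q) [] \<in> S" "length ((inv\<^bsub>Q\<^esub> q) []) < n" if q: "q \<in> m_inv Q ` \<pi> ` E" for q
  proof -
    obtain g where "g \<in> E" "q = inv\<^bsub>Q\<^esub> (\<pi> g)" using q by auto
    then have "inv\<^bsub>Q\<^esub> q = \<pi> g" using E(2) by auto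
    then show "(inv\<^bsub>Q\<^esub> q) [] \<in> S" "length ((inv\<^bsub>Q\<^esub> q) []) < n" using \<pi>E[OF \<open>g \<in> E\<close>] by auto
  qed
  show thesis
  proof (rule that[OF Q.group_axioms fin \<pi>(1)])
    show "inj_on \<pi> E"
      using \<pi>E(3) by (intro inj_onI) metis
    show "R i \<subseteq> m_inv Q ` \<pi> ` E" for i by (auto simp: R_def)
    show "d - 1 \<le> card {i\<in>{1..d}. q \<in> R i}" if q: "q \<in> m_inv Q ` \<pi> ` E" for q
    proof -
      have "d - 1 \<le> card ({1..d} - {fst (hd ((inv\<^bsub>Q\<^esub> q) []))})"
        using diff_card_le_card_Diff[of "{fst (hd ((inv\<^bsub>Q\<^esub> q) []))}" "{1..d}"] by simp
      also have "\<dots> \<le> card {i\<in>{1..d}. q \<in> R i}"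
        using q by (intro card_mono) (auto simp: R_def starts_with_def)
      finally show ?thesis .
    qed
    fix i assume i: "i \<in> {1..d}"
    have sn: "?\<sigma> i [^]\<^bsub>Q\<^esub> (j::nat) \<in> carrier Q" for j using sc[OF i] by simp
    have key: "(?\<sigma> i [^]\<^bsub>Q\<^esub> l) ((inv\<^bsub>Q\<^esub> q) []) = (if l = 0 then (inv\<^bsub>Q\<^esub> q) [] else (i, l) # (inv\<^bsub>Q\<^esub> q) [])"
      if "q \<in> R i" "l < k" for q l
      using that syllable_perm_pow[OF i k, of "(inv\<^bsub>Q\<^esub> q) []" n l] inv_S[of q]
        prepend_pow[of i "(inv\<^bsub>Q\<^esub> q) []" n l k] by (auto simp: Q_def S_def R_def)
    show "inj_on (\<lambda>(g, j). g \<otimes>\<^bsub>Q\<^esub> \<pi> (Gamma_gen d k i) [^]\<^bsub>Q\<^esub> j) (R i \<times> {..<k})"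
    proof (rule inj_onI, clarify)
      fix q j q' j' assume *: "q \<in> R i" "j < k" "q' \<in> R i" "j' < k"
        "q \<otimes>\<^bsub>Q\<^esub> \<pi> (Gamma_gen d k i) [^]\<^bsub>Q\<^esub> j = q' \<otimes>\<^bsub>Q\<^esub> \<pi> (Gamma_gen d k i) [^]\<^bsub>Q\<^esub> j'"
      let ?t = "?\<sigma> i"
      have q: "q \<in> carrier Q" "q' \<in> carrier Q" "q \<in> m_inv Q ` \<pi> ` E" "q' \<in> m_inv Q ` \<pi> ` E"
        using *(1,3) EQ by (auto simp: R_def)
      have eq: "q \<otimes>\<^bsub>Q\<^esub> ?t [^]\<^bsub>Q\<^esub> j = q' \<otimes>\<^bsub>Q\<^esub> ?t [^]\<^bsub>Q\<^esub> j'" using *(5) \<pi>(2)[OF i] by simp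
      have "inv\<^bsub>Q\<^esub> (q \<otimes>\<^bsub>Q\<^esub> ?t [^]\<^bsub>Q\<^esub> j) = inv\<^bsub>Q\<^esub> (?t [^]\<^bsub>Q\<^esub> j) \<otimes>\<^bsub>Q\<^esub> inv\<^bsub>Q\<^esub> q"
        "inv\<^bsub>Q\<^esub> (q' \<otimes>\<^bsub>Q\<^esub> ?t [^]\<^bsub>Q\<^esub> j') = inv\<^bsub>Q\<^esub> (?t [^]\<^bsub>Q\<^esub> j') \<otimes>\<^bsub>Q\<^esub> inv\<^bsub>Q\<^esub> q'"
        using q(1,2) sn by (simp_all add: Q.inv_mult_group)
      with eq have inveq: "inv\<^bsub>Q\<^esub> (?t [^]\<^bsub>Q\<^esub> j) \<otimes>\<^bsub>Q\<^esub> inv\<^bsub>Q\<^esub> q = inv\<^bsub>Q\<^esub> (?t [^]\<^bsub>Q\<^esub> j') \<otimes>\<^bsub>Q\<^esub> inv\<^bsub>Q\<^esub> q'" by simp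
      \<comment> \<open>Multiplying the inverted equation by both powers of \<open>?t\<close>
        replaces its negative powers by \<open>j'\<close> on one side and \<open>j\<close> on the
        other, to which \<open>key\<close> applies.\<close>
      have "?t [^]\<^bsub>Q\<^esub> j' \<otimes>\<^bsub>Q\<^esub> inv\<^bsub>Q\<^esub> q = ?t [^]\<^bsub>Q\<^esub> j' \<otimes>\<^bsub>Q\<^esub> (?t [^]\<^bsub>Q\<^esub> j \<otimes>\<^bsub>Q\<^esub> (inv\<^bsub>Q\<^esub> (?t [^]\<^bsub>Q\<^esub> j) \<otimes>\<^bsub>Q\<^esub> inv\<^bsub>Q\<^esub> q))"
        using q sn[of j] sn[of j'] by (simp add: Q.m_assoc[symmetric])
      also have "\<dots> = ?t [^]\<^bsub>Q\<^esub> j' \<otimes>\<^bsub>Q\<^esub> (?t [^]\<^bsub>Q\<^esub> j \<otimes>\<^bsub>Q\<^esub> (inv\<^bsub>Q\<^esub> (?t [^]\<^bsub>Q\<^esub> j') \<otimes>\<^bsub>Q\<^esub> inv\<^bsub>Q\<^esub> q'))"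
        by (simp only: inveq)
      also have "\<dots> = (?t [^]\<^bsub>Q\<^esub> j' \<otimes>\<^bsub>Q\<^esub> ?t [^]\<^bsub>Q\<^esub> j) \<otimes>\<^bsub>Q\<^esub> (inv\<^bsub>Q\<^esub> (?t [^]\<^bsub>Q\<^esub> j') \<otimes>\<^bsub>Q\<^esub> inv\<^bsub>Q\<^esub> q')"
        using q sn by (simp add: Q.m_assoc)
      also have "?t [^]\<^bsub>Q\<^esub> j' \<otimes>\<^bsub>Q\<^esub> ?t [^]\<^bsub>Q\<^esub> j = ?t [^]\<^bsub>Q\<^esub> j \<otimes>\<^bsub>Q\<^esub> ?t [^]\<^bsub>Q\<^esub> j'"
        using sc[OF i] by (simp add: Q.nat_pow_mult add.commute)
      also have "(?t [^]\<^bsub>Q\<^esub> j \<otimes>\<^bsub>Q\<^esub> ?t [^]\<^bsub>Q\<^esub> j') \<otimes>\<^bsub>Q\<^esub> (inv\<^bsub>Q\<^esub> (?t [^]\<^bsub>Q\<^esub> j') \<otimes>\<^bsub>Q\<^esub> inv\<^bsub>Q\<^esub> q')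
          = ?t [^]\<^bsub>Q\<^esub> j \<otimes>\<^bsub>Q\<^esub> (?t [^]\<^bsub>Q\<^esub> j' \<otimes>\<^bsub>Q\<^esub> inv\<^bsub>Q\<^esub> (?t [^]\<^bsub>Q\<^esub> j')) \<otimes>\<^bsub>Q\<^esub> inv\<^bsub>Q\<^esub> q'"
        using q sn by (simp add: Q.m_assoc del: Q.r_inv Q.Units_r_inv)
      also have "\<dots> = ?t [^]\<^bsub>Q\<^esub> j \<otimes>\<^bsub>Q\<^esub> inv\<^bsub>Q\<^esub> q'"
        using q sn by simp
      finally have "(?t [^]\<^bsub>Q\<^esub> j' \<otimes>\<^bsub>Q\<^esub> inv\<^bsub>Q\<^esub> q) [] = (?t [^]\<^bsub>Q\<^esub> j \<otimes>\<^bsub>Q\<^esub> inv\<^bsub>Q\<^esub> q') []" by simp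
      then have "(?t [^]\<^bsub>Q\<^esub> j') ((inv\<^bsub>Q\<^esub> q) []) = (?t [^]\<^bsub>Q\<^esub> j) ((inv\<^bsub>Q\<^esub> q') [])"
        using Q_apply[OF sn _ Nil] q by simp
      then have "j' = j"
        using key[OF *(1,4)] key[OF *(3,2)] *(1,3)
        by (intro syllable_Cons_eq_iff[of i "(inv\<^bsub>Q\<^esub> q) []" "(inv\<^bsub>Q\<^esub> q') []"]) (simp_all add: R_def)
      with eq q sn show "q = q' \<and> j = j'" by simp
    qed
  qed
qed

section \<open>Noise and parity\<close>

lemma entropy_pmf_ge:
  assumes "finite (set_pmf p)"
  shows "- pmf p x * ln (pmf p x) \<le> entropy_pmf p"
proof (cases "x \<in> set_pmf p")
  case True
  then show ?thesis
    unfolding entropy_pmf_def using assms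
    by (intro member_le_sum[where f = "\<lambda>x. - pmf p x * ln (pmf p x)"])
      (auto intro!: mult_nonneg_nonpos simp: pmf_le_1 pmf_positive)
next
  case False
  then show ?thesis
    using entropy_pmf_nonneg[of p] by (simp add: set_pmf_iff)
qed

text \<open>Gibbs' inequality against the weight \<open>c\<close> on the points other than
  \<open>x\<close>; the term of \<open>x\<close> is at most \<open>1 - pmf p x\<close>, which
  cancels the linear part. It will be used with \<open>x\<close> the zero pattern and
  \<open>c\<close> the density.\<close>

lemma entropy_pmf_le:
  fixes c :: real
  assumes A: "finite A" "set_pmf p \<subseteq> A" and c: "0 < c"
  shows "entropy_pmf p \<le> (1 - pmf p x) * - ln c + card A * c"
proof -
  let ?S = "set_pmf p - {x}"
  have fin: "finite (set_pmf p)" using A finite_subset by blast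
  have sum1: "(\<Sum>y\<in>?S. pmf p y) = 1 - pmf p x"
    using fin sum_pmf_eq_1[OF fin, of p] by (cases "x \<in> set_pmf p") (auto simp: sum_diff1 set_pmf_iff)
  have "entropy_pmf p \<le> - pmf p x * ln (pmf p x) + (\<Sum>y\<in>?S. - pmf p y * ln (pmf p y))"
    unfolding entropy_pmf_def using fin
    by (cases "x \<in> set_pmf p") (auto simp: sum.remove set_pmf_iff)
  also have "- pmf p x * ln (pmf p x) \<le> 1 - pmf p x"
  proof (cases "pmf p x = 0")
    case False
    then have pos: "0 < pmf p x" by (simp add: pmf_nonneg order_less_le)
    have "pmf p x * ln (1 / pmf p x) \<le> pmf p x * (1 / pmf p x - 1)"
      using pos by (intro mult_left_mono ln_le_minus_one) auto
    then show ?thesis using pos by (simp add: ln_div algebra_simps)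
  qed simp
  also have "(\<Sum>y\<in>?S. - pmf p y * ln (pmf p y)) \<le> (\<Sum>y\<in>?S. c - pmf p y + pmf p y * - ln c)"
  proof (rule sum_mono)
    fix y assume "y \<in> ?S"
    then have pos: "0 < pmf p y" by (simp add: pmf_positive)
    have "pmf p y * ln (c / pmf p y) \<le> pmf p y * (c / pmf p y - 1)"
      using pos c by (intro mult_left_mono ln_le_minus_one) auto
    then show "- pmf p y * ln (pmf p y) \<le> c - pmf p y + pmf p y * - ln c"
      using pos c by (simp add: ln_div algebra_simps)
  qed
  also have "\<dots> = card ?S * c - (1 - pmf p x) + (1 - pmf p x) * - ln c"
    unfolding sum.distrib sum_subtractf sum_distrib_right[symmetric] sum1 by simp
  also have "real (card ?S) * c \<le> card A * c"
    using A c by (intro mult_right_mono) (auto intro!: card_mono)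
  finally show ?thesis by simp
qed

lemma Pi_pmf_pair:
  fixes p :: "'a \<Rightarrow> 'b pmf" and q :: "'a \<Rightarrow> 'c pmf"
  assumes "finite A"
  shows "map_pmf (\<lambda>Y. (fst \<circ> Y, snd \<circ> Y)) (Pi_pmf A (a, b) (\<lambda>x. pair_pmf (p x) (q x)))
    = pair_pmf (Pi_pmf A a p) (Pi_pmf A b q)"
proof (rule pmf_eqI, clarify)
  fix u :: "'a \<Rightarrow> 'b" and v :: "'a \<Rightarrow> 'c"
  let ?Y = "\<lambda>x. (u x, v x)"
  have inj: "inj (\<lambda>Y. (fst \<circ> Y, snd \<circ> Y))"
    by (auto simp: inj_def fun_eq_iff prod_eq_iff)
  have "pmf (map_pmf (\<lambda>Y. (fst \<circ> Y, snd \<circ> Y)) (Pi_pmf A (a, b) (\<lambda>x. pair_pmf (p x) (q x)))) (u, v)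
    = pmf (Pi_pmf A (a, b) (\<lambda>x. pair_pmf (p x) (q x))) ?Y"
    using pmf_map_inj'[OF inj, of _ ?Y] by (simp add: o_def)
  also have "\<dots> = pmf (Pi_pmf A a p) u * pmf (Pi_pmf A b q) v"
    using assms by (auto simp: pmf_Pi pmf_pair prod.distrib)
  finally show "pmf (map_pmf (\<lambda>Y. (fst \<circ> Y, snd \<circ> Y)) (Pi_pmf A (a, b) (\<lambda>x. pair_pmf (p x) (q x)))) (u, v)
    = pmf (pair_pmf (Pi_pmf A a p) (Pi_pmf A b q)) (u, v)"
    by (simp add: pmf_pair)
qed

section \<open>Resampled seeds\<close>

fun resample :: "'s \<times> 's \<times> bool \<Rightarrow> 's" where
  "resample (a, b, c) = (if c then b else a)"

text \<open>A seed, a fresh independent copy and a coin deciding whether the copy replaces it. Both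
  \<open>fst\<close> and \<open>resample\<close> have law \<open>p\<close>, and \<open>t\<close>
  interpolates between equal and independent copies.\<close>

definition noisy_seed :: "real \<Rightarrow> 's pmf \<Rightarrow> ('s \<times> 's \<times> bool) pmf" where
  "noisy_seed t p = pair_pmf p (pair_pmf p (bernoulli_pmf t))"

lemma map_fst_noisy_seed: "map_pmf fst (noisy_seed t p) = p"
  by (simp add: noisy_seed_def map_fst_pair_pmf)

lemma map_resample_noisy_seed: "map_pmf resample (noisy_seed t p) = p"
proof -
  have "map_pmf resample (noisy_seed t p)
    = bind_pmf p (\<lambda>a. bind_pmf p (\<lambda>b. bind_pmf (bernoulli_pmf t) (\<lambda>c. return_pmf (if c then b else a))))"
    by (simp add: noisy_seed_def pair_pmf_def map_bind_pmf bind_assoc_pmf bind_return_pmf)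
  \<comment> \<open>With the coin tossed first, either outcome leaves a seed of law
    \<open>p\<close>.\<close>
  also have "\<dots> = bind_pmf (bernoulli_pmf t) (\<lambda>c. bind_pmf p (\<lambda>a. bind_pmf p (\<lambda>b. return_pmf (if c then b else a))))"
    by (subst bind_commute_pmf, subst (2) bind_commute_pmf) simp
  also have "\<dots> = bind_pmf (bernoulli_pmf t) (\<lambda>c. p)"
  proof -
    have "bind_pmf p (\<lambda>a. bind_pmf p (\<lambda>b. return_pmf (if c then b else a))) = p" for c
      by (cases c) (simp_all add: bind_return_pmf' bind_pmf_const)
    then show ?thesis by simp
  qed
  finally show ?thesis by (simp add: bind_pmf_const)
qed

text \<open>Parity is additive modulo two, so a parity failure of the xor forces a failure of one of
  the two copies.\<close>

lemma odd_sum_xor: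
  fixes k :: nat
  shows "odd (\<Sum>j<k. of_bool (P j \<noteq> Q j) :: nat) \<longleftrightarrow> odd (\<Sum>j<k. of_bool (P j) :: nat) \<noteq> odd (\<Sum>j<k. of_bool (Q j) :: nat)"
  by (induction k) auto

lemma not_in_set_bernoulli_0: "True \<notin> set_pmf (bernoulli_pmf 0)"
  by (simp add: set_pmf_iff)

lemma not_in_set_bernoulli_1: "False \<notin> set_pmf (bernoulli_pmf 1)"
  by (simp add: set_pmf_iff)

context finite_block_code
begin

definition noisy_map :: "('q \<Rightarrow> 's \<times> 's \<times> bool) \<Rightarrow> bool" where
  "noisy_map Y \<longleftrightarrow> f (fst \<circ> Y) \<noteq> f (resample \<circ> Y)"

lemma noisy_block_code: "finite_block_code Q (noisy_seed t p) D noisy_map"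
proof
  show "finite (set_pmf (noisy_seed t p))"
    using finite_seeds by (simp add: noisy_seed_def)
  show "noisy_map Y = noisy_map Y'" if "\<And>g. g \<in> D \<Longrightarrow> Y g = Y' g" for Y Y'
    using local[of "fst \<circ> Y" "fst \<circ> Y'"] local[of "resample \<circ> Y" "resample \<circ> Y'"] that
    by (simp add: noisy_map_def)
qed (rule finite_carrier window)+

definition noisy_seeds :: "real \<Rightarrow> ('q \<Rightarrow> 's \<times> 's \<times> bool) pmf" where
  "noisy_seeds t = Pi_pmf (carrier Q) (dflt, dflt, False) (\<lambda>_. noisy_seed t p)"

lemma map_fst_noisy_seeds: "map_pmf (\<lambda>Y. fst \<circ> Y) (noisy_seeds t) = seeds"
  using Pi_pmf_map[OF finite_carrier, of fst "(dflt, dflt, False)" dflt "\<lambda>_. noisy_seed t p"]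
  by (simp add: noisy_seeds_def seeds_def map_fst_noisy_seed)

lemma map_resample_noisy_seeds: "map_pmf (\<lambda>Y. resample \<circ> Y) (noisy_seeds t) = seeds"
  using Pi_pmf_map[OF finite_carrier, of resample "(dflt, dflt, False)" dflt "\<lambda>_. noisy_seed t p"]
  by (simp add: noisy_seeds_def seeds_def map_resample_noisy_seed)

lemma set_noisy_seeds:
  "set_pmf (noisy_seeds t) = PiE_dflt (carrier Q) (dflt, dflt, False) (\<lambda>_. set_pmf p \<times> set_pmf p \<times> set_pmf (bernoulli_pmf t))"
  using finite_carrier by (simp add: noisy_seeds_def set_Pi_pmf noisy_seed_def o_def)

definition noisy_density :: "real \<Rightarrow> real" where
  "noisy_density t = measure_pmf.prob (noisy_seeds t) {Y. noisy_map Y}"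

lemma noisy_density_0: "noisy_density 0 = 0"
proof -
  have "resample \<circ> Y = fst \<circ> Y" if "Y \<in> set_pmf (noisy_seeds 0)" for Y
  proof
    fix q show "(resample \<circ> Y) q = (fst \<circ> Y) q"
      using that not_in_set_bernoulli_0
      by (cases "q \<in> carrier Q"; cases "Y q"; cases "snd (snd (Y q))") (force simp: set_noisy_seeds PiE_dflt_def)+
  qed
  then show ?thesis
    by (auto simp: noisy_density_def measure_pmf_zero_iff noisy_map_def)
qed

lemma noisy_density_1:
  defines "q \<equiv> measure_pmf.prob seeds {U. f U}"
  shows "noisy_density 1 = 2 * q * (1 - q)"
proof -
  have "map_pmf (\<lambda>Y. (f (fst \<circ> Y), f (resample \<circ> Y))) (noisy_seeds 1)
    = map_pmf (\<lambda>Y. (f (fst \<circ> Y), f (fst \<circ> (snd \<circ> Y)))) (noisy_seeds 1)"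
  proof (rule map_pmf_cong[OF HOL.refl])
    fix Y assume Y: "Y \<in> set_pmf (noisy_seeds 1)"
    have "resample (Y q) = fst (snd (Y q))" for q
      using Y not_in_set_bernoulli_1
      by (cases "q \<in> carrier Q"; cases "Y q"; cases "snd (snd (Y q))") (force simp: set_noisy_seeds PiE_dflt_def)+
    then show "(f (fst \<circ> Y), f (resample \<circ> Y)) = (f (fst \<circ> Y), f (fst \<circ> (snd \<circ> Y)))"
      by (simp add: o_def)
  qed
  also have "\<dots> = map_pmf (\<lambda>(a, b). (f a, f (fst \<circ> b))) (map_pmf (\<lambda>Y. (fst \<circ> Y, snd \<circ> Y)) (noisy_seeds 1))"
    by (simp add: pmf.map_comp o_def)
  also have "\<dots> = map_pmf (\<lambda>(a, b). (f a, f (fst \<circ> b)))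
      (pair_pmf seeds (Pi_pmf (carrier Q) (dflt, False) (\<lambda>_. pair_pmf p (bernoulli_pmf 1))))"
    unfolding noisy_seeds_def noisy_seed_def seeds_def by (simp only: Pi_pmf_pair[OF finite_carrier])
  also have "\<dots> = pair_pmf (map_pmf f seeds) (map_pmf f (map_pmf (\<lambda>b. fst \<circ> b) (Pi_pmf (carrier Q) (dflt, False) (\<lambda>_. pair_pmf p (bernoulli_pmf 1)))))"
    by (subst map_pair) (simp add: pmf.map_comp o_def)
  also have "map_pmf (\<lambda>b. fst \<circ> b) (Pi_pmf (carrier Q) (dflt, False) (\<lambda>_. pair_pmf p (bernoulli_pmf 1))) = seeds"
    using Pi_pmf_map[OF finite_carrier, of fst "(dflt, False)" dflt "\<lambda>_. pair_pmf p (bernoulli_pmf 1)"]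
    by (simp add: seeds_def map_fst_pair_pmf)
  finally have *: "map_pmf (\<lambda>Y. (f (fst \<circ> Y), f (resample \<circ> Y))) (noisy_seeds 1) = pair_pmf (map_pmf f seeds) (map_pmf f seeds)" .
  have q: "pmf (map_pmf f seeds) True = q"
    by (simp add: pmf_map q_def vimage_def)
  have "pmf (map_pmf f seeds) False = 1 - q"
    using sum_pmf_eq_1[OF finite subset_UNIV, of "map_pmf f seeds"] q unfolding UNIV_bool by simp
  have "noisy_density 1 = measure_pmf.prob (map_pmf (\<lambda>Y. (f (fst \<circ> Y), f (resample \<circ> Y))) (noisy_seeds 1)) {(True, False), (False, True)}"
    unfolding noisy_density_def measure_map_pmf
    by (rule arg_cong[where f = "measure_pmf.prob _"]) (auto simp: noisy_map_def)
  also have "\<dots> = 2 * q * (1 - q)"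
    unfolding * by (subst measure_measure_pmf_finite) (simp_all add: pmf_pair q \<open>pmf (map_pmf f seeds) False = 1 - q\<close>)
  finally show ?thesis .
qed

lemma continuous_noisy_density: "continuous_on {0..1} noisy_density"
proof -
  define A where "A = PiE_dflt (carrier Q) (dflt, dflt, False) (\<lambda>_. set_pmf p \<times> set_pmf p \<times> (UNIV :: bool set)) \<inter> {Y. noisy_map Y}"
  define w where "w = (\<lambda>t (a, b, c). pmf p a * (pmf p b * (if c then t else 1 - t)))"
  have finA: "finite A"
    unfolding A_def using finite_carrier finite_seeds by (intro finite_Int disjI1 finite_PiE_dflt) auto
  have eq: "noisy_density t = (\<Sum>Y\<in>A. \<Prod>q\<in>carrier Q. w t (Y q))" if t: "t \<in> {0..1}" for t
  proof -
    have "noisy_density t = measure_pmf.prob (noisy_seeds t) A"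
      unfolding noisy_density_def
      by (intro measure_pmf.finite_measure_eq_AE)
        (auto simp: A_def AE_measure_pmf_iff set_noisy_seeds PiE_dflt_def)
    also have "\<dots> = (\<Sum>Y\<in>A. pmf (noisy_seeds t) Y)"
      by (rule measure_measure_pmf_finite[OF finA])
    also have "\<dots> = (\<Sum>Y\<in>A. \<Prod>q\<in>carrier Q. w t (Y q))"
    proof (rule sum.cong[OF HOL.refl])
      fix Y assume Y: "Y \<in> A"
      have "pmf (noisy_seeds t) Y = (\<Prod>q\<in>carrier Q. pmf (noisy_seed t p) (Y q))"
        using Y unfolding noisy_seeds_def by (intro pmf_Pi'[OF finite_carrier]) (auto simp: A_def PiE_dflt_def)
      moreover have "pmf (noisy_seed t p) x = w t x" for x
        using t by (cases x; cases "snd (snd x)") (auto simp: noisy_seed_def w_def pmf_pair)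
      ultimately show "pmf (noisy_seeds t) Y = (\<Prod>q\<in>carrier Q. w t (Y q))" by simp
    qed
    finally show ?thesis .
  qed
  have "continuous_on {0..1} (\<lambda>t. \<Sum>Y\<in>A. \<Prod>q\<in>carrier Q. w t (Y q))"
  proof -
    have "continuous_on {0..1} (\<lambda>t :: real. if c then t else 1 - t)" for c
      by (cases c) (auto intro!: continuous_intros)
    then show ?thesis
      unfolding w_def case_prod_unfold by (intro continuous_intros)
  qed
  then show ?thesis
    by (rule continuous_on_eq) (rule eq[symmetric])
qed

end

section \<open>The contradiction on a finite group and on the free product\<close>

lemma sum_of_bool_odd_bound:
  fixes k :: nat
  assumes "\<exists>j<k. P j"
  shows "1 \<le> (\<Sum>j<k. of_bool (P j) :: real) / 2 + of_bool (odd (\<Sum>j<k. of_bool (P j) :: nat))"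
proof -
  define n where "n = (\<Sum>j<k. of_bool (P j) :: nat)"
  have "n \<noteq> 0" using assms by (auto simp: n_def)
  \<comment> \<open>A positive even number is at least two; odd patterns are paid for by the second
    summand.\<close>
  then have "even n \<Longrightarrow> 2 \<le> n" by (auto elim!: evenE)
  moreover have "(\<Sum>j<k. of_bool (P j) :: real) = real n" by (simp add: n_def)
  ultimately show ?thesis unfolding n_def[symmetric] by auto
qed

text \<open>After division by \<open>x\<close> the coefficient of \<open>L\<close> is
  \<open>k (d - 2) / 2 - d / 4\<close>, which is at least \<open>d / 4\<close> because
  \<open>k (d - 2) \<ge> d\<close>. Hence \<open>L \<le> 2 ^ (k + 2)\<close>, just short of its
  value.\<close>

lemma parity_rate_contradiction:
  fixes d k :: nat and x L :: real
  assumes "3 \<le> d" "d < k" "0 < x" and L: "L = 2 ^ (k + 2) + 1"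
    and "real k * (real (d - 1) * (x * L)) \<le> real d * ((real k * x / 2 + x / 4) * L + 2 ^ k * x)"
  shows False
proof -
  have "x * (real k * (real d - 1) * L) \<le> x * (real d * ((real k / 2 + 1 / 4) * L + 2 ^ k))"
    using assms(1,5) by (simp add: of_nat_diff algebra_simps)
  then have "real k * (real d - 1) * L \<le> real d * ((real k / 2 + 1 / 4) * L + 2 ^ k)"
    using \<open>0 < x\<close> by simp
  then have *: "(real k * (real d - 2) / 2 - real d / 4) * L \<le> real d * 2 ^ k"
    by (simp add: algebra_simps)
  have "real d / 4 \<le> real k * (real d - 2) / 2 - real d / 4"
  proof -
    have "real d * 1 \<le> real k * (real d - 2)"
      using assms(1,2) by (intro mult_mono) auto
    then show ?thesis by simp
  qed
  moreover have "0 < L" unfolding L by (intro add_nonneg_pos) auto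
  ultimately have "real d / 4 * L \<le> real d * 2 ^ k"
    using * mult_right_mono[of "real d / 4" "real k * (real d - 2) / 2 - real d / 4" L] by linarith
  then have "L \<le> 4 * 2 ^ k"
    using assms(1) by (simp add: field_simps)
  then show False unfolding L by (simp add: power_add)
qed

text \<open>
  The density \<open>\<delta>\<close> of the noisy map will be \<open>exp (- L)\<close> with \<open>L = 2\<^sup>k\<^sup>+\<^sup>2 + 1\<close>, just above the bound
  on \<open>L\<close> in \<open>parity_rate_contradiction\<close>; both copies of the map contribute \<open>\<delta> / 8\<close> to its parity error.
\<close>

definition parity_error :: "nat \<Rightarrow> real" where
  "parity_error k = exp (- (2 ^ (k + 2) + 1)) / 8"

text \<open>The density bounds exclude maps such as the constant \<open>False\<close>, which has no
  parity error at all, and guarantee that noise can reach the density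
  \<open>\<delta>\<close>.\<close>

lemma (in finite_block_code) no_parity_code:
  assumes dk: "3 \<le> d" "d < k"
    and s: "\<And>i. i \<in> {1..d} \<Longrightarrow> s i \<in> carrier Q" "\<And>i. i \<in> {1..d} \<Longrightarrow> s i [^] k = \<one>"
    and R: "\<And>i. i \<in> {1..d} \<Longrightarrow> R i \<subseteq> m_inv Q ` D"
      "\<And>g. g \<in> m_inv Q ` D \<Longrightarrow> d - 1 \<le> card {i\<in>{1..d}. g \<in> R i}"
      "\<And>i. i \<in> {1..d} \<Longrightarrow> inj_on (\<lambda>(g, j). g \<otimes> s i [^] j) (R i \<times> {..<k})"
    and density: "1 / 4 \<le> measure_pmf.prob seeds {U. f U}" "measure_pmf.prob seeds {U. f U} \<le> 3 / 4"
    and parity: "\<And>i. i \<in> {1..d} \<Longrightarrow>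
      measure_pmf.prob seeds {U. odd (\<Sum>j<k. of_bool (code (s i [^] j) U) :: nat)} \<le> parity_error k"
  shows False
proof -
  define \<delta> where "\<delta> = exp (- (2 ^ (k + 2) + 1 :: real))"
  have \<delta>: "0 < \<delta>" by (simp add: \<delta>_def)
  \<comment> \<open>\<open>3 / 8\<close> is the minimum of \<open>2 q (1 - q)\<close> for
    \<open>q\<close> between \<open>1 / 4\<close> and \<open>3 / 4\<close>, so the intermediate
    value theorem reaches \<open>\<delta>\<close> for every admissible density.\<close>
  have "\<delta> \<le> 3 / 8"
  proof -
    have "(1::real) \<le> 2 ^ k" "(2::real) ^ (k + 2) = 4 * 2 ^ k"
      by (simp_all add: power_add)
    then have "(4::real) \<le> 2 ^ (k + 2) + 1" by linarith
    then have "5 \<le> exp (2 ^ (k + 2) + 1 :: real)"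
      using exp_ge_add_one_self[of "2 ^ (k + 2) + 1"] by linarith
    then have "\<delta> \<le> 1 / 5"
      unfolding \<delta>_def exp_minus by (simp add: field_simps)
    then show ?thesis by simp
  qed
  also have "3 / 8 \<le> noisy_density 1"
  proof -
    have "0 \<le> (measure_pmf.prob seeds {U. f U} - 1 / 4) * (3 / 4 - measure_pmf.prob seeds {U. f U})"
      using density by simp
    then show ?thesis by (simp add: noisy_density_1 algebra_simps)
  qed
  finally obtain t where t: "noisy_density t = \<delta>"
    using IVT'[of noisy_density 0 \<delta> 1] continuous_noisy_density \<delta> noisy_density_0 by auto
  interpret N: finite_block_code Q "noisy_seed t p" "(dflt, dflt, False)" D noisy_map
    by (rule noisy_block_code)
  have Ns: "N.seeds = noisy_seeds t" by (simp add: N.seeds_def noisy_seeds_def)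
  have Ncode: "N.code v Y \<longleftrightarrow> code v (fst \<circ> Y) \<noteq> code v (resample \<circ> Y)" for v Y
    by (simp add: N.code_def code_def noisy_map_def o_def)
  have code1: "N.code \<one> Y = noisy_map Y" for Y
    unfolding N.code_def by (rule N.local) (use window in auto)
  have dens: "measure_pmf.prob N.seeds {Y. N.code v Y} = \<delta>" if "v \<in> carrier Q" for v
  proof -
    have "measure_pmf.prob N.seeds {Y. N.code v Y} = pmf (map_pmf (N.code v) N.seeds) True"
      by (simp add: pmf_map vimage_def)
    also have "\<dots> = pmf (map_pmf (N.code \<one>) N.seeds) True"
      by (simp only: N.map_code_seeds[OF that])
    also have "\<dots> = \<delta>"
      using t by (simp add: pmf_map vimage_def code1 Ns noisy_density_def)
    finally show ?thesis .
  qed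
  have lower: "\<delta> * (2 ^ (k + 2) + 1) \<le> entropy_pmf (map_pmf (N.code \<one>) N.seeds)"
  proof -
    have "pmf (map_pmf (N.code \<one>) N.seeds) True = \<delta>"
      using dens[OF one_closed] by (simp add: pmf_map vimage_def)
    moreover have "\<delta> * (2 ^ (k + 2) + 1) = - \<delta> * ln \<delta>"
      by (simp only: \<delta>_def ln_exp mult_minus_left mult_minus_right minus_minus)
    ultimately show ?thesis
      using entropy_pmf_ge[of "map_pmf (N.code \<one>) N.seeds" True] N.finite_set_seeds by simp
  qed
  have upper: "entropy_pmf (map_pmf (N.coset_code k (s i) \<one>) N.seeds)
    \<le> (real k * \<delta> / 2 + \<delta> / 4) * (2 ^ (k + 2) + 1) + 2 ^ k * \<delta>" if i: "i \<in> {1..d}" for i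
  proof -
    let ?c = "\<lambda>j. N.code (s i [^] j)"
    let ?E = "measure_pmf.expectation N.seeds" and ?P = "measure_pmf.prob N.seeds"
    let ?z = "replicate k False"
    have int: "integrable N.seeds h" for h :: "_ \<Rightarrow> real"
      by (rule integrable_measure_pmf_finite[OF N.finite_set_seeds])
    have E_bool: "?E (\<lambda>Y. of_bool (A Y)) = ?P {Y. A Y}" for A
    proof -
      have "(\<lambda>Y. of_bool (A Y)) = (indicator {Y. A Y} :: _ \<Rightarrow> real)"
        by (auto simp: indicator_def)
      then show ?thesis by simp
    qed
    have cc: "N.coset_code k (s i) \<one> Y = map (\<lambda>j. ?c j Y) [0..<k]" for Y
      using s(1)[OF i] by (simp add: N.coset_code_def)
    have odd: "?P {Y. odd (\<Sum>j<k. of_bool (?c j Y) :: nat)} \<le> \<delta> / 4"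
    proof -
      let ?o = "\<lambda>U. odd (\<Sum>j<k. of_bool (code (s i [^] j) U) :: nat)"
      have "?P {Y. odd (\<Sum>j<k. of_bool (?c j Y) :: nat)} \<le> ?P ({Y. ?o (fst \<circ> Y)} \<union> {Y. ?o (resample \<circ> Y)})"
      proof (rule measure_pmf.finite_measure_mono[OF subsetI])
        fix Y assume "Y \<in> {Y. odd (\<Sum>j<k. of_bool (?c j Y) :: nat)}"
        then show "Y \<in> {Y. ?o (fst \<circ> Y)} \<union> {Y. ?o (resample \<circ> Y)}"
          unfolding mem_Collect_eq Un_iff Ncode odd_sum_xor by blast
      qed simp
      also have "\<dots> \<le> ?P {Y. ?o (fst \<circ> Y)} + ?P {Y. ?o (resample \<circ> Y)}"
        by (intro measure_Un_le) auto
      also have "?P {Y. ?o (fst \<circ> Y)} = measure_pmf.prob (map_pmf (\<lambda>Y. fst \<circ> Y) N.seeds) {U. ?o U}"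
        by (simp add: vimage_def)
      also have "?P {Y. ?o (resample \<circ> Y)} = measure_pmf.prob (map_pmf (\<lambda>Y. resample \<circ> Y) N.seeds) {U. ?o U}"
        by (simp add: vimage_def)
      finally show ?thesis
        using parity[OF i] unfolding Ns map_fst_noisy_seeds map_resample_noisy_seeds
        by (simp add: parity_error_def \<delta>_def)
    qed
    have "1 - pmf (map_pmf (N.coset_code k (s i) \<one>) N.seeds) ?z = ?P {Y. \<exists>j<k. ?c j Y}"
    proof -
      have "(\<forall>j<k. \<not> ?c j Y) \<longleftrightarrow> N.coset_code k (s i) \<one> Y = ?z" for Y
        unfolding cc by (auto simp: list_eq_iff_nth_eq)
      then have "{Y. \<exists>j<k. ?c j Y} = UNIV - (N.coset_code k (s i) \<one> -` {?z})"
        by blast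
      then show ?thesis
        using measure_pmf.prob_compl[of "N.coset_code k (s i) \<one> -` {?z}" N.seeds] by (simp add: pmf_map)
    qed
    also have "\<dots> = ?E (\<lambda>Y. of_bool (\<exists>j<k. ?c j Y))"
      by (simp only: E_bool)
    \<comment> \<open>Half the expected number of ones is \<open>k \<delta> / 2\<close>; this factor
      one half is the whole gain from even parity.\<close>
    also have "\<dots> \<le> ?E (\<lambda>Y. (\<Sum>j<k. of_bool (?c j Y)) / 2 + of_bool (odd (\<Sum>j<k. of_bool (?c j Y) :: nat)))"
    proof (intro integral_mono int)
      fix Y
      show "(of_bool (\<exists>j<k. ?c j Y) :: real) \<le> (\<Sum>j<k. of_bool (?c j Y)) / 2 + of_bool (odd (\<Sum>j<k. of_bool (?c j Y) :: nat))"
      proof (cases "\<exists>j<k. ?c j Y")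
        case True
        then show ?thesis using sum_of_bool_odd_bound[of k "\<lambda>j. ?c j Y"] by simp
      next
        case False
        then show ?thesis by (auto intro!: add_nonneg_nonneg sum_nonneg)
      qed
    qed
    also have "\<dots> = (\<Sum>j<k. ?E (\<lambda>Y. of_bool (?c j Y))) / 2 + ?E (\<lambda>Y. of_bool (odd (\<Sum>j<k. of_bool (?c j Y) :: nat)))"
      by (subst Bochner_Integration.integral_add[OF int int], subst integral_divide_zero, subst Bochner_Integration.integral_sum[OF int]) simp
    also have "(\<Sum>j<k. ?E (\<lambda>Y. of_bool (?c j Y))) = (\<Sum>j<k. \<delta>)"
      using s(1)[OF i] by (simp add: E_bool dens)
    also have "?E (\<lambda>Y. of_bool (odd (\<Sum>j<k. of_bool (?c j Y) :: nat))) \<le> \<delta> / 4"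
      unfolding E_bool by (rule odd)
    finally have nz: "1 - pmf (map_pmf (N.coset_code k (s i) \<one>) N.seeds) ?z \<le> real k * \<delta> / 2 + \<delta> / 4"
      by simp
    let ?A = "{xs :: bool list. set xs \<subseteq> UNIV \<and> length xs = k}"
    \<comment> \<open>The weight \<open>\<delta>\<close> makes the logarithm the same as in the
      lower bound, at the price of \<open>\<delta>\<close> for each of the \<open>2 ^ k\<close>
      patterns.\<close>
    have "entropy_pmf (map_pmf (N.coset_code k (s i) \<one>) N.seeds)
      \<le> (1 - pmf (map_pmf (N.coset_code k (s i) \<one>) N.seeds) ?z) * - ln \<delta> + card ?A * \<delta>"
      using \<delta> by (intro entropy_pmf_le finite_lists_length_eq) (auto simp: cc)
    also have "card ?A = 2 ^ k"
      by (subst card_lists_length_eq) auto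
    also have "- ln \<delta> = 2 ^ (k + 2) + 1"
      by (simp add: \<delta>_def)
    also have "(1 - pmf (map_pmf (N.coset_code k (s i) \<one>) N.seeds) ?z) * (2 ^ (k + 2) + 1)
      \<le> (real k * \<delta> / 2 + \<delta> / 4) * (2 ^ (k + 2) + 1)"
      by (rule mult_right_mono[OF nz]) (auto intro!: add_nonneg_nonneg)
    finally show ?thesis by simp
  qed
  have "real k * (real (d - 1) * (\<delta> * (2 ^ (k + 2) + 1)))
    \<le> real k * (real (d - 1) * entropy_pmf (map_pmf (N.code \<one>) N.seeds))"
    by (intro mult_left_mono lower) auto
  also have "\<dots> \<le> (\<Sum>i\<in>{1..d}. entropy_pmf (map_pmf (N.coset_code k (s i) \<one>) N.seeds))"
    by (rule N.coset_entropy[OF _ s R]) auto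
  also have "\<dots> \<le> (\<Sum>i\<in>{1..d}. (real k * \<delta> / 2 + \<delta> / 4) * (2 ^ (k + 2) + 1) + 2 ^ k * \<delta>)"
    by (intro sum_mono upper)
  finally have "real k * (real (d - 1) * (\<delta> * (2 ^ (k + 2) + 1)))
    \<le> real d * ((real k * \<delta> / 2 + \<delta> / 4) * (2 ^ (k + 2) + 1) + 2 ^ k * \<delta>)"
    by simp
  then show False
    by (rule parity_rate_contradiction[OF dk \<delta> HOL.refl])
qed

lemma Pi_pmf_inj_on:
  assumes "finite B" "inj_on \<pi> E" "\<pi> ` E \<subseteq> B" and inf: "infinite (UNIV :: 'b set)"
  shows "map_pmf (\<lambda>U g. if g \<in> E then U (\<pi> g) else dflt) (Pi_pmf (B :: 'b set) dflt (\<lambda>_. p)) = Pi_pmf E dflt (\<lambda>_. p)"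
proof -
  \<comment> \<open>A point outside \<open>B\<close> receives all positions off \<open>E\<close>,
    where the seed has to be \<open>dflt\<close>.\<close>
  obtain b where b: "b \<notin> B" using ex_new_if_finite[OF inf assms(1)] by auto
  let ?h = "\<lambda>g. if g \<in> E then \<pi> g else b"
  have finE: "finite E" using assms(1-3) by (meson finite_imageD finite_subset)
  have bij: "bij_betw ?h E (\<pi> ` E)"
    using assms(2) by (auto simp: bij_betw_def inj_on_def)
  have "Pi_pmf E dflt (\<lambda>_. p) = map_pmf (\<lambda>U. U \<circ> ?h) (Pi_pmf (\<pi> ` E) dflt (\<lambda>_. p))"
    using assms(3) b by (intro Pi_pmf_bij_betw finE bij) auto
  also have "Pi_pmf (\<pi> ` E) dflt (\<lambda>_. p) = map_pmf (\<lambda>U x. if x \<in> \<pi> ` E then U x else dflt) (Pi_pmf B dflt (\<lambda>_. p))"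
    by (rule Pi_pmf_subset[OF assms(1,3)])
  also have "map_pmf (\<lambda>U. U \<circ> ?h) \<dots> = map_pmf (\<lambda>U g. if g \<in> E then U (\<pi> g) else dflt) (Pi_pmf B dflt (\<lambda>_. p))"
    unfolding pmf.map_comp using assms(3) b by (intro map_pmf_cong) (auto simp: fun_eq_iff)
  finally show ?thesis by simp
qed

text \<open>\<open>E\<close> holds \<open>D\<close> and its translates by all powers of generators
  below \<open>k\<close>, hence every seed read along the cosets through the identity. As
  \<open>\<pi>\<close> is injective on \<open>E\<close>, these seeds keep their joint law in the
  quotient.\<close>

lemma no_parity_block_code:
  assumes dk: "3 \<le> d" "d < k"
    and p: "finite (set_pmf p)"
    and E: "finite E" "E \<subseteq> carrier (Gamma_group d k)" "D \<subseteq> E"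
    and DE: "\<And>i j g. i \<in> {1..d} \<Longrightarrow> j < k \<Longrightarrow> g \<in> D \<Longrightarrow>
      Gamma_gen d k i [^]\<^bsub>Gamma_group d k\<^esub> j \<otimes>\<^bsub>Gamma_group d k\<^esub> g \<in> E"
    and F: "\<And>Y Y'. (\<And>g. g \<in> D \<Longrightarrow> Y g = Y' g) \<Longrightarrow> F Y = F Y'"
    and density: "1 / 4 \<le> measure_pmf.prob (Pi_pmf E dflt (\<lambda>_. p)) {U. F U}"
      "measure_pmf.prob (Pi_pmf E dflt (\<lambda>_. p)) {U. F U} \<le> 3 / 4"
    and parity: "\<And>i. i \<in> {1..d} \<Longrightarrow> measure_pmf.prob (Pi_pmf E dflt (\<lambda>_. p))
      {U. odd (\<Sum>j<k. of_bool (F (\<lambda>g. U (Gamma_gen d k i [^]\<^bsub>Gamma_group d k\<^esub> j \<otimes>\<^bsub>Gamma_group d k\<^esub> g))) :: nat)} \<le> parity_error k"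
  shows False
proof -
  interpret \<Gamma>: group "Gamma_group d k" by (rule group_Gamma)
  have k2: "2 \<le> k" using dk by simp
  obtain Q :: "((nat \<times> nat) list \<Rightarrow> (nat \<times> nat) list) monoid" and \<pi> R
    where Q: "group Q" "finite (carrier Q)" "\<pi> \<in> hom (Gamma_group d k) Q" "inj_on \<pi> E"
    and R: "\<And>i. i \<in> {1..d} \<Longrightarrow> R i \<subseteq> m_inv Q ` \<pi> ` E"
    "\<And>g. g \<in> m_inv Q ` \<pi> ` E \<Longrightarrow> d - 1 \<le> card {i\<in>{1..d}. g \<in> R i}"
    "\<And>i. i \<in> {1..d} \<Longrightarrow> inj_on (\<lambda>(g, j). g \<otimes>\<^bsub>Q\<^esub> \<pi> (Gamma_gen d k i) [^]\<^bsub>Q\<^esub> j) (R i \<times> {..<k})"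
    using Gamma_finite_quotient[OF k2 E(1,2)] by blast
  interpret Q: group Q by fact
  interpret \<pi>: group_hom "Gamma_group d k" Q \<pi> by unfold_locales (rule Q(3))
  define f where "f Y = F (\<lambda>g. Y (\<pi> g))" for Y
  have \<pi>E: "\<pi> ` E \<subseteq> carrier Q" using E(2) by auto
  interpret B: finite_block_code Q p dflt "\<pi> ` E" f
  proof
    show "f Y = f Y'" if "\<And>g. g \<in> \<pi> ` E \<Longrightarrow> Y g = Y' g" for Y Y'
      unfolding f_def by (rule F) (use that E(3) in auto)
  qed (use Q(2) p \<pi>E in auto)
  have "infinite (UNIV :: ((nat \<times> nat) list \<Rightarrow> (nat \<times> nat) list) set)"
    using finite_fun_UNIVD2 infinite_UNIV_listI by blast
  note law = Pi_pmf_inj_on[OF Q(2) Q(4) \<pi>E this, of dflt p, folded B.seeds_def]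
  have f: "F (\<lambda>g. if g \<in> E then U (\<pi> g) else dflt) = f U" for U
    unfolding f_def by (rule F) (use E(3) in auto)
  have code: "F (\<lambda>g. if Gamma_gen d k i [^]\<^bsub>Gamma_group d k\<^esub> j \<otimes>\<^bsub>Gamma_group d k\<^esub> g \<in> E
      then U (\<pi> (Gamma_gen d k i [^]\<^bsub>Gamma_group d k\<^esub> j \<otimes>\<^bsub>Gamma_group d k\<^esub> g)) else dflt)
    = B.code (\<pi> (Gamma_gen d k i) [^]\<^bsub>Q\<^esub> j) U" if "i \<in> {1..d}" "j < k" for i j U
    unfolding B.code_def f_def
  proof (rule F)
    fix g assume g: "g \<in> D"
    then have "g \<in> carrier (Gamma_group d k)" using E by auto
    then show "(if Gamma_gen d k i [^]\<^bsub>Gamma_group d k\<^esub> j \<otimes>\<^bsub>Gamma_group d k\<^esub> g \<in> E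
        then U (\<pi> (Gamma_gen d k i [^]\<^bsub>Gamma_group d k\<^esub> j \<otimes>\<^bsub>Gamma_group d k\<^esub> g)) else dflt)
      = U (\<pi> (Gamma_gen d k i) [^]\<^bsub>Q\<^esub> j \<otimes>\<^bsub>Q\<^esub> \<pi> g)"
      using DE[OF that g] Gamma_gen_closed[OF that(1), of k] by (simp add: \<pi>.hom_nat_pow)
  qed
  show False
  proof (rule B.no_parity_code[OF dk, where s = "\<lambda>i. \<pi> (Gamma_gen d k i)" and R = R])
    show "\<pi> (Gamma_gen d k i) \<in> carrier Q" if "i \<in> {1..d}" for i
      using Gamma_gen_closed[OF that, of k] by simp
    show "\<pi> (Gamma_gen d k i) [^]\<^bsub>Q\<^esub> k = \<one>\<^bsub>Q\<^esub>" if "i \<in> {1..d}" for i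
      using Gamma_gen_closed[OF that, of k] Gamma_gen_pow_order[OF that, of k] by (metis \<pi>.hom_nat_pow \<pi>.hom_one)
    have "measure_pmf.prob B.seeds {U. f U} = measure_pmf.prob (Pi_pmf E dflt (\<lambda>_. p)) {U. F U}"
      unfolding law[symmetric] by (simp add: vimage_def f)
    then show "1 / 4 \<le> measure_pmf.prob B.seeds {U. f U}" "measure_pmf.prob B.seeds {U. f U} \<le> 3 / 4"
      using density by simp_all
    fix i assume i: "i \<in> {1..d}"
    have "measure_pmf.prob B.seeds {U. odd (\<Sum>j<k. of_bool (B.code (\<pi> (Gamma_gen d k i) [^]\<^bsub>Q\<^esub> j) U) :: nat)}
      = measure_pmf.prob (Pi_pmf E dflt (\<lambda>_. p))
      {U. odd (\<Sum>j<k. of_bool (F (\<lambda>g. U (Gamma_gen d k i [^]\<^bsub>Gamma_group d k\<^esub> j \<otimes>\<^bsub>Gamma_group d k\<^esub> g))) :: nat)}"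
      unfolding law[symmetric] measure_map_pmf vimage_def mem_Collect_eq
      by (intro arg_cong[where f = "measure_pmf.prob _"] Collect_cong arg_cong[where f = odd] sum.cong HOL.refl arg_cong[where f = of_bool] code[symmetric] i) auto
    then show "measure_pmf.prob B.seeds {U. odd (\<Sum>j<k. of_bool (B.code (\<pi> (Gamma_gen d k i) [^]\<^bsub>Q\<^esub> j) U) :: nat)} \<le> parity_error k"
      using parity[OF i] by simp
  qed (rule R, assumption)+
qed

section \<open>The Haar measure of the parity shift\<close>

lemma bij_betw_add_mod:
  fixes a :: int
  assumes "0 < k"
  shows "bij_betw (\<lambda>j. (a + int j) mod int k) {..<k} {0..<int k}"
proof (rule bij_betw_byWitness[where f' = "\<lambda>r. nat ((r - a) mod int k)"])
  show "\<forall>j\<in>{..<k}. nat (((a + int j) mod int k - a) mod int k) = j"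
    by (simp add: mod_diff_left_eq)
  show "\<forall>r\<in>{0..<int k}. (a + int (nat ((r - a) mod int k))) mod int k = r"
    using assms by (simp add: mod_add_right_eq)
qed (use assms in \<open>auto simp: nat_less_iff\<close>)

lemma Gamma_mult_gen_pow_closed:
  "g \<in> carrier (Gamma_group d k) \<Longrightarrow> i \<in> {1..d} \<Longrightarrow>
    g \<otimes>\<^bsub>Gamma_group d k\<^esub> (Gamma_gen d k i [^]\<^bsub>Gamma_group d k\<^esub> (j :: nat)) \<in> carrier (Gamma_group d k)"
  using Gamma_gen_closed[of i d k] group_Gamma[of d k]
  by (simp add: group.is_monoid monoid.nat_pow_closed monoid.m_closed)

text \<open>
  The witness is pulled back along the homomorphism to \<open>\<int>/k\<close> sending every \<open>s\<^sub>i\<close> to \<open>1\<close>, which maps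
  each coset of \<open>\<langle>s\<^sub>i\<rangle>\<close> bijectively.
\<close>

lemma parity_shift_nontrivial:
  assumes k: "2 \<le> k"
  obtains x where "x \<in> parity_shift d k" "x \<one>\<^bsub>Gamma_group d k\<^esub> = 1"
proof -
  let ?Z = "integer_mod_group k"
  interpret \<Gamma>: group "Gamma_group d k" by (rule group_Gamma)
  obtain \<phi> where \<phi>: "\<phi> \<in> hom (Gamma_group d k) ?Z" "\<And>i. i \<in> {1..d} \<Longrightarrow> \<phi> (Gamma_gen d k i) = 1"
    by (rule Gamma_hom[where d = d and k = k and H = ?Z and h = "\<lambda>_. 1"])
      (use k in \<open>auto simp: carrier_integer_mod_group\<close>)
  interpret \<phi>: group_hom "Gamma_group d k" ?Z \<phi>
    by (simp add: group_hom_def group_hom_axioms_def \<phi>(1) group_Gamma)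
  \<comment> \<open>Each coset carries exactly two ones, at the residues \<open>0\<close> and
    \<open>1\<close>, which \<open>2 \<le> k\<close> keeps apart.\<close>
  define x where "x = (\<lambda>g\<in>carrier (Gamma_group d k). if \<phi> g \<in> {0, 1} then 1 else 0 :: bit)"
  have "(\<Sum>j<k. x (g \<otimes>\<^bsub>Gamma_group d k\<^esub> (Gamma_gen d k i [^]\<^bsub>Gamma_group d k\<^esub> j))) = 0"
    if g: "g \<in> carrier (Gamma_group d k)" and i: "i \<in> {1..d}" for g i
  proof -
    let ?h = "\<lambda>r :: int. if r \<in> {0, 1} then 1 else 0 :: bit"
    have "\<phi> (g \<otimes>\<^bsub>Gamma_group d k\<^esub> (Gamma_gen d k i [^]\<^bsub>Gamma_group d k\<^esub> j)) = (\<phi> g + int j) mod int k" for j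
      using g Gamma_gen_closed[OF i, of k] \<phi>(2)[OF i] by (simp add: \<phi>.hom_nat_pow mod_add_right_eq)
    then have "(\<Sum>j<k. x (g \<otimes>\<^bsub>Gamma_group d k\<^esub> (Gamma_gen d k i [^]\<^bsub>Gamma_group d k\<^esub> j)))
      = (\<Sum>j<k. ?h ((\<phi> g + int j) mod int k))"
      using Gamma_mult_gen_pow_closed[OF g i] by (simp add: x_def)
    also have "\<dots> = (\<Sum>r\<in>{0..<int k}. ?h r)"
      using k by (intro sum.reindex_bij_betw bij_betw_add_mod) simp
    also have "\<dots> = (\<Sum>r\<in>{0, 1}. ?h r)"
      using k by (intro sum.mono_neutral_right) auto
    also have "\<dots> = 0" by simp
    finally show ?thesis .
  qed
  then have "x \<in> parity_shift d k"
    by (simp add: parity_shift_def x_def)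
  moreover have "x \<one>\<^bsub>Gamma_group d k\<^esub> = 1"
    using \<phi>.hom_one by (simp add: x_def)
  ultimately show thesis by (rule that)
qed

lemma shift_parity_shift:
  assumes x: "x \<in> parity_shift d k" and g: "g \<in> carrier (Gamma_group d k)"
  shows "shift (Gamma_group d k) g x \<in> parity_shift d k"
proof -
  interpret group "Gamma_group d k" by (rule group_Gamma)
  have "(\<Sum>j<k. shift (Gamma_group d k) g x (h \<otimes>\<^bsub>Gamma_group d k\<^esub> (Gamma_gen d k i [^]\<^bsub>Gamma_group d k\<^esub> j))) = 0"
    if h: "h \<in> carrier (Gamma_group d k)" "i \<in> {1..d}" for h i
  proof -
    let ?s = "\<lambda>j. Gamma_gen d k i [^]\<^bsub>Gamma_group d k\<^esub> (j :: nat)"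
    have "(\<Sum>j<k. shift (Gamma_group d k) g x (h \<otimes>\<^bsub>Gamma_group d k\<^esub> ?s j))
      = (\<Sum>j<k. x ((inv\<^bsub>Gamma_group d k\<^esub> g \<otimes>\<^bsub>Gamma_group d k\<^esub> h) \<otimes>\<^bsub>Gamma_group d k\<^esub> ?s j))"
      using g h Gamma_gen_closed[OF h(2), of k] by (simp add: shift_def m_assoc)
    also have "\<dots> = 0"
      using x g h by (simp add: parity_shift_def)
    finally show ?thesis .
  qed
  then show ?thesis by (simp add: parity_shift_def) (simp add: shift_def)
qed

lemma (in group) shift_shift_inv:
  assumes "g \<in> carrier G" "x \<in> extensional (carrier G)"
  shows "shift G g (shift G (inv g) x) = x" "shift G (inv g) (shift G g x) = x"
  using assms by (auto simp: shift_def fun_eq_iff extensional_def m_assoc[symmetric])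

lemma (in group) shift_one:
  assumes "x \<in> extensional (carrier G)"
  shows "shift G \<one> x = x"
  using assms by (auto simp: shift_def fun_eq_iff extensional_def)

text \<open>Weak containment speaks of images, whereas coordinates and measurability are computed
  for preimages; the shift by \<open>inv g\<close> undoes the shift by \<open>g\<close> on
  extensional functions.\<close>

lemma (in group) shift_image:
  assumes g: "g \<in> carrier G" and ext: "\<And>x. x \<in> \<Omega> \<Longrightarrow> x \<in> extensional (carrier G)"
    and inv: "\<And>h x. h \<in> carrier G \<Longrightarrow> x \<in> \<Omega> \<Longrightarrow> shift G h x \<in> \<Omega>" and B: "B \<subseteq> \<Omega>"
  shows "shift G g ` B = {x \<in> \<Omega>. shift G (inv g) x \<in> B}"
proof (intro equalityI subsetI)
  fix x assume "x \<in> shift G g ` B"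
  then obtain y where y: "y \<in> B" "x = shift G g y" by auto
  then have "shift G (inv g) x = y" using shift_shift_inv(2)[OF g ext, of y] B by auto
  then show "x \<in> {x \<in> \<Omega>. shift G (inv g) x \<in> B}" using y inv[OF g] B by auto
next
  fix x assume x: "x \<in> {x \<in> \<Omega>. shift G (inv g) x \<in> B}"
  then have "x = shift G g (shift G (inv g) x)" using shift_shift_inv(1)[OF g ext, of x] by auto
  then show "x \<in> shift G g ` B" using x by blast
qed

lemma parity_shift_extensional: "x \<in> parity_shift d k \<Longrightarrow> x \<in> extensional (carrier (Gamma_group d k))"
  by (auto simp: parity_shift_def PiE_def)

lemma topspace_parity_topology: "topspace (parity_topology d k) = parity_shift d k"
  by (auto simp: parity_topology_def parity_shift_def)

context
  fixes d k :: nat and m :: "(nat gword set \<Rightarrow> bit) measure"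
  assumes haar: "haar_prob_measure (parity_group d k) (parity_topology d k) m"
begin

lemma sets_haar_parity: "sets m = sigma_sets (parity_shift d k) {U. openin (parity_topology d k) U}"
proof -
  have "{U. openin (parity_topology d k) U} \<subseteq> Pow (parity_shift d k)"
    using openin_subset topspace_parity_topology by blast
  then show ?thesis
    using haar by (simp add: haar_prob_measure_def borel_of_def topspace_parity_topology)
qed

lemma space_haar_parity: "space m = parity_shift d k"
proof -
  have "parity_shift d k \<in> sets m"
    unfolding sets_haar_parity by (rule sigma_sets_top)
  moreover have "space m \<in> sigma_sets (parity_shift d k) {U. openin (parity_topology d k) U}"
    unfolding sets_haar_parity[symmetric] by simp
  moreover have "{U. openin (parity_topology d k) U} \<subseteq> Pow (parity_shift d k)"
    using openin_subset topspace_parity_topology by blast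
  ultimately show ?thesis
    using sigma_sets_into_sp sets.sets_into_space by (metis subset_antisym)
qed

lemma coordinate_in_sets:
  assumes "g \<in> carrier (Gamma_group d k)"
  shows "{x \<in> parity_shift d k. x g = b} \<in> sets m"
proof -
  have "continuous_map (parity_topology d k) (discrete_topology UNIV) (\<lambda>x. x g)"
    unfolding parity_topology_def using assms
    by (intro continuous_map_from_subtopology continuous_map_product_projection)
  then have "openin (parity_topology d k) {x \<in> topspace (parity_topology d k). x g \<in> {b}}"
    by (rule openin_continuous_map_preimage) simp
  then show ?thesis
    unfolding sets_haar_parity by (simp add: topspace_parity_topology sigma_sets.Basic)
qed

text \<open>Adding a configuration with value \<open>1\<close> at the identity swaps the two values
  of that coordinate, so Haar invariance gives both cylinders the same measure.\<close>

lemma measure_coordinate: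
  assumes "2 \<le> k"
  shows "measure m {x \<in> parity_shift d k. x \<one>\<^bsub>Gamma_group d k\<^esub> = 1} = 1 / 2"
proof -
  let ?e = "\<one>\<^bsub>Gamma_group d k\<^esub>" and ?C = "\<lambda>b. {x \<in> parity_shift d k. x \<one>\<^bsub>Gamma_group d k\<^esub> = b}"
  interpret prob_space m using haar by (simp add: haar_prob_measure_def)
  interpret \<Gamma>: group "Gamma_group d k" by (rule group_Gamma)
  interpret P: comm_group "parity_group d k" by (rule comm_group_parity_group)
  obtain y where y: "y \<in> parity_shift d k" "y ?e = 1" by (rule parity_shift_nontrivial[OF assms])
  let ?t = "\<lambda>x. y \<otimes>\<^bsub>parity_group d k\<^esub> x"
  have yP: "y \<in> carrier (parity_group d k)" using y by (simp add: parity_group_def)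
  have e: "?t x ?e = 1 + x ?e" for x
    using y(2) by (simp add: parity_group_def)
  have cl: "?t x \<in> parity_shift d k" if "x \<in> parity_shift d k" for x
    using P.m_closed[OF yP, of x] that by (simp add: parity_group_def)
  have tt: "?t (?t x) = x" if "x \<in> parity_shift d k" for x
    using parity_shift_extensional[OF that] by (auto simp: parity_group_def fun_eq_iff extensional_def add.assoc[symmetric] simp del: add_bit_eq_xor)
  have "?t ` ?C 0 = ?C 1"
  proof (intro equalityI subsetI)
    fix x assume x: "x \<in> ?C 1"
    then have "?t x \<in> ?C 0" using cl[of x] e[of x] by simp
    moreover have "x = ?t (?t x)" using tt[of x] x by simp
    ultimately show "x \<in> ?t ` ?C 0" by (intro image_eqI)
  qed (use cl e in auto)
  moreover have "emeasure m (?t ` ?C 0) = emeasure m (?C 0)"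
    using haar coordinate_in_sets[OF \<Gamma>.one_closed] yP unfolding haar_prob_measure_def by blast
  ultimately have "measure m (?C 1) = measure m (?C 0)"
    by (simp only: measure_def)
  moreover have "measure m (?C 0 \<union> ?C 1) = measure m (?C 0) + measure m (?C 1)"
    by (intro finite_measure_Union coordinate_in_sets[OF \<Gamma>.one_closed]) auto
  moreover have "?C 0 \<union> ?C 1 = space m"
    by (auto simp: space_haar_parity)
  ultimately show ?thesis using prob_space by simp
qed

end

text \<open>Reindexing lets the transported sets be labelled by patterns on cosets instead of by
  numbers.\<close>

lemma weakly_containedD:
  assumes wc: "weakly_contained G M S N R"
    and I: "finite I" "\<And>i. i \<in> I \<Longrightarrow> A i \<in> sets M"
    and F: "finite F" "F \<subseteq> carrier G" and "0 < \<epsilon>"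
  obtains B where "\<And>i. i \<in> I \<Longrightarrow> B i \<in> sets N"
    "\<And>g i j. g \<in> F \<Longrightarrow> i \<in> I \<Longrightarrow> j \<in> I \<Longrightarrow>
      \<bar>measure M (S g ` A i \<inter> A j) - measure N (R g ` B i \<inter> B j)\<bar> < \<epsilon>"
proof -
  obtain e where e: "bij_betw e {1..card I} I"
    using ex_bij_betw_nat_finite_1[OF I(1)] by auto
  let ?i = "inv_into {1..card I} e"
  have inv: "?i i \<in> {1..card I}" "e (?i i) = i" if "i \<in> I" for i
    using bij_betwE[OF bij_betw_inv_into[OF e]] bij_betw_inv_into_right[OF e] that by auto
  have "\<forall>i\<in>{1..card I}. A (e i) \<in> sets M"
    using e I(2) by (auto simp: bij_betw_def)
  then obtain B where B: "\<And>i. i \<in> {1..card I} \<Longrightarrow> B i \<in> sets N"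
    "\<And>g i j. g \<in> F \<Longrightarrow> i \<in> {1..card I} \<Longrightarrow> j \<in> {1..card I} \<Longrightarrow>
      \<bar>measure M (S g ` A (e i) \<inter> A (e j)) - measure N (R g ` B i \<inter> B j)\<bar> < \<epsilon>"
    using wc[unfolded weakly_contained_def, rule_format, of "card I" "\<lambda>i. A (e i)" F \<epsilon>] F \<open>0 < \<epsilon>\<close> by metis
  show thesis
  proof (rule that[of "\<lambda>i. B (?i i)"])
    fix g i j assume *: "g \<in> F" "i \<in> I" "j \<in> I"
    show "\<bar>measure M (S g ` A i \<inter> A j) - measure N (R g ` B (?i i) \<inter> B (?i j))\<bar> < \<epsilon>"
      using B(2)[OF *(1) inv(1)[OF *(2)] inv(1)[OF *(3)]] inv(2) * by simp
  qed (use B(1) inv(1) in auto)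
qed

section \<open>Approximation by finite windows and finite alphabets\<close>

lemma (in finite_measure) approximation_by_algebra:
  assumes gen: "sets M = sigma_sets (space M) \<G>" "\<G> \<subseteq> \<S>"
    and \<S>: "\<S> \<subseteq> sets M" "\<And>A. A \<in> \<S> \<Longrightarrow> space M - A \<in> \<S>" "\<And>A B. A \<in> \<S> \<Longrightarrow> B \<in> \<S> \<Longrightarrow> A \<union> B \<in> \<S>" "{} \<in> \<S>"
    and "B \<in> sets M" "0 < \<epsilon>"
  shows "\<exists>A\<in>\<S>. measure M ((A - B) \<union> (B - A)) < \<epsilon>"
proof -
  have "B \<in> sigma_sets (space M) \<G>" using \<open>B \<in> sets M\<close> by (simp add: gen(1))
  then show ?thesis
    using \<open>0 < \<epsilon>\<close>
  proof (induction arbitrary: \<epsilon>)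
    case (Basic a)
    then have "a \<in> \<S>" using gen(2) by blast
    then show ?case using Basic by (intro bexI[of _ a]) simp_all
  next
    case Empty
    then show ?case using \<S>(4) by (intro bexI[of _ "{}"]) simp_all
  next
    case (Compl a)
    then obtain A where A: "A \<in> \<S>" "measure M ((A - a) \<union> (a - A)) < \<epsilon>" by blast
    have "a \<in> sets M" using Compl.hyps by (simp add: gen(1))
    then have "((space M - A) - (space M - a)) \<union> ((space M - a) - (space M - A)) = (A - a) \<union> (a - A)"
      using A(1) \<S>(1) sets.sets_into_space by blast
    then show ?case using A \<S>(2) by (intro bexI[of _ "space M - A"]) simp_all
  next
    case (Union a)
    have a: "a n \<in> sets M" for n using Union.hyps by (simp add: gen(1))
    let ?U = "\<Union>n. a n"
    have "(\<lambda>n. measure M (\<Union>i<n. a i)) \<longlonglongrightarrow> measure M (\<Union>n. \<Union>i<n. a i)"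
      using a by (intro finite_Lim_measure_incseq incseq_SucI) (auto simp: lessThan_Suc)
    moreover have "(\<Union>n. \<Union>i<n. a i) = ?U" by auto
    ultimately have "(\<lambda>n. measure M (\<Union>i<n. a i)) \<longlonglongrightarrow> measure M ?U" by simp
    then obtain n where n: "\<bar>measure M (\<Union>i<n. a i) - measure M ?U\<bar> < \<epsilon> / 2"
      using LIMSEQ_D[of _ _ "\<epsilon> / 2"] Union.prems by (metis half_gt_zero order_refl real_norm_def)
    let ?V = "\<Union>i<n. a i"
    have V: "?V \<in> sets M" "?U \<in> sets M" using a by auto
    have "measure M (?U - ?V) = measure M ?U - measure M ?V"
      using V by (intro finite_measure_Diff) auto
    with n have UV: "measure M (?U - ?V) < \<epsilon> / 2" by linarith
    \<comment> \<open>The \<open>n\<close> errors add up to at most \<open>\<epsilon> / 2\<close>,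
      the other half being the tail of the union; \<open>n + 1\<close> avoids division by
      zero.\<close>
    have "\<exists>A\<in>\<S>. measure M ((A - a i) \<union> (a i - A)) < \<epsilon> / (2 * (real n + 1))" for i
      using Union.IH[of "\<epsilon> / (2 * (real n + 1))" i] Union.prems by simp
    then obtain A where A: "\<And>i. A i \<in> \<S>" "\<And>i. measure M ((A i - a i) \<union> (a i - A i)) < \<epsilon> / (2 * (real n + 1))"
      by metis
    have AM: "A i \<in> sets M" for i using A(1) \<S>(1) by blast
    let ?A = "\<Union>i<n. A i"
    have "?A \<in> \<S>"
    proof (induction n)
      case (Suc n)
      then show ?case using \<S>(3)[OF A(1)[of n]] by (simp add: lessThan_Suc)
    qed (simp add: \<S>(4))
    moreover have "measure M ((?A - ?U) \<union> (?U - ?A)) < \<epsilon>"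
    proof -
      have "measure M ((?A - ?U) \<union> (?U - ?A)) \<le> measure M ((\<Union>i<n. (A i - a i) \<union> (a i - A i)) \<union> (?U - ?V))"
        using a AM V by (intro finite_measure_mono) (auto intro!: sets.finite_UN)
      also have "\<dots> \<le> measure M (\<Union>i<n. (A i - a i) \<union> (a i - A i)) + measure M (?U - ?V)"
        using a AM V by (intro measure_Un_le) auto
      also have "measure M (\<Union>i<n. (A i - a i) \<union> (a i - A i)) \<le> (\<Sum>i<n. measure M ((A i - a i) \<union> (a i - A i)))"
        using a AM by (intro finite_measure_subadditive_finite) auto
      also have "\<dots> \<le> (\<Sum>i<n. \<epsilon> / (2 * (real n + 1)))"
        by (intro sum_mono less_imp_le A(2))
      also have "\<dots> \<le> \<epsilon> / 2"
        using Union.prems by (simp add: field_simps)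
      finally show ?thesis using UV by linarith
    qed
    ultimately show ?case by blast
  qed
qed

section \<open>Cylinders over a finite alphabet\<close>

definition depends_on :: "'i set \<Rightarrow> (('i \<Rightarrow> 's) \<Rightarrow> bool) \<Rightarrow> bool" where
  "depends_on D F \<longleftrightarrow> (\<forall>Y Y'. (\<forall>g\<in>D. Y g = Y' g) \<longrightarrow> F Y = F Y')"

text \<open>Names the atom of the finite algebra generated by \<open>\<A>\<close> that contains
  \<open>a\<close>. This turns an arbitrary base space into a finite alphabet, as the entropy
  argument requires.\<close>

definition label :: "'a set set \<Rightarrow> 'a \<Rightarrow> 'a set set" where
  "label \<A> a = {A \<in> \<A>. a \<in> A}"

definition cylinders :: "'i set \<Rightarrow> 'a measure \<Rightarrow> ('i \<Rightarrow> 'a) set set" where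
  "cylinders I K = {B. \<exists>D \<A> F. finite D \<and> D \<subseteq> I \<and> finite \<A> \<and> \<A> \<subseteq> sets K \<and> depends_on D F \<and>
    B = {y \<in> space (Pi\<^sub>M I (\<lambda>_. K)). F (\<lambda>i. label \<A> (y i))}}"

lemma cylindersI:
  assumes "finite D" "D \<subseteq> I" "finite \<A>" "\<A> \<subseteq> sets K" "depends_on D F"
    and "B = {y \<in> space (Pi\<^sub>M I (\<lambda>_. K)). F (\<lambda>i. label \<A> (y i))}"
  shows "B \<in> cylinders I K"
  unfolding cylinders_def mem_Collect_eq using assms by (intro exI conjI)

lemma cylindersE:
  assumes "B \<in> cylinders I K"
  obtains D \<A> F where "finite D" "D \<subseteq> I" "finite \<A>" "\<A> \<subseteq> sets K" "depends_on D F"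
    "B = {y \<in> space (Pi\<^sub>M I (\<lambda>_. K)). F (\<lambda>i. label \<A> (y i))}"
  using assms unfolding cylinders_def mem_Collect_eq by (elim exE conjE)

lemma label_eq_measurable:
  assumes "finite \<A>" "\<A> \<subseteq> sets K"
  shows "{a \<in> space K. label \<A> a = V} \<in> sets K"
proof (cases "V \<subseteq> \<A>")
  case True
  then have "{a \<in> space K. label \<A> a = V} = {a \<in> space K. \<forall>A\<in>\<A>. a \<in> A \<longleftrightarrow> A \<in> V}"
    by (auto simp: label_def)
  also have "\<dots> \<in> sets K"
  proof (rule sets.sets_Collect_finite_All[OF _ assms(1)])
    fix A assume "A \<in> \<A>"
    then have A: "A \<in> sets K" using assms(2) by blast
    have "{a \<in> space K. a \<in> A \<longleftrightarrow> A \<in> V} = (if A \<in> V then A else space K - A)"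
      using sets.sets_into_space[OF A] by auto
    then show "{a \<in> space K. a \<in> A \<longleftrightarrow> A \<in> V} \<in> sets K" using A by auto
  qed
  finally show ?thesis .
next
  case False
  then have "{a \<in> space K. label \<A> a = V} = {}" by (auto simp: label_def)
  then show ?thesis by (simp only: sets.empty_sets)
qed

lemma label_in_Pow: "label \<A> a \<in> Pow \<A>"
  by (auto simp: label_def)

context prob_space
begin

definition label_pmf :: "'a set set \<Rightarrow> 'a set set pmf" where
  "label_pmf \<A> = embed_pmf (\<lambda>V. measure M {a \<in> space M. label \<A> a = V})"

lemma pmf_label_pmf:
  assumes "finite \<A>" "\<A> \<subseteq> sets M"
  shows "pmf (label_pmf \<A>) V = measure M {a \<in> space M. label \<A> a = V}"
  unfolding label_pmf_def
proof (rule pmf_embed_pmf)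
  let ?\<mu> = "\<lambda>V. measure M {a \<in> space M. label \<A> a = V}"
  have zero: "?\<mu> V = 0" if "V \<notin> Pow \<A>" for V
  proof -
    have "{a \<in> space M. label \<A> a = V} = {}" using that by (auto simp: label_def)
    then show ?thesis by (simp only: measure_empty)
  qed
  have "(\<integral>\<^sup>+V. ennreal (?\<mu> V) \<partial>count_space UNIV) = (\<Sum>V\<in>Pow \<A>. ennreal (?\<mu> V))"
    using assms(1) zero by (intro nn_integral_count_space') auto
  also have "\<dots> = ennreal (\<Sum>V\<in>Pow \<A>. ?\<mu> V)"
    by (intro sum_ennreal) auto
  also have "(\<Sum>V\<in>Pow \<A>. ?\<mu> V) = measure M (\<Union>V\<in>Pow \<A>. {a \<in> space M. label \<A> a = V})"
    using assms label_eq_measurable[OF assms]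
    by (intro finite_measure_finite_Union[symmetric]) (auto simp: disjoint_family_on_def)
  also have "(\<Union>V\<in>Pow \<A>. {a \<in> space M. label \<A> a = V}) = space M"
  proof (intro equalityI subsetI)
    fix a assume "a \<in> space M"
    then have "a \<in> {b \<in> space M. label \<A> b = label \<A> a}" by simp
    then show "a \<in> (\<Union>V\<in>Pow \<A>. {a \<in> space M. label \<A> a = V})"
      by (rule UN_I[OF label_in_Pow])
  qed simp
  finally show "(\<integral>\<^sup>+V. ennreal (?\<mu> V) \<partial>count_space UNIV) = 1" by (simp add: prob_space)
qed simp

lemma set_label_pmf:
  assumes "finite \<A>" "\<A> \<subseteq> sets M"
  shows "set_pmf (label_pmf \<A>) \<subseteq> Pow \<A>"
proof
  fix V assume "V \<in> set_pmf (label_pmf \<A>)"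
  then have "measure M {a \<in> space M. label \<A> a = V} \<noteq> 0"
    by (simp add: set_pmf_iff pmf_label_pmf[OF assms])
  then have "{a \<in> space M. label \<A> a = V} \<noteq> {}" by (metis measure_empty)
  then obtain a where "label \<A> a = V" by blast
  then show "V \<in> Pow \<A>" using label_in_Pow[of \<A> a] by simp
qed

text \<open>The event is a finite disjoint union of boxes, one for each label pattern on
  \<open>E\<close>, and both measures assign a box the same product.\<close>

lemma measure_label_PiM:
  assumes \<A>: "finite \<A>" "\<A> \<subseteq> sets M" and E: "finite E" "E \<subseteq> I" and \<Psi>: "depends_on E \<Psi>"
  shows "measure (Pi\<^sub>M I (\<lambda>_. M)) {y \<in> space (Pi\<^sub>M I (\<lambda>_. M)). \<Psi> (\<lambda>i. label \<A> (y i))}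
    = measure_pmf.prob (Pi_pmf E dflt (\<lambda>_. label_pmf \<A>)) {U. \<Psi> U}"
    and "{y \<in> space (Pi\<^sub>M I (\<lambda>_. M)). \<Psi> (\<lambda>i. label \<A> (y i))} \<in> sets (Pi\<^sub>M I (\<lambda>_. M))"
proof -
  interpret P: product_prob_space "\<lambda>_. M" I by unfold_locales
  let ?N = "Pi\<^sub>M I (\<lambda>_. M)"
  let ?C = "\<lambda>V. {y \<in> space ?N. \<forall>i\<in>E. y i \<in> {a \<in> space M. label \<A> a = V i}}"
  define W where "W = {V \<in> PiE_dflt E dflt (\<lambda>_. Pow \<A>). \<Psi> V}"
  have finW: "finite W"
    unfolding W_def using \<A>(1) E(1) by (intro finite_Collect_conjI disjI1 finite_PiE_dflt) auto
  note lm = label_eq_measurable[OF \<A>]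
  have C: "?C V \<in> sets ?N" for V
    using E lm by (intro sets.sets_Collect_finite_All sets_Collect_single') auto
  have eq: "{y \<in> space ?N. \<Psi> (\<lambda>i. label \<A> (y i))} = (\<Union>V\<in>W. ?C V)"
  proof (intro equalityI subsetI)
    fix y assume y: "y \<in> {y \<in> space ?N. \<Psi> (\<lambda>i. label \<A> (y i))}"
    define V where "V i = (if i \<in> E then label \<A> (y i) else dflt)" for i
    have "\<Psi> V = \<Psi> (\<lambda>i. label \<A> (y i))"
      using \<Psi> by (simp add: depends_on_def V_def)
    moreover have "V \<in> PiE_dflt E dflt (\<lambda>_. Pow \<A>)"
      by (auto simp: PiE_dflt_def V_def label_def)
    ultimately have "V \<in> W" using y by (simp add: W_def)
    moreover have "y \<in> ?C V"
      using y E(2) by (auto simp: V_def space_PiM PiE_iff)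
    ultimately show "y \<in> (\<Union>V\<in>W. ?C V)" by blast
  next
    fix y assume "y \<in> (\<Union>V\<in>W. ?C V)"
    then obtain V where V: "V \<in> W" "y \<in> ?C V" by blast
    then have "\<Psi> V = \<Psi> (\<lambda>i. label \<A> (y i))"
      using \<Psi> by (simp add: depends_on_def)
    then show "y \<in> {y \<in> space ?N. \<Psi> (\<lambda>i. label \<A> (y i))}" using V by (simp add: W_def)
  qed
  show "{y \<in> space ?N. \<Psi> (\<lambda>i. label \<A> (y i))} \<in> sets ?N"
    unfolding eq using finW C by (intro sets.finite_UN) auto
  have "measure ?N {y \<in> space ?N. \<Psi> (\<lambda>i. label \<A> (y i))} = (\<Sum>V\<in>W. measure ?N (?C V))"
    unfolding eq
  proof (rule P.finite_measure_finite_Union[OF finW])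
    show "disjoint_family_on ?C W"
      unfolding disjoint_family_on_def
    proof (intro ballI impI)
      fix V V' assume V: "V \<in> W" "V' \<in> W" "V \<noteq> V'"
      then obtain i where i: "V i \<noteq> V' i" by (meson ext)
      then have "i \<in> E" using V(1,2) unfolding W_def PiE_dflt_def by force
      then show "?C V \<inter> ?C V' = {}" using i by auto
    qed
  qed (use C in auto)
  also have "\<dots> = (\<Sum>V\<in>W. pmf (Pi_pmf E dflt (\<lambda>_. label_pmf \<A>)) V)"
  proof (rule sum.cong)
    fix V assume V: "V \<in> W"
    have "emeasure ?N (?C V) = (\<Prod>i\<in>E. emeasure M {a \<in> space M. label \<A> a = V i})"
      using E lm by (intro P.emeasure_PiM_Collect) auto
    then have "measure ?N (?C V) = (\<Prod>i\<in>E. measure M {a \<in> space M. label \<A> a = V i})"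
      by (simp add: P.emeasure_eq_measure emeasure_eq_measure prod_ennreal prod_nonneg)
    also have "\<dots> = pmf (Pi_pmf E dflt (\<lambda>_. label_pmf \<A>)) V"
      using V E(1) by (subst pmf_Pi') (auto simp: W_def PiE_dflt_def pmf_label_pmf[OF \<A>])
    finally show "measure ?N (?C V) = pmf (Pi_pmf E dflt (\<lambda>_. label_pmf \<A>)) V" .
  qed simp
  also have "\<dots> = measure_pmf.prob (Pi_pmf E dflt (\<lambda>_. label_pmf \<A>)) W"
    using finW by (simp add: measure_measure_pmf_finite)
  also have "\<dots> = measure_pmf.prob (Pi_pmf E dflt (\<lambda>_. label_pmf \<A>)) {U. \<Psi> U}"
    using set_Pi_pmf_subset'[OF E(1), of dflt "\<lambda>_. label_pmf \<A>"] set_label_pmf[OF \<A>]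
    by (intro measure_pmf.finite_measure_eq_AE) (auto simp: AE_measure_pmf_iff W_def PiE_dflt_def, blast)
  finally show "measure ?N {y \<in> space ?N. \<Psi> (\<lambda>i. label \<A> (y i))}
    = measure_pmf.prob (Pi_pmf E dflt (\<lambda>_. label_pmf \<A>)) {U. \<Psi> U}" .
qed

lemma cylinder_approximation:
  assumes B: "B \<in> sets (Pi\<^sub>M I (\<lambda>_. M))" and \<epsilon>: "0 < \<epsilon>"
  shows "\<exists>A\<in>cylinders I M. measure (Pi\<^sub>M I (\<lambda>_. M)) ((A - B) \<union> (B - A)) < \<epsilon>"
proof -
  interpret P: product_prob_space "\<lambda>_. M" I by unfold_locales
  let ?N = "Pi\<^sub>M I (\<lambda>_. M)"
  have S: "cylinders I M \<subseteq> sets ?N"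
  proof
    fix A assume "A \<in> cylinders I M"
    then show "A \<in> sets ?N"
      by (rule cylindersE) (simp only: measure_label_PiM(2))
  qed
  have compl: "space ?N - A \<in> cylinders I M" if A: "A \<in> cylinders I M" for A
  proof -
    obtain D \<A> F where r: "finite D" "D \<subseteq> I" "finite \<A>" "\<A> \<subseteq> sets M" "depends_on D F"
      "A = {y \<in> space ?N. F (\<lambda>i. label \<A> (y i))}"
      using A by (rule cylindersE)
    have "depends_on D (\<lambda>Y. \<not> F Y)"
      unfolding depends_on_def
    proof (intro allI impI)
      fix Y Y' :: "_ \<Rightarrow> 'a set set" assume "\<forall>g\<in>D. Y g = Y' g"
      then have "F Y = F Y'" using r(5) by (simp add: depends_on_def)
      then show "(\<not> F Y) = (\<not> F Y')" by simp
    qed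
    then show ?thesis by (rule cylindersI[OF r(1-4)]) (auto simp: r(6))
  qed
  have union: "A \<union> A' \<in> cylinders I M" if A: "A \<in> cylinders I M" "A' \<in> cylinders I M" for A A'
  proof -
    obtain D \<A> F where r: "finite D" "D \<subseteq> I" "finite \<A>" "\<A> \<subseteq> sets M" "depends_on D F"
      "A = {y \<in> space ?N. F (\<lambda>i. label \<A> (y i))}"
      using A(1) by (rule cylindersE)
    obtain D' \<A>' F' where r': "finite D'" "D' \<subseteq> I" "finite \<A>'" "\<A>' \<subseteq> sets M" "depends_on D' F'"
      "A' = {y \<in> space ?N. F' (\<lambda>i. label \<A>' (y i))}"
      using A(2) by (rule cylindersE)
    \<comment> \<open>Labels over \<open>\<A> \<union> \<A>'\<close> refine both families;
      intersecting with either one recovers its label.\<close>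
    define H where "H Y \<longleftrightarrow> F (\<lambda>i. Y i \<inter> \<A>) \<or> F' (\<lambda>i. Y i \<inter> \<A>')" for Y
    have "depends_on (D \<union> D') H"
      unfolding depends_on_def
    proof (intro allI impI)
      fix Y Y' :: "_ \<Rightarrow> 'a set set" assume "\<forall>g\<in>D \<union> D'. Y g = Y' g"
      then have "F (\<lambda>i. Y i \<inter> \<A>) = F (\<lambda>i. Y' i \<inter> \<A>)" "F' (\<lambda>i. Y i \<inter> \<A>') = F' (\<lambda>i. Y' i \<inter> \<A>')"
        using r(5) r'(5) unfolding depends_on_def by simp_all
      then show "H Y = H Y'" by (simp add: H_def)
    qed
    moreover have "label (\<A> \<union> \<A>') a \<inter> \<A> = label \<A> a" "label (\<A> \<union> \<A>') a \<inter> \<A>' = label \<A>' a" for a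
      by (auto simp: label_def)
    then have "A \<union> A' = {y \<in> space ?N. H (\<lambda>i. label (\<A> \<union> \<A>') (y i))}"
      unfolding H_def r(6) r'(6) by auto
    moreover have "finite (D \<union> D')" "D \<union> D' \<subseteq> I" "finite (\<A> \<union> \<A>')" "\<A> \<union> \<A>' \<subseteq> sets M"
      using r r' by auto
    ultimately show ?thesis by (intro cylindersI)
  qed
  have empty: "{} \<in> cylinders I M"
    by (rule cylindersI[of "{}" _ "{}" _ "\<lambda>_. False"]) (simp_all add: depends_on_def)
  have gen: "{{y \<in> space ?N. y i \<in> A} |i A. i \<in> I \<and> A \<in> sets M} \<subseteq> cylinders I M"
  proof clarify
    fix i A assume iA: "i \<in> I" "A \<in> sets M"
    have "depends_on {i} (\<lambda>Y. A \<in> Y i)" by (simp add: depends_on_def)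
    moreover have "{y \<in> space ?N. y i \<in> A} = {y \<in> space ?N. A \<in> label {A} (y i)}"
      by (auto simp: label_def)
    moreover have "finite {i}" "{i} \<subseteq> I" "finite {A}" "{A} \<subseteq> sets M" using iA by auto
    ultimately show "{y \<in> space ?N. y i \<in> A} \<in> cylinders I M"
      by (intro cylindersI)
  qed
  have sets: "sets ?N = sigma_sets (space ?N) {{y \<in> space ?N. y i \<in> A} |i A. i \<in> I \<and> A \<in> sets M}"
    unfolding sets_PiM_single by (simp add: space_PiM)
  show ?thesis
    by (rule P.approximation_by_algebra[OF sets gen S compl union empty B \<epsilon>])
qed

end

section \<open>Weak containment\<close>

lemma shift_measure_preserving:
  assumes K: "prob_space K" and g: "g \<in> carrier G" and G: "group G"
  shows "shift G g \<in> measurable (bernoulli G K) (bernoulli G K)"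
    and "distr (bernoulli G K) (bernoulli G K) (shift G g) = bernoulli G K"
proof -
  interpret group G by fact
  let ?f = "\<lambda>h. inv\<^bsub>G\<^esub> g \<otimes>\<^bsub>G\<^esub> h"
  have sh: "shift G g = (\<lambda>y. \<lambda>h\<in>carrier G. y (?f h))"
    by (simp add: shift_def fun_eq_iff)
  have f: "inj_on ?f (carrier G)" "?f \<in> carrier G \<rightarrow> carrier G"
    using g by (auto intro!: inj_onI)
  show "shift G g \<in> measurable (bernoulli G K) (bernoulli G K)"
    unfolding bernoulli_def sh using f(2) by (intro measurable_restrict measurable_component_singleton) auto
  show "distr (bernoulli G K) (bernoulli G K) (shift G g) = bernoulli G K"
    unfolding bernoulli_def sh using K f by (intro distr_PiM_reindex)
qed

lemma measure_shift_vimage: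
  assumes K: "prob_space K" and g: "g \<in> carrier G" and G: "group G" and B: "B \<in> sets (bernoulli G K)"
  shows "measure (bernoulli G K) {y \<in> space (bernoulli G K). shift G g y \<in> B} = measure (bernoulli G K) B"
    and "{y \<in> space (bernoulli G K). shift G g y \<in> B} \<in> sets (bernoulli G K)"
proof -
  note sh = shift_measure_preserving[OF K g G]
  have eq: "{y \<in> space (bernoulli G K). shift G g y \<in> B} = shift G g -` B \<inter> space (bernoulli G K)" by auto
  show "{y \<in> space (bernoulli G K). shift G g y \<in> B} \<in> sets (bernoulli G K)"
    unfolding eq by (rule measurable_sets[OF sh(1) B])
  have "measure (bernoulli G K) B = measure (distr (bernoulli G K) (bernoulli G K) (shift G g)) B"
    by (simp only: sh(2))
  also have "\<dots> = measure (bernoulli G K) {y \<in> space (bernoulli G K). shift G g y \<in> B}"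
    unfolding eq by (rule measure_distr[OF sh(1) B])
  finally show "measure (bernoulli G K) {y \<in> space (bernoulli G K). shift G g y \<in> B} = measure (bernoulli G K) B" by simp
qed

lemma sum_bit_eq_0_iff:
  fixes k :: nat
  shows "(\<Sum>j<k. x j :: bit) = 0 \<longleftrightarrow> even (\<Sum>j<k. of_bool (x j = 1) :: nat)"
proof (induction k)
  case (Suc k)
  then show ?case by (cases "x k = 1"; cases "(\<Sum>j<k. x j) = 0") simp_all
qed simp

text \<open>
  Weak containment controls only measures of pairwise intersections. So besides the set \<open>x\<^sub>e = 1\<close> one
  also transports, for every even pattern \<open>c\<close> on \<open>\<langle>s\<^sub>i\<rangle>\<close>, the cylinder \<open>C i c\<close>; its intersections
  with the translates of \<open>x\<^sub>e = 1\<close> are all of it or empty, which determines the pattern on its image.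
\<close>

lemma parity_code_of_weak_containment:
  fixes d k :: nat
  assumes k: "2 \<le> k"
    and haar: "haar_prob_measure (parity_group d k) (parity_topology d k) m"
    and K: "prob_space K"
    and wc: "weakly_contained (Gamma_group d k) m (shift (Gamma_group d k)) (bernoulli (Gamma_group d k) K) (shift (Gamma_group d k))"
    and \<epsilon>: "0 < \<epsilon>"
  defines "N \<equiv> bernoulli (Gamma_group d k) K"
    and "z \<equiv> \<lambda>B i j. {y \<in> space (bernoulli (Gamma_group d k) K).
      shift (Gamma_group d k) (inv\<^bsub>Gamma_group d k\<^esub> (Gamma_gen d k i [^]\<^bsub>Gamma_group d k\<^esub> (j :: nat))) y \<in> B}"
  obtains B where "B \<in> sets N" "\<bar>measure N B - 1 / 2\<bar> < \<epsilon>"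
    "\<And>i. i \<in> {1..d} \<Longrightarrow> measure N {y \<in> space N. odd (\<Sum>j<k. of_bool (y \<in> z B i j) :: nat)} < \<epsilon>"
proof -
  let ?G = "Gamma_group d k"
  interpret G: group ?G by (rule group_Gamma)
  interpret m: prob_space m using haar by (simp add: haar_prob_measure_def)
  interpret N: prob_space N unfolding N_def bernoulli_def using K by (intro prob_space_PiM)
  let ?e = "\<one>\<^bsub>?G\<^esub>" and ?X = "parity_shift d k"
  let ?s = "\<lambda>i j. Gamma_gen d k i [^]\<^bsub>?G\<^esub> (j :: nat)"
  have s: "?s i j \<in> carrier ?G" if "i \<in> {1..d}" for i j
    using Gamma_gen_closed[OF that, of k] by simp
  define Ev where "Ev = {c. c \<subseteq> {..<k} \<and> even (card c)}"
  define C where "C i c = {x \<in> ?X. \<forall>j\<in>{..<k}. x (?s i j) = (if j \<in> c then 1 else 0)}" for i c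
  define A where "A t = (case t of None \<Rightarrow> {x \<in> ?X. x ?e = 1} | Some (i, c) \<Rightarrow> C i c)" for t
  define I where "I = insert None (Some ` ({1..d} \<times> Ev))"
  define F where "F = insert ?e ((\<lambda>(i, j). ?s i j) ` ({1..d} \<times> {..<k}))"
  \<comment> \<open>Each of at most \<open>2 ^ k\<close> patterns costs \<open>\<eta>\<close> for
    its measure and \<open>2 * \<eta>\<close> for each of \<open>k\<close> positions; the final
    \<open>+ 1\<close> makes the bound strict.\<close>
  define \<eta> where "\<eta> = \<epsilon> / (2 ^ k * (2 * real k + 1) + 1)"
  have \<eta>: "0 < \<eta>" using \<epsilon> by (auto simp: \<eta>_def intro!: divide_pos_pos add_nonneg_pos)
  have finEv: "finite Ev" by (rule finite_subset[of _ "Pow {..<k}"]) (auto simp: Ev_def)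
  have cardEv: "real (card Ev) \<le> 2 ^ k"
  proof -
    have "card Ev \<le> card (Pow {..<k})" by (intro card_mono) (auto simp: Ev_def)
    then have "card Ev \<le> 2 ^ k" by (simp add: card_Pow)
    then show ?thesis by (metis of_nat_le_iff of_nat_numeral of_nat_power)
  qed
  have C_sets: "C i c \<in> sets m" if "i \<in> {1..d}" for i c
  proof -
    have "C i c = {x \<in> space m. \<forall>j\<in>{..<k}. x (?s i j) = (if j \<in> c then 1 else 0)}"
      by (simp add: C_def space_haar_parity[OF haar])
    also have "\<dots> \<in> sets m"
    proof (rule sets.sets_Collect_finite_All)
      fix j
      show "{x \<in> space m. x (?s i j) = (if j \<in> c then 1 else 0)} \<in> sets m"
        unfolding space_haar_parity[OF haar] by (rule coordinate_in_sets[OF haar s[OF that]])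
    qed simp
    finally show ?thesis .
  qed
  have A_sets: "A t \<in> sets m" if "t \<in> I" for t
    using that C_sets coordinate_in_sets[OF haar G.one_closed, of 1] by (auto simp: I_def A_def)
  have F: "finite F" "F \<subseteq> carrier ?G" using s by (auto simp: F_def)
  have finI: "finite I" by (simp add: I_def finEv)
  obtain B where B: "\<And>t. t \<in> I \<Longrightarrow> B t \<in> sets N"
    and near: "\<And>g t u. g \<in> F \<Longrightarrow> t \<in> I \<Longrightarrow> u \<in> I \<Longrightarrow>
      \<bar>measure m (shift ?G g ` A t \<inter> A u) - measure N (shift ?G g ` B t \<inter> B u)\<bar> < \<eta>"
    by (rule weakly_containedD[where A = A, OF wc[folded N_def] finI A_sets F \<eta>]) (assumption, rule that)

  have extX: "x \<in> extensional (carrier ?G)" if "x \<in> ?X" for x using that by (rule parity_shift_extensional)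
  have extN: "y \<in> extensional (carrier ?G)" if "y \<in> space N" for y
    using that by (simp add: N_def bernoulli_def space_PiM PiE_def)
  have shN: "shift ?G h y \<in> space N" if "h \<in> carrier ?G" "y \<in> space N" for h y
    using measurable_space[OF shift_measure_preserving(1)[OF K that(1) group_Gamma]] that(2) by (simp add: N_def)
  have shift_e: "shift ?G ?e ` S = S" if "\<And>x. x \<in> S \<Longrightarrow> x \<in> extensional (carrier ?G)" for S :: "(nat gword set \<Rightarrow> 'z) set"
    using G.shift_one[OF that] by (metis (no_types, lifting) image_cong image_ident)
  have A_X: "A t \<subseteq> ?X" for t by (auto simp: A_def C_def split: option.splits)
  have B_N: "B t \<subseteq> space N" if "t \<in> I" for t using sets.sets_into_space[OF B[OF that]] .
  \<comment> \<open>At the identity, with equal indices, the condition on intersections compares the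
    measures of single sets.\<close>
  have near_e: "\<bar>measure m (A t) - measure N (B t)\<bar> < \<eta>" if "t \<in> I" for t
  proof -
    have "shift ?G ?e ` A t = A t" by (rule shift_e) (use A_X extX in blast)
    moreover have "shift ?G ?e ` B t = B t" by (rule shift_e) (use B_N[OF that] extN in blast)
    ultimately show ?thesis using near[of ?e t t] that by (simp add: F_def)
  qed
  have z: "shift ?G (?s i j) ` B None = z (B None) i j" if "i \<in> {1..d}" for i j
    unfolding z_def N_def[symmetric]
    by (rule G.shift_image[OF s[OF that] extN shN]) (use B_N in \<open>auto simp: I_def\<close>)
  have shA: "shift ?G (?s i j) ` A None = {x \<in> ?X. x (?s i j) = 1}" if "i \<in> {1..d}" for i j
  proof -
    have "shift ?G (?s i j) ` A None = {x \<in> ?X. shift ?G (inv\<^bsub>?G\<^esub> ?s i j) x \<in> A None}"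
      by (rule G.shift_image[OF s[OF that] extX shift_parity_shift A_X])
    also have "\<dots> = {x \<in> ?X. x (?s i j) = 1}"
      using s[OF that, of j] shift_parity_shift[of _ d k "inv\<^bsub>?G\<^esub> ?s i j"]
      by (auto simp: A_def shift_def[of _ _ _])
    finally show ?thesis .
  qed

  have None: "None \<in> I" by (simp add: I_def)
  show thesis
  proof (rule that[of "B None"])
    show "B None \<in> sets N" by (rule B[OF None])
    have "\<eta> \<le> \<epsilon> / 1"
      unfolding \<eta>_def using \<epsilon> by (intro divide_left_mono) (auto intro!: add_nonneg_pos)
    then show "\<bar>measure N (B None) - 1 / 2\<bar> < \<epsilon>"
      using near_e[OF None] measure_coordinate[OF haar k] by (simp add: A_def)
    fix i assume i: "i \<in> {1..d}"
    let ?z = "\<lambda>j. z (B None) i j"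
    have zs: "?z j \<in> sets N" for j
      unfolding z_def N_def using s[OF i] B[OF None]
      by (intro measure_shift_vimage(2)[OF K _ group_Gamma]) (auto simp: N_def)
    define good where "good c = {y \<in> B (Some (i, c)). \<forall>j\<in>{..<k}. y \<in> ?z j \<longleftrightarrow> j \<in> c}" for c
    define bad where "bad c = (\<Union>j<k. if j \<in> c then B (Some (i, c)) - ?z j else B (Some (i, c)) \<inter> ?z j)" for c
    have I: "Some (i, c) \<in> I" if "c \<in> Ev" for c using that i by (simp add: I_def)
    have good_bad: "good c = B (Some (i, c)) - bad c" for c
      by (auto simp: good_def bad_def split: if_splits)
    have bad_sets: "bad c \<in> sets N" if "c \<in> Ev" for c
      unfolding bad_def using B[OF I[OF that]] zs by (intro sets.finite_UN) auto
    have good_sets: "good c \<in> sets N" if "c \<in> Ev" for c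
      unfolding good_bad using B[OF I[OF that]] bad_sets[OF that] by auto
    \<comment> \<open>For \<open>j\<close> in \<open>c\<close> the intersection in the parity shift
      is all of \<open>C i c\<close>, and two errors \<open>\<eta>\<close> add up; otherwise it is
      empty and a single \<open>\<eta>\<close> suffices.\<close>
    have bad_small: "measure N (bad c) \<le> real k * (2 * \<eta>)" if c: "c \<in> Ev" for c
    proof -
      let ?D = "\<lambda>j. if j \<in> c then B (Some (i, c)) - ?z j else B (Some (i, c)) \<inter> ?z j"
      have D: "measure N (?D j) \<le> 2 * \<eta>" if j: "j < k" for j
      proof -
        have nr: "\<bar>measure m ({x \<in> ?X. x (?s i j) = 1} \<inter> C i c) - measure N (?z j \<inter> B (Some (i, c)))\<bar> < \<eta>"
        proof -
          have "?s i j \<in> F"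
            unfolding F_def using i j by (intro insertI2 image_eqI[of _ _ "(i, j)"]) auto
          from near[OF this None I[OF c]] show ?thesis
            unfolding shA[OF i] z[OF i] by (simp add: A_def)
        qed
        show ?thesis
        proof (cases "j \<in> c")
          case True
          then have "{x \<in> ?X. x (?s i j) = 1} \<inter> C i c = C i c" using j by (auto simp: C_def)
          moreover have "measure N (B (Some (i, c)) - ?z j) = measure N (B (Some (i, c))) - measure N (?z j \<inter> B (Some (i, c)))"
            using B[OF I[OF c]] zs by (subst N.finite_measure_Diff') (auto simp: Int_commute)
          ultimately show ?thesis
            using True nr near_e[OF I[OF c]] by (simp add: A_def)
        next
          case False
          then have "{x \<in> ?X. x (?s i j) = 1} \<inter> C i c = {}" using j by (auto simp: C_def)
          then show ?thesis using False nr \<eta> by (simp add: Int_commute)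
        qed
      qed
      have "measure N (bad c) \<le> (\<Sum>j<k. measure N (?D j))"
        unfolding bad_def using B[OF I[OF c]] zs by (intro N.finite_measure_subadditive_finite) auto
      also have "\<dots> \<le> (\<Sum>j<k. 2 * \<eta>)" by (intro sum_mono D) simp
      finally show ?thesis by simp
    qed
    \<comment> \<open>The cylinders of even patterns cover the parity shift, so their pairwise
      disjoint good parts nearly exhaust \<open>N\<close>.\<close>
    have "1 = measure m (\<Union>c\<in>Ev. C i c)"
    proof -
      have "x \<in> (\<Union>c\<in>Ev. C i c)" if x: "x \<in> ?X" for x
      proof (rule UN_I)
        let ?c = "{j. j < k \<and> x (?s i j) = 1}"
        have "(\<Sum>j<k. x (?e \<otimes>\<^bsub>?G\<^esub> ?s i j)) = 0"
          using x i G.one_closed unfolding parity_shift_def by blast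
        then have "(\<Sum>j<k. x (?s i j)) = 0"
          using s[OF i] by (simp only: G.l_one)
        then have "even (\<Sum>j<k. of_bool (x (?s i j) = 1) :: nat)" by (simp only: sum_bit_eq_0_iff)
        also have "(\<Sum>j<k. of_bool (x (?s i j) = 1) :: nat) = card ?c"
          by (simp add: Collect_conj_eq lessThan_def)
        finally show "?c \<in> Ev" by (auto simp: Ev_def)
        show "x \<in> C i ?c" using x by (auto simp: C_def)
      qed
      then have "?X \<subseteq> (\<Union>c\<in>Ev. C i c)" by (rule subsetI)
      moreover have "(\<Union>c\<in>Ev. C i c) \<subseteq> ?X" by (auto simp: C_def)
      ultimately have "(\<Union>c\<in>Ev. C i c) = space m" by (simp only: space_haar_parity[OF haar] subset_antisym)
      then show ?thesis by (simp add: m.prob_space)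
    qed
    also have "\<dots> \<le> (\<Sum>c\<in>Ev. measure m (C i c))"
      using finEv C_sets[OF i] by (intro m.finite_measure_subadditive_finite) auto
    also have "\<dots> \<le> (\<Sum>c\<in>Ev. measure N (good c) + \<eta> * (2 * real k + 1))"
    proof (rule sum_mono)
      fix c assume c: "c \<in> Ev"
      have "measure N (B (Some (i, c))) \<le> measure N (good c \<union> bad c)"
        using B[OF I[OF c]] bad_sets[OF c] by (intro N.finite_measure_mono) (auto simp: good_bad)
      also have "\<dots> \<le> measure N (good c) + measure N (bad c)"
        by (rule measure_Un_le[OF good_sets[OF c] bad_sets[OF c]])
      finally show "measure m (C i c) \<le> measure N (good c) + \<eta> * (2 * real k + 1)"
        using bad_small[OF c] near_e[OF I[OF c]] by (simp add: A_def algebra_simps)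
    qed
    also have "\<dots> = measure N (\<Union>c\<in>Ev. good c) + card Ev * (\<eta> * (2 * real k + 1))"
    proof -
      have "c = c'" if "c \<in> Ev" "c' \<in> Ev" "y \<in> good c" "y \<in> good c'" for c c' y
        using that by (auto simp: good_def Ev_def)
      then have "disjoint_family_on good Ev" by (auto simp: disjoint_family_on_def)
      then have "(\<Sum>c\<in>Ev. measure N (good c)) = measure N (\<Union>c\<in>Ev. good c)"
        using good_sets by (intro N.finite_measure_finite_Union[symmetric] finEv) auto
      then show ?thesis by (simp add: sum.distrib)
    qed
    also have "\<dots> \<le> measure N (\<Union>c\<in>Ev. good c) + 2 ^ k * (\<eta> * (2 * real k + 1))"
      using cardEv \<eta> by (intro add_left_mono mult_right_mono) auto
    finally have 1: "1 - measure N (\<Union>c\<in>Ev. good c) \<le> 2 ^ k * (\<eta> * (2 * real k + 1))" by simp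
    have good_UN: "(\<Union>c\<in>Ev. good c) \<in> sets N" using good_sets finEv by (intro sets.finite_UN) auto
    have "{y \<in> space N. odd (\<Sum>j<k. of_bool (y \<in> ?z j) :: nat)} \<subseteq> space N - (\<Union>c\<in>Ev. good c)"
    proof
      fix y assume y: "y \<in> {y \<in> space N. odd (\<Sum>j<k. of_bool (y \<in> ?z j) :: nat)}"
      have "y \<notin> good c" if c: "c \<in> Ev" for c
      proof
        assume "y \<in> good c"
        then have "(\<Sum>j<k. of_bool (y \<in> ?z j) :: nat) = (\<Sum>j<k. of_bool (j \<in> c))"
          by (intro sum.cong) (auto simp: good_def)
        also have "\<dots> = card c" using c by (simp add: Ev_def Int_absorb1)
        finally show False using y c by (simp add: Ev_def)
      qed
      then show "y \<in> space N - (\<Union>c\<in>Ev. good c)" using y by blast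
    qed
    then have "measure N {y \<in> space N. odd (\<Sum>j<k. of_bool (y \<in> ?z j) :: nat)} \<le> measure N (space N - (\<Union>c\<in>Ev. good c))"
      using good_UN by (intro N.finite_measure_mono) auto
    also have "\<dots> = 1 - measure N (\<Union>c\<in>Ev. good c)"
      by (rule N.prob_compl[OF good_UN])
    also note 1
    also have "2 ^ k * (\<eta> * (2 * real k + 1)) < \<eta> * (2 ^ k * (2 * real k + 1) + 1)"
      using \<eta> by (simp add: algebra_simps)
    also have "\<dots> = \<epsilon>"
    proof -
      have "(0 :: real) < 2 ^ k * (2 * real k + 1) + 1" by (intro add_nonneg_pos) auto
      then show ?thesis by (simp add: \<eta>_def)
    qed
    finally show "measure N {y \<in> space N. odd (\<Sum>j<k. of_bool (y \<in> ?z j) :: nat)} < \<epsilon>" .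
  qed
qed


theorem theorem3:
  fixes d k :: nat
    and m\<^sub>X :: "(nat gword set \<Rightarrow> bit) measure"
    and \<kappa> :: "'k measure"
  assumes "k > d" and "d \<ge> 3"
    and "haar_prob_measure (parity_group d k) (parity_topology d k) m\<^sub>X"
    and "standard_prob_space \<kappa>"
  shows "\<not> weakly_contained (Gamma_group d k)
           m\<^sub>X (shift (Gamma_group d k))
           (bernoulli (Gamma_group d k) \<kappa>) (shift (Gamma_group d k))"
proof
  let ?G = "Gamma_group d k" and ?e = "\<one>\<^bsub>Gamma_group d k\<^esub>"
  let ?s = "\<lambda>i j. Gamma_gen d k i [^]\<^bsub>Gamma_group d k\<^esub> (j :: nat)"
  assume wc: "weakly_contained ?G m\<^sub>X (shift ?G) (bernoulli ?G \<kappa>) (shift ?G)"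
  interpret G: group ?G by (rule group_Gamma)
  have \<kappa>: "prob_space \<kappa>" using assms(4) by (simp add: standard_prob_space_def)
  interpret \<kappa>: prob_space \<kappa> by (rule \<kappa>)
  define N where "N = bernoulli ?G \<kappa>"
  interpret N: prob_space N unfolding N_def bernoulli_def using \<kappa> by (intro prob_space_PiM)
  \<comment> \<open>The event that the map with value set \<open>B\<close> outputs one at position
    \<open>j\<close> of the coset of \<open>i\<close> through the identity.\<close>
  define z where "z B i j = {y \<in> space N. shift ?G (inv\<^bsub>?G\<^esub> (?s i j)) y \<in> B}" for B i j
  have s: "?s i j \<in> carrier ?G" if "i \<in> {1..d}" for i j
    using Gamma_gen_closed[OF that, of k] by simp
  have "0 \<le> (2 :: real) ^ (k + 2) + 1" by (intro add_nonneg_nonneg) auto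
  then have "exp (- (2 ^ (k + 2) + 1 :: real)) \<le> 1" by (simp only: exp_le_one_iff neg_le_0_iff_le)
  then have err: "0 < parity_error k" "parity_error k \<le> 1 / 8"
    unfolding parity_error_def by (simp_all del: exp_le_one_iff)
  have dk: "1 \<le> d" "2 \<le> k" using assms(1,2) by auto
  obtain B where B: "B \<in> sets N" "\<bar>measure N B - 1 / 2\<bar> < parity_error k / 2"
    "\<And>i. i \<in> {1..d} \<Longrightarrow> measure N {y \<in> space N. odd (\<Sum>j<k. of_bool (y \<in> z B i j) :: nat)} < parity_error k / 2"
    using parity_code_of_weak_containment[OF dk(2) assms(3) \<kappa> wc, of "parity_error k / 2"] err(1)
    unfolding N_def z_def by auto
  \<comment> \<open>Half of the parity error is spent on \<open>B\<close>, the other half on the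
    \<open>k\<close> translates of the symmetric difference of \<open>A\<close> and
    \<open>B\<close>.\<close>
  define \<eta> where "\<eta> = parity_error k / (2 * real k)"
  have \<eta>: "0 < \<eta>" using err dk by (simp add: \<eta>_def)
  obtain A where A: "A \<in> cylinders (carrier ?G) \<kappa>" "measure N ((A - B) \<union> (B - A)) < \<eta>"
    using \<kappa>.cylinder_approximation[of B "carrier ?G" \<eta>] B(1) \<eta> unfolding N_def bernoulli_def by blast
  obtain D \<A> F where D: "finite D" "D \<subseteq> carrier ?G" and \<A>: "finite \<A>" "\<A> \<subseteq> sets \<kappa>"
    and F: "depends_on D F" and A_eq: "A = {y \<in> space N. F (\<lambda>i. label \<A> (y i))}"
    using A(1) unfolding N_def bernoulli_def by (rule cylindersE)
  have A_sets: "A \<in> sets N"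
    unfolding A_eq N_def bernoulli_def by (rule \<kappa>.measure_label_PiM(2)[OF \<A> D F])
  define E where "E = D \<union> (\<lambda>(i, j, g). ?s i j \<otimes>\<^bsub>?G\<^esub> g) ` ({1..d} \<times> {..<k} \<times> D)"
  have E: "finite E" "E \<subseteq> carrier ?G" "D \<subseteq> E"
    using D s by (auto simp: E_def)
  have DE: "?s i j \<otimes>\<^bsub>?G\<^esub> g \<in> E" if "i \<in> {1..d}" "j < k" "g \<in> D" for i j g
    unfolding E_def using that by (intro UnI2 image_eqI[of _ _ "(i, j, g)"]) auto
  have FD: "F Y = F Y'" if "\<And>g. g \<in> D \<Longrightarrow> Y g = Y' g" for Y Y'
    using F that by (simp add: depends_on_def)
  let ?\<Psi> = "\<lambda>i U. odd (\<Sum>j<k. of_bool (F (\<lambda>g. U (?s i j \<otimes>\<^bsub>?G\<^esub> g))) :: nat)"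
  have FE: "depends_on E F"
    unfolding depends_on_def using FD E(3) by blast
  have \<Psi>E: "depends_on E (?\<Psi> i)" if i: "i \<in> {1..d}" for i
    unfolding depends_on_def
  proof (intro allI impI)
    fix Y Y' :: "nat gword set \<Rightarrow> 'k set set" assume Y: "\<forall>g\<in>E. Y g = Y' g"
    have "F (\<lambda>g. Y (?s i j \<otimes>\<^bsub>?G\<^esub> g)) = F (\<lambda>g. Y' (?s i j \<otimes>\<^bsub>?G\<^esub> g))" if "j < k" for j
      using Y DE[OF i that] by (intro FD) blast
    then show "?\<Psi> i Y = ?\<Psi> i Y'"
      by (intro arg_cong[where f = odd] sum.cong) auto
  qed
  have close: "\<bar>measure N A - measure N B\<bar> < \<eta>"
  proof -
    have "measure N A \<le> measure N (B \<union> ((A - B) \<union> (B - A)))"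
      using A_sets B(1) by (intro N.finite_measure_mono) auto
    also have "\<dots> \<le> measure N B + measure N ((A - B) \<union> (B - A))"
      using A_sets B(1) by (intro measure_Un_le) auto
    finally have 1: "measure N A < measure N B + \<eta>" using A(2) by simp
    have "measure N B \<le> measure N (A \<union> ((A - B) \<union> (B - A)))"
      using A_sets B(1) by (intro N.finite_measure_mono) auto
    also have "\<dots> \<le> measure N A + measure N ((A - B) \<union> (B - A))"
      using A_sets B(1) by (intro measure_Un_le) auto
    finally show ?thesis using 1 A(2) by simp
  qed
  \<comment> \<open>At most \<open>1 / 8\<close> from the approximation and \<open>1 / 16\<close>
    from \<open>B\<close> keep the density of \<open>A\<close> within \<open>1 / 4\<close> of
    \<open>1 / 2\<close>.\<close>
  have "\<eta> \<le> 1 / 8"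
  proof -
    have "\<eta> \<le> parity_error k / 1"
      unfolding \<eta>_def using err(1) dk by (intro divide_left_mono) auto
    then show ?thesis using err(2) by simp
  qed
  then have density: "1 / 4 \<le> measure N A" "measure N A \<le> 3 / 4"
    using close B(2) err(2) by linarith+
  have dens_eq: "measure N A = measure_pmf.prob (Pi_pmf E {} (\<lambda>_. \<kappa>.label_pmf \<A>)) {U. F U}"
    unfolding A_eq N_def bernoulli_def by (rule \<kappa>.measure_label_PiM(1)[OF \<A> E(1,2) FE])
  have z_sets: "z S i j \<in> sets N" "measure N (z S i j) = measure N S" if "i \<in> {1..d}" "S \<in> sets N" for S i j
    using measure_shift_vimage[OF \<kappa> G.inv_closed[OF s[OF that(1)]] group_Gamma, of S j] that(2)
    by (simp_all add: z_def N_def)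
  have zA: "y \<in> z A i j \<longleftrightarrow> F (\<lambda>g. label \<A> (y (?s i j \<otimes>\<^bsub>?G\<^esub> g)))" if i: "i \<in> {1..d}" and y: "y \<in> space N" for i j y
  proof -
    have "shift ?G (inv\<^bsub>?G\<^esub> (?s i j)) y \<in> space N"
      using measurable_space[OF shift_measure_preserving(1)[OF \<kappa> G.inv_closed[OF s[OF i]] group_Gamma]] y
      by (simp add: N_def)
    then have "y \<in> z A i j \<longleftrightarrow> F (\<lambda>g. label \<A> (shift ?G (inv\<^bsub>?G\<^esub> (?s i j)) y g))"
      using y by (simp add: z_def A_eq)
    also have "\<dots> \<longleftrightarrow> F (\<lambda>g. label \<A> (y (?s i j \<otimes>\<^bsub>?G\<^esub> g)))"
      using D(2) s[OF i, of j] by (intro FD) (auto simp: shift_def)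
    finally show ?thesis .
  qed
  have parity: "measure_pmf.prob (Pi_pmf E {} (\<lambda>_. \<kappa>.label_pmf \<A>)) {U. ?\<Psi> i U} \<le> parity_error k" if i: "i \<in> {1..d}" for i
  proof -
    let ?odd = "\<lambda>S. {y \<in> space N. odd (\<Sum>j<k. of_bool (y \<in> z S i j) :: nat)}"
    let ?\<Delta> = "\<lambda>j. z ((A - B) \<union> (B - A)) i j"
    have AB: "(A - B) \<union> (B - A) \<in> sets N" using A_sets B(1) by auto
    have [measurable]: "z B i j \<in> sets N" for j by (rule z_sets(1)[OF i B(1)])
    have odd_sets: "?odd B \<in> sets N" by measurable
    have \<Delta>_sets: "(\<Union>j<k. ?\<Delta> j) \<in> sets N" using z_sets(1)[OF i AB] by (intro sets.finite_UN) auto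
    have "measure_pmf.prob (Pi_pmf E {} (\<lambda>_. \<kappa>.label_pmf \<A>)) {U. ?\<Psi> i U}
      = measure N {y \<in> space N. ?\<Psi> i (\<lambda>g. label \<A> (y g))}"
      unfolding N_def bernoulli_def by (rule \<kappa>.measure_label_PiM(1)[OF \<A> E(1,2) \<Psi>E[OF i], symmetric])
    also have "{y \<in> space N. ?\<Psi> i (\<lambda>g. label \<A> (y g))} = ?odd A"
      using zA[OF i] by (intro Collect_cong conj_cong HOL.refl arg_cong[where f = odd] sum.cong) simp_all
    also have "measure N (?odd A) \<le> measure N (?odd B \<union> (\<Union>j<k. ?\<Delta> j))"
    proof (rule N.finite_measure_mono)
      show "?odd A \<subseteq> ?odd B \<union> (\<Union>j<k. ?\<Delta> j)"
      proof
        fix y assume y: "y \<in> ?odd A"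
        show "y \<in> ?odd B \<union> (\<Union>j<k. ?\<Delta> j)"
        proof (cases "\<exists>j<k. y \<in> ?\<Delta> j")
          case False
          then have "y \<in> z A i j \<longleftrightarrow> y \<in> z B i j" if "j < k" for j
            using that y by (auto simp: z_def)
          then have "(\<Sum>j<k. of_bool (y \<in> z A i j) :: nat) = (\<Sum>j<k. of_bool (y \<in> z B i j))"
            by (intro sum.cong) auto
          then show ?thesis using y by simp
        qed auto
      qed
      show "?odd B \<union> (\<Union>j<k. ?\<Delta> j) \<in> sets N"
        using odd_sets \<Delta>_sets by (rule sets.Un)
    qed
    also have "\<dots> \<le> measure N (?odd B) + measure N (\<Union>j<k. ?\<Delta> j)"
      by (rule measure_Un_le[OF odd_sets \<Delta>_sets])
    also have "measure N (\<Union>j<k. ?\<Delta> j) \<le> (\<Sum>j<k. measure N (?\<Delta> j))"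
      using z_sets(1)[OF i AB] by (intro N.finite_measure_subadditive_finite) auto
    also have "\<dots> \<le> (\<Sum>j<k. \<eta>)"
      using A(2) by (intro sum_mono) (simp add: z_sets(2)[OF i AB])
    also have "\<dots> = parity_error k / 2"
      using dk by (simp add: \<eta>_def)
    finally show ?thesis using B(3)[OF i] by simp
  qed
  show False
  proof (rule no_parity_block_code[OF assms(2,1) _ E DE FD])
    show "finite (set_pmf (\<kappa>.label_pmf \<A>))"
      using \<kappa>.set_label_pmf[OF \<A>] \<A>(1) by (meson finite_Pow_iff finite_subset)
    show "1 / 4 \<le> measure_pmf.prob (Pi_pmf E {} (\<lambda>_. \<kappa>.label_pmf \<A>)) {U. F U}"
      "measure_pmf.prob (Pi_pmf E {} (\<lambda>_. \<kappa>.label_pmf \<A>)) {U. F U} \<le> 3 / 4"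
      using density by (simp_all add: dens_eq)
  qed (assumption | (rule parity, assumption) | blast)+
qed

end
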